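(* Let $V\in L^1(\mathbb{R})\cap L^2(\mathbb{R})$ be real-valued. Let $f\in C_0^\infty(\mathbb{R})$. Suppose $0<\alpha<\beta$ are such that $[\sqrt\alpha,\sqrt\beta\,]\cap\mathcal{E}_0=\emptyset$. Then $$\|P_{[\alpha,\beta)}f\|_{L^2}^2=\int_{\alpha\le\xi^2\le\beta}|f^\sharp(\xi)|^2\,d\xi.$$
   Context: $L^2=L^2(\mathbb{R})$. $H$ is the unique self-adjoint extension of $-d^2/dx^2+V$ from $C_0^\infty(\mathbb{R})$ (domain $W^{2,2}(\mathbb{R})$). For a Borel set $A\subset\mathbb{R}$, $P_A=\chi_A(H)$ is the spectral projection of $H$. Put $V^{1/2}=|V|^{1/2}\,\mathrm{sgn}\,V$. For $k>0$ let $T(k)$ be the (Hilbert–Schmidt) operator on $L^2$ with kernel $-(2ik)^{-1}|V(x)|^{1/2}e^{ik|x-y|}V^{1/2}(y)$. $\mathcal{E}_0\subset(0,\infty)$ denotes a fixed bounded set of measure zero with $\mathcal{E}_0\cup\{0\}$ closed such that $I+T(k)$ has a bounded inverse on $L^2$ for all $k\in(0,\infty)\setminus\mathcal{E}_0$. For $\xi\in\mathbb{R}$ with $|\xi|\in(0,\infty)\setminus\mathcal{E}_0$, let $\psi(\cdot,\xi)\in L^2$ be the unique solution of $(I+T(|\xi|))\psi(\cdot,\xi)=|V(x)|^{1/2}e^{ix\xi}$, and set $$e(x,\xi)=e^{ix\xi}+(2i|\xi|)^{-1}\int_{-\infty}^\infty e^{i|\xi||x-y|}V^{1/2}(y)\psi(y,\xi)\,dy.$$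 This $e(\cdot,\xi)$ is bounded and satisfies $e(x,\xi)=e^{ix\xi}+(2i|\xi|)^{-1}\int e^{i|\xi||x-y|}V(y)e(y,\xi)\,dy$. For $f\in C_0^\infty(\mathbb{R})$ and a.e. $\xi$, $f^\sharp(\xi)=(2\pi)^{-1/2}\int_{-\infty}^\infty f(x)\overline{e(x,\xi)}\,dx$. *)

theory Defs
  imports "HOL-Analysis.Analysis"
begin

text \<open>
  Elements of \<open>L\<^sup>2(\<real>)\<close> (complex-valued) are handled through Borel representatives; equality
  in \<open>L\<^sup>2\<close> is equality almost everywhere.
\<close>

definition L2 :: "(real \<Rightarrow> complex) set" where
  "L2 = {f. f \<in> borel_measurable lborel \<and> integrable lborel (\<lambda>x. (cmod (f x))\<^sup>2)}"

definition l2_inner :: "(real \<Rightarrow> complex) \<Rightarrow> (real \<Rightarrow> complex) \<Rightarrow> complex" where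
  "l2_inner f g = (LINT x|lborel. f x * cnj (g x))"

definition l2_norm :: "(real \<Rightarrow> complex) \<Rightarrow> real" where
  "l2_norm f = sqrt (LINT x|lborel. (cmod (f x))\<^sup>2)"

definition ae_eq :: "(real \<Rightarrow> complex) \<Rightarrow> (real \<Rightarrow> complex) \<Rightarrow> bool" (infix "\<approx>" 50) where
  "f \<approx> g \<longleftrightarrow> (AE x in lborel. f x = g x)"

text \<open>
  Linearity and boundedness together make such an operator respect \<open>\<approx>\<close>, so it descends to
  equivalence classes.
\<close>

definition l2_bounded_op :: "((real \<Rightarrow> complex) \<Rightarrow> real \<Rightarrow> complex) \<Rightarrow> bool" where
  "l2_bounded_op B \<longleftrightarrow>
     (\<forall>f\<in>L2. B f \<in> L2) \<and>
     (\<forall>f\<in>L2. \<forall>g\<in>L2. \<forall>a. B (\<lambda>x. a * f x + g x) \<approx> (\<lambda>x. a * B f x + B g x)) \<and>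
     (\<exists>C. \<forall>f\<in>L2. l2_norm (B f) \<le> C * l2_norm f)"

definition l2_has_bounded_inverse :: "((real \<Rightarrow> complex) \<Rightarrow> real \<Rightarrow> complex) \<Rightarrow> bool" where
  "l2_has_bounded_inverse B \<longleftrightarrow>
     (\<exists>S. l2_bounded_op S \<and> (\<forall>f\<in>L2. B (S f) \<approx> f \<and> S (B f) \<approx> f))"

definition l2_orthogonal_projection :: "((real \<Rightarrow> complex) \<Rightarrow> real \<Rightarrow> complex) \<Rightarrow> bool" where
  "l2_orthogonal_projection B \<longleftrightarrow>
     l2_bounded_op B \<and> (\<forall>f\<in>L2. B (B f) \<approx> B f) \<and>
     (\<forall>f\<in>L2. \<forall>g\<in>L2. l2_inner (B f) g = l2_inner f (B g))"

text \<open>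
  Unbounded operators in \<open>L\<^sup>2(\<real>)\<close> are given by their graphs, which contain all
  representatives; the domain is the \<^const>\<open>Domain\<close> of the graph.
\<close>

type_synonym l2_graph = "((real \<Rightarrow> complex) \<times> (real \<Rightarrow> complex)) set"

definition l2_adjoint :: "l2_graph \<Rightarrow> l2_graph" where
  "l2_adjoint A =
     {(g, h). g \<in> L2 \<and> h \<in> L2 \<and> (\<forall>(f, u)\<in>A. l2_inner u g = l2_inner f h)}"

definition l2_densely_defined :: "l2_graph \<Rightarrow> bool" where
  "l2_densely_defined A \<longleftrightarrow>
     (\<forall>g\<in>L2. \<forall>\<epsilon>>0. \<exists>f\<in>Domain A. l2_norm (\<lambda>x. f x - g x) < \<epsilon>)"

text \<open>
  An adjoint is always a linear subspace of \<open>L\<^sup>2 \<times> L\<^sup>2\<close> closed under \<open>\<approx>\<close>, and the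
  adjoint of a densely defined graph is single-valued up to \<open>\<approx>\<close>, so \<open>A = A\<^sup>*\<close> already
  makes \<open>A\<close> the graph of a linear operator.
\<close>

definition l2_self_adjoint :: "l2_graph \<Rightarrow> bool" where
  "l2_self_adjoint A \<longleftrightarrow> l2_densely_defined A \<and> l2_adjoint A = A"

definition vderiv :: "(real \<Rightarrow> complex) \<Rightarrow> real \<Rightarrow> complex" where
  "vderiv f = (\<lambda>x. vector_derivative f (at x))"

definition test_functions :: "(real \<Rightarrow> complex) set" where
  "test_functions =
     {f. (\<forall>n x. (vderiv ^^ n) f differentiable (at x)) \<and> compact (closure {x. f x \<noteq> 0})}"

definition weak_derivative :: "(real \<Rightarrow> complex) \<Rightarrow> (real \<Rightarrow> complex) \<Rightarrow> bool" where
  "weak_derivative f g \<longleftrightarrow>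
     (\<forall>\<phi>\<in>test_functions. (LINT x|lborel. f x * vderiv \<phi> x) = - (LINT x|lborel. g x * \<phi> x))"

definition W22 :: "(real \<Rightarrow> complex) set" where
  "W22 = {f \<in> L2. \<exists>g\<in>L2. \<exists>h\<in>L2. weak_derivative f g \<and> weak_derivative g h}"

definition minimal_schroedinger :: "(real \<Rightarrow> real) \<Rightarrow> l2_graph" where
  "minimal_schroedinger V =
     {(\<phi>, \<lambda>x. - vderiv (vderiv \<phi>) x + complex_of_real (V x) * \<phi> x) | \<phi>. \<phi> \<in> test_functions}"

definition schroedinger_operator :: "(real \<Rightarrow> real) \<Rightarrow> l2_graph \<Rightarrow> bool" where
  "schroedinger_operator V H \<longleftrightarrow>
     l2_self_adjoint H \<and> minimal_schroedinger V \<subseteq> H \<and> Domain H = W22"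

text \<open>
  Projection-valued measures on the Borel sets of the real line; countable additivity is in the
  strong operator topology.
\<close>

definition projection_valued_measure ::
    "(real set \<Rightarrow> (real \<Rightarrow> complex) \<Rightarrow> real \<Rightarrow> complex) \<Rightarrow> bool" where
  "projection_valued_measure P \<longleftrightarrow>
     (\<forall>A\<in>sets borel. l2_orthogonal_projection (P A)) \<and>
     (\<forall>f\<in>L2. P {} f \<approx> (\<lambda>x. 0) \<and> P UNIV f \<approx> f) \<and>
     (\<forall>A\<in>sets borel. \<forall>B\<in>sets borel. \<forall>f\<in>L2. P A (P B f) \<approx> P (A \<inter> B) f) \<and>
     (\<forall>A::nat \<Rightarrow> real set. range A \<subseteq> sets borel \<longrightarrow> disjoint_family A \<longrightarrow>
        (\<forall>f\<in>L2. (\<lambda>N. l2_norm (\<lambda>x. P (\<Union>n. A n) f x - (\<Sum>n<N. P (A n) f x))) \<longlonglongrightarrow> 0))"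

definition spectral_distribution ::
    "(real set \<Rightarrow> (real \<Rightarrow> complex) \<Rightarrow> real \<Rightarrow> complex) \<Rightarrow> (real \<Rightarrow> complex) \<Rightarrow> real measure" where
  "spectral_distribution P f =
     measure_of UNIV (sets borel) (\<lambda>A. ennreal (Re (l2_inner (P A f) f)))"

text \<open>
  \<open>P\<close> is the spectral measure \<open>A \<mapsto> \<chi>\<^sub>A(H)\<close> of \<open>H\<close>, that is
  \<open>H = \<integral> \<lambda> dP(\<lambda>)\<close>: the domain of \<open>H\<close> consists of the \<open>f\<close> with
  \<open>\<integral> \<lambda>\<^sup>2 d(P(\<lambda>)f, f) < \<infinity>\<close>, and \<open>(Hf, f) = \<integral> \<lambda> d(P(\<lambda>)f, f)\<close> there.
  By polarization the quadratic form determines the operator, and by the uniqueness part of the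
  spectral theorem a self-adjoint \<open>H\<close> determines \<open>P\<close> up to \<open>\<approx>\<close>.
\<close>

definition spectral_measure_of ::
    "l2_graph \<Rightarrow> (real set \<Rightarrow> (real \<Rightarrow> complex) \<Rightarrow> real \<Rightarrow> complex) \<Rightarrow> bool" where
  "spectral_measure_of H P \<longleftrightarrow>
     projection_valued_measure P \<and>
     Domain H = {f \<in> L2. integrable (spectral_distribution P f) (\<lambda>t. t\<^sup>2)} \<and>
     (\<forall>(f, h)\<in>H. l2_inner h f = complex_of_real (LINT t|spectral_distribution P f. t))"

definition signed_sqrt :: "(real \<Rightarrow> real) \<Rightarrow> real \<Rightarrow> real" where
  "signed_sqrt V x = sqrt \<bar>V x\<bar> * sgn (V x)"

definition T_op :: "(real \<Rightarrow> real) \<Rightarrow> real \<Rightarrow> (real \<Rightarrow> complex) \<Rightarrow> real \<Rightarrow> complex" where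
  "T_op V k \<phi> x =
     (LINT y|lborel. - (1 / (2 * \<i> * of_real k)) * of_real (sqrt \<bar>V x\<bar>) *
        exp (\<i> * of_real (k * \<bar>x - y\<bar>)) * of_real (signed_sqrt V y) * \<phi> y)"

definition exceptional_set :: "(real \<Rightarrow> real) \<Rightarrow> real set \<Rightarrow> bool" where
  "exceptional_set V E0 \<longleftrightarrow>
     E0 \<subseteq> {0<..} \<and> bounded E0 \<and> E0 \<in> null_sets lborel \<and> closed (E0 \<union> {0}) \<and>
     (\<forall>k\<in>{0<..} - E0. l2_has_bounded_inverse (\<lambda>\<phi> x. \<phi> x + T_op V k \<phi> x))"

text \<open>
  Where \<open>I + T(\<bar>\<xi>\<bar>)\<close> is invertible the solution below is unique up to \<open>\<approx>\<close>, and
  \<open>eigenfn\<close> and \<open>sharp\<close> do not depend on the representative chosen. For other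
  \<open>\<xi>\<close> the value is arbitrary.
\<close>

definition psi :: "(real \<Rightarrow> real) \<Rightarrow> real \<Rightarrow> real \<Rightarrow> complex" where
  "psi V \<xi> = (SOME \<psi>. \<psi> \<in> L2 \<and>
     (\<lambda>x. \<psi> x + T_op V \<bar>\<xi>\<bar> \<psi> x) \<approx>
       (\<lambda>x. of_real (sqrt \<bar>V x\<bar>) * exp (\<i> * of_real (x * \<xi>))))"

definition eigenfn :: "(real \<Rightarrow> real) \<Rightarrow> real \<Rightarrow> real \<Rightarrow> complex" where
  "eigenfn V x \<xi> =
     exp (\<i> * of_real (x * \<xi>)) +
     1 / (2 * \<i> * of_real \<bar>\<xi>\<bar>) *
       (LINT y|lborel. exp (\<i> * of_real (\<bar>\<xi>\<bar> * \<bar>x - y\<bar>)) * of_real (signed_sqrt V y) * psi V \<xi> y)"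

definition sharp :: "(real \<Rightarrow> real) \<Rightarrow> (real \<Rightarrow> complex) \<Rightarrow> real \<Rightarrow> complex" where
  "sharp V f \<xi> = of_real (1 / sqrt (2 * pi)) * (LINT x|lborel. f x * cnj (eigenfn V x \<xi>))"

end

theory Submission
  imports Defs
begin

text \<open>
  This is Stone's formula. Put \<open>g = cnj f\<close>. For \<open>Im k > 0\<close> the Birman--Schwinger equation with source
  \<open>g\<close> yields a solution of \<open>v = R\<^sub>0(k\<^sup>2) (g - V v)\<close>; its conjugate \<open>u\<close> lies in the domain of \<open>H\<close> and
  satisfies \<open>(H - cnj (k\<^sup>2)) u = f\<close>, so the imaginary part of the inner product of \<open>f\<close> and \<open>u\<close> is the
  Poisson integral of the spectral distribution of \<open>f\<close>. Since \<open>T(k)\<close> is norm continuous up to the real axis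
  and solvability of the equation is an open condition, this Poisson integral has a continuous boundary value
  over \<open>[\<alpha>, \<beta>]\<close>, which is therefore the density of the spectral distribution there. For real \<open>k\<close>, writing
  \<open>w = g - V v\<close>, the imaginary part of \<open>\<integral> v cnj g = \<integral> v cnj w + \<integral> V \<bar>v\<bar>\<^sup>2\<close> only sees the free resolvent,
  whose imaginary part is the Fourier transform on the energy shell, and
  \<open>\<integral> w e\<^sup>i\<^sup>x\<^sup>\<xi> = \<integral> g e(\<cdot>, \<xi>)\<close> by transposing the Lippmann--Schwinger equation. The conjugation of \<open>f\<close> is what makes
  the outgoing eigenfunctions appear as \<open>\<integral> f cnj e\<close>.
\<close>

text \<open>The hypothesis on \<open>P\<close> gives only the domain of \<open>H\<close> and the
  diagonal form (Hf, f), nothing about functions of \<open>H\<close>, so the Poisson integral has to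
  be extracted from the quadratic form. The form splits over a Borel set and its complement, hence
  \<open>P A\<close> commutes with \<open>H\<close>. On a cell of length \<delta> around t0 the
  operator H - t0 then has norm at most \<delta>, so (H - \<zeta>) u = f becomes a two-sided
  comparison of the spectral masses of f and u on that cell. Summing over a grid and refining it
  gives the norm of u, and Im (f, u) is - Im \<zeta> times its square. For real k the free resolvent
  does not map into L2. This is why V is split into two square roots and why limits at the real axis
  are taken only for sqrt |V| v in L2 or for pairings of v with integrable functions. The action of
  \<open>H\<close> on its domain is not given by a formula either: u lies in \<open>W22\<close>, and
  Hu is identified by testing against smooth functions, whose density is proved with explicit bumps.
  Energies are written \<kappa>^2, so that \<xi> = \<kappa> and \<xi> = -\<kappa> share one
  parameter k.\<close>

section \<open>The space of square-integrable functions\<close>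

lemma L2_measurable [measurable_dest]: "f \<in> L2 \<Longrightarrow> f \<in> borel_measurable borel"
  by (simp add: L2_def)

lemma L2_measurable' [measurable_dest]: "f \<in> L2 \<Longrightarrow> f \<in> borel_measurable lborel"
  by (simp add: L2_def)

lemma L2_integrable_square: "f \<in> L2 \<Longrightarrow> integrable lborel (\<lambda>x. (cmod (f x))\<^sup>2)"
  by (simp add: L2_def)

lemma l2_norm_nonneg [simp]: "0 \<le> l2_norm f"
  by (simp add: l2_norm_def)

lemma l2_norm_power2: "(l2_norm f)\<^sup>2 = (LINT x|lborel. (cmod (f x))\<^sup>2)"
  by (simp add: l2_norm_def)

lemma L2_bound:
  assumes "f \<in> borel_measurable lborel" "integrable lborel g" "AE x in lborel. (cmod (f x))\<^sup>2 \<le> g x"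
  shows "f \<in> L2"
  unfolding L2_def using assms
  by (auto intro!: Bochner_Integration.integrable_bound[of lborel g])

lemma square_sum_le: "(cmod (a + b))\<^sup>2 \<le> 2 * (cmod a)\<^sup>2 + 2 * (cmod b)\<^sup>2"
proof -
  have "(cmod (a + b))\<^sup>2 \<le> (cmod a + cmod b)\<^sup>2"
    by (intro power_mono norm_triangle_ineq) auto
  also have "\<dots> \<le> 2 * (cmod a)\<^sup>2 + 2 * (cmod b)\<^sup>2"
    using sum_squares_bound[of "cmod a" "cmod b"] by (simp add: power2_sum)
  finally show ?thesis .
qed

lemma L2_add [intro]: "f \<in> L2 \<Longrightarrow> g \<in> L2 \<Longrightarrow> (\<lambda>x. f x + g x) \<in> L2"
  by (rule L2_bound[where g = "\<lambda>x. 2 * (cmod (f x))\<^sup>2 + 2 * (cmod (g x))\<^sup>2"])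
     (auto simp: L2_integrable_square square_sum_le)

lemma L2_cmult [intro]: "f \<in> L2 \<Longrightarrow> (\<lambda>x. c * f x) \<in> L2"
  by (rule L2_bound[where g = "\<lambda>x. (cmod c)\<^sup>2 * (cmod (f x))\<^sup>2"])
     (auto simp: L2_integrable_square norm_mult power_mult_distrib)

lemma L2_minus [intro]: "f \<in> L2 \<Longrightarrow> (\<lambda>x. - f x) \<in> L2"
  using L2_cmult[of f "-1"] by simp

lemma L2_diff [intro]: "f \<in> L2 \<Longrightarrow> g \<in> L2 \<Longrightarrow> (\<lambda>x. f x - g x) \<in> L2"
  using L2_add[of f "\<lambda>x. - g x"] by auto

lemma borel_measurable_cnj' [measurable (raw)]:
  "f \<in> borel_measurable M \<Longrightarrow> (\<lambda>x. cnj (f x)) \<in> borel_measurable M"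
  by (rule borel_measurable_continuous_on[where f = cnj]) (auto intro: continuous_on_cnj continuous_on_id)

lemma L2_cnj [intro]: "f \<in> L2 \<Longrightarrow> (\<lambda>x. cnj (f x)) \<in> L2"
  by (rule L2_bound[where g = "\<lambda>x. (cmod (f x))\<^sup>2"]) (auto simp: L2_integrable_square)

lemma L2_zero [intro, simp]: "(\<lambda>x. 0) \<in> L2"
  by (simp add: L2_def)

lemma L2_sum [intro]: "(\<And>i. i \<in> I \<Longrightarrow> f i \<in> L2) \<Longrightarrow> (\<lambda>x. \<Sum>i\<in>I. f i x) \<in> L2"
  by (induction I rule: infinite_finite_induct) auto

lemma L2_mult_bounded:
  assumes "f \<in> L2" "g \<in> borel_measurable lborel" "\<And>x. cmod (g x) \<le> B"
  shows "(\<lambda>x. g x * f x) \<in> L2"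
proof (rule L2_bound[where g = "\<lambda>x. B\<^sup>2 * (cmod (f x))\<^sup>2"])
  show "AE x in lborel. (cmod (g x * f x))\<^sup>2 \<le> B\<^sup>2 * (cmod (f x))\<^sup>2"
    by (intro AE_I2) (auto simp: norm_mult power_mult_distrib intro!: mult_right_mono power_mono assms)
qed (use assms L2_integrable_square in auto)

lemma mult_le_sum_squares:
  fixes a b :: real
  assumes "0 \<le> a" "0 \<le> b"
  shows "a * b \<le> a\<^sup>2 + b\<^sup>2"
proof -
  have "0 \<le> a * b"
    using assms by simp
  then show ?thesis
    using sum_squares_bound[of a b] by linarith
qed

lemma L2_mult_integrable:
  assumes "f \<in> L2" "g \<in> L2"
  shows "integrable lborel (\<lambda>x. f x * g x)"
proof (rule Bochner_Integration.integrable_bound[of lborel "\<lambda>x. (cmod (f x))\<^sup>2 + (cmod (g x))\<^sup>2"])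
  show "AE x in lborel. norm (f x * g x) \<le> norm ((cmod (f x))\<^sup>2 + (cmod (g x))\<^sup>2)"
    by (intro AE_I2) (use mult_le_sum_squares in \<open>auto simp: norm_mult abs_of_nonneg\<close>)
qed (use assms in \<open>auto intro: L2_integrable_square\<close>)

lemma L2_inner_integrable:
  "f \<in> L2 \<Longrightarrow> g \<in> L2 \<Longrightarrow> integrable lborel (\<lambda>x. f x * cnj (g x))"
  using L2_mult_integrable[of f "\<lambda>x. cnj (g x)"] by auto

lemma Cauchy_Schwarz_integral:
  fixes p q :: "'a \<Rightarrow> real"
  assumes "integrable M (\<lambda>x. (p x)\<^sup>2)" "integrable M (\<lambda>x. (q x)\<^sup>2)"
    and [measurable]: "p \<in> borel_measurable M" "q \<in> borel_measurable M"
  shows "integrable M (\<lambda>x. p x * q x)"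
    and "(LINT x|M. \<bar>p x * q x\<bar>)\<^sup>2 \<le> (LINT x|M. (p x)\<^sup>2) * (LINT x|M. (q x)\<^sup>2)"
proof -
  have le: "\<bar>p x * q x\<bar> \<le> (p x)\<^sup>2 + (q x)\<^sup>2" for x
    using mult_le_sum_squares[of "\<bar>p x\<bar>" "\<bar>q x\<bar>"] by (simp add: abs_mult)
  have int: "integrable M (\<lambda>x. p x * q x)"
    by (rule Bochner_Integration.integrable_bound[of M "\<lambda>x. (p x)\<^sup>2 + (q x)\<^sup>2"])
       (use assms le in \<open>auto intro: order_trans[OF _ abs_ge_self]\<close>)
  then show "integrable M (\<lambda>x. p x * q x)" .
  have "ennreal ((LINT x|M. \<bar>p x * q x\<bar>)\<^sup>2) = (\<integral>\<^sup>+x. ennreal \<bar>p x\<bar> * ennreal \<bar>q x\<bar> \<partial>M)\<^sup>2"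
  proof -
    have "ennreal (LINT x|M. \<bar>p x * q x\<bar>) = (\<integral>\<^sup>+x. ennreal \<bar>p x * q x\<bar> \<partial>M)"
      using int by (intro nn_integral_eq_integral[symmetric]) auto
    then show ?thesis
      by (simp add: ennreal_power[symmetric] abs_mult ennreal_mult')
  qed
  also have "\<dots> \<le> (\<integral>\<^sup>+x. ennreal \<bar>p x\<bar> ^ 2 \<partial>M) * (\<integral>\<^sup>+x. ennreal \<bar>q x\<bar> ^ 2 \<partial>M)"
    by (rule Cauchy_Schwarz_nn_integral) auto
  also have "\<dots> = ennreal ((LINT x|M. (p x)\<^sup>2) * (LINT x|M. (q x)\<^sup>2))"
    using assms by (simp add: ennreal_power nn_integral_eq_integral ennreal_mult')
  finally show "(LINT x|M. \<bar>p x * q x\<bar>)\<^sup>2 \<le> (LINT x|M. (p x)\<^sup>2) * (LINT x|M. (q x)\<^sup>2)"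
    by (subst (asm) ennreal_le_iff) auto
qed

lemma L2_Cauchy_Schwarz_abs:
  assumes "f \<in> L2" "g \<in> L2"
  shows "(LINT x|lborel. cmod (f x) * cmod (g x)) \<le> l2_norm f * l2_norm g"
proof -
  have "(LINT x|lborel. \<bar>cmod (f x) * cmod (g x)\<bar>)\<^sup>2 \<le> (l2_norm f * l2_norm g)\<^sup>2"
    using Cauchy_Schwarz_integral(2)[of lborel "\<lambda>x. cmod (f x)" "\<lambda>x. cmod (g x)"] assms
    by (auto simp: L2_integrable_square power_mult_distrib l2_norm_power2)
  then have "(LINT x|lborel. \<bar>cmod (f x) * cmod (g x)\<bar>) \<le> l2_norm f * l2_norm g"
    by (rule power2_le_imp_le) simp
  then show ?thesis
    by (simp only: abs_mult abs_norm_cancel)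
qed

lemma l2_Cauchy_Schwarz:
  assumes "f \<in> L2" "g \<in> L2"
  shows "cmod (l2_inner f g) \<le> l2_norm f * l2_norm g"
proof -
  have "cmod (l2_inner f g) \<le> (LINT x|lborel. cmod (f x) * cmod (g x))"
    unfolding l2_inner_def by (rule order_trans[OF integral_norm_bound]) (simp add: norm_mult)
  then show ?thesis
    using L2_Cauchy_Schwarz_abs[OF assms] by linarith
qed

lemma l2_inner_self: "l2_inner f f = of_real ((l2_norm f)\<^sup>2)"
  unfolding l2_inner_def l2_norm_power2 by (simp add: complex_norm_square[symmetric] del: of_real_power)

lemma l2_inner_commute: "l2_inner g f = cnj (l2_inner f g)"
  unfolding l2_inner_def by (simp flip: Bochner_Integration.integral_cnj add: mult.commute)

lemma l2_inner_add_left: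
  "f \<in> L2 \<Longrightarrow> g \<in> L2 \<Longrightarrow> h \<in> L2 \<Longrightarrow> l2_inner (\<lambda>x. f x + g x) h = l2_inner f h + l2_inner g h"
  unfolding l2_inner_def by (simp add: distrib_right L2_inner_integrable)

lemma l2_inner_diff_left:
  "f \<in> L2 \<Longrightarrow> g \<in> L2 \<Longrightarrow> h \<in> L2 \<Longrightarrow> l2_inner (\<lambda>x. f x - g x) h = l2_inner f h - l2_inner g h"
  unfolding l2_inner_def by (simp add: left_diff_distrib L2_inner_integrable)

lemma l2_inner_add_right:
  "f \<in> L2 \<Longrightarrow> g \<in> L2 \<Longrightarrow> h \<in> L2 \<Longrightarrow> l2_inner h (\<lambda>x. f x + g x) = l2_inner h f + l2_inner h g"
  unfolding l2_inner_def by (simp add: distrib_left L2_inner_integrable)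

lemma l2_inner_diff_right:
  "f \<in> L2 \<Longrightarrow> g \<in> L2 \<Longrightarrow> h \<in> L2 \<Longrightarrow> l2_inner h (\<lambda>x. f x - g x) = l2_inner h f - l2_inner h g"
  unfolding l2_inner_def by (simp add: right_diff_distrib L2_inner_integrable)

lemma l2_inner_cmult_left: "l2_inner (\<lambda>x. c * f x) h = c * l2_inner f h"
  unfolding l2_inner_def by (simp add: mult.assoc)

lemma l2_inner_cmult_right: "l2_inner h (\<lambda>x. c * f x) = cnj c * l2_inner h f"
  unfolding l2_inner_def by (simp add: mult.left_commute)

lemma l2_norm_add_power2:
  assumes "f \<in> L2" "g \<in> L2"
  shows "(l2_norm (\<lambda>x. f x + g x))\<^sup>2 = (l2_norm f)\<^sup>2 + (l2_norm g)\<^sup>2 + 2 * Re (l2_inner f g)"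
proof -
  have "l2_inner (\<lambda>x. f x + g x) (\<lambda>x. f x + g x)
      = l2_inner f f + l2_inner f g + (cnj (l2_inner f g) + l2_inner g g)"
    using assms by (simp add: l2_inner_add_left l2_inner_add_right L2_add l2_inner_commute[symmetric])
  then have "Re (l2_inner (\<lambda>x. f x + g x) (\<lambda>x. f x + g x)) = Re (l2_inner f f + l2_inner f g + (cnj (l2_inner f g) + l2_inner g g))"
    by simp
  then show ?thesis
    by (simp add: l2_inner_self)
qed

lemma l2_norm_triangle:
  assumes "f \<in> L2" "g \<in> L2"
  shows "l2_norm (\<lambda>x. f x + g x) \<le> l2_norm f + l2_norm g"
proof (rule power2_le_imp_le)
  show "(l2_norm (\<lambda>x. f x + g x))\<^sup>2 \<le> (l2_norm f + l2_norm g)\<^sup>2"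
    unfolding l2_norm_add_power2[OF assms]
    using l2_Cauchy_Schwarz[OF assms] complex_Re_le_cmod[of "l2_inner f g"] by (simp add: power2_sum)
qed simp

lemma l2_norm_cmult: "l2_norm (\<lambda>x. c * f x) = cmod c * l2_norm f"
  unfolding l2_norm_def by (simp add: norm_mult power_mult_distrib real_sqrt_mult)

lemma l2_norm_minus: "l2_norm (\<lambda>x. - f x) = l2_norm f"
  unfolding l2_norm_def by simp

lemma l2_norm_minus_commute: "l2_norm (\<lambda>x. f x - g x) = l2_norm (\<lambda>x. g x - f x)"
  unfolding l2_norm_def by (simp add: norm_minus_commute)

lemma l2_norm_triangle_diff:
  assumes "f \<in> L2" "g \<in> L2"
  shows "l2_norm (\<lambda>x. f x - g x) \<le> l2_norm f + l2_norm g"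
  using l2_norm_triangle[OF assms(1) L2_minus[OF assms(2)]] by (simp add: l2_norm_minus)

lemma l2_norm_mono:
  assumes "f \<in> borel_measurable lborel" "integrable lborel g" "AE x in lborel. (cmod (f x))\<^sup>2 \<le> g x"
    "(LINT x|lborel. g x) \<le> B\<^sup>2" "0 \<le> B"
  shows "l2_norm f \<le> B"
proof -
  have "(LINT x|lborel. (cmod (f x))\<^sup>2) \<le> (LINT x|lborel. g x)"
    using assms L2_bound[OF assms(1-3)] by (intro integral_mono_AE L2_integrable_square)
  then have "(l2_norm f)\<^sup>2 \<le> B\<^sup>2"
    using assms(4) by (simp add: l2_norm_power2)
  then show ?thesis
    using assms(5) by (rule power2_le_imp_le)
qed

lemma ae_eq_refl [simp]: "ae_eq f f"
  by (simp add: ae_eq_def)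

lemma ae_eq_sym: "ae_eq f g \<Longrightarrow> ae_eq g f"
  by (auto simp: ae_eq_def)

lemma ae_eq_trans: "ae_eq f g \<Longrightarrow> ae_eq g h \<Longrightarrow> ae_eq f h"
  unfolding ae_eq_def by (erule (1) eventually_elim2) simp

lemma l2_norm_cong:
  assumes "f \<in> borel_measurable borel" "g \<in> borel_measurable borel" "ae_eq f g"
  shows "l2_norm f = l2_norm g"
proof -
  have "(LINT x|lborel. (cmod (f x))\<^sup>2) = (LINT x|lborel. (cmod (g x))\<^sup>2)"
    using assms(3) by (intro integral_cong_AE) (use assms in \<open>auto simp: ae_eq_def\<close>)
  then show ?thesis
    by (simp add: l2_norm_def)
qed

lemma l2_inner_cong:
  assumes "f \<in> L2" "f' \<in> L2" "g \<in> L2" "g' \<in> L2" "ae_eq f f'" "ae_eq g g'"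
  shows "l2_inner f g = l2_inner f' g'"
  unfolding l2_inner_def
proof (rule integral_cong_AE)
  show "AE x in lborel. f x * cnj (g x) = f' x * cnj (g' x)"
    using assms(5,6) unfolding ae_eq_def by eventually_elim simp
qed (use assms(1-4) in auto)

lemma l2_norm_zero_imp_ae_eq:
  assumes "f \<in> L2" "g \<in> L2" "l2_norm (\<lambda>x. f x - g x) = 0"
  shows "ae_eq f g"
proof -
  have "(\<lambda>x. f x - g x) \<in> L2"
    using assms by auto
  then have "AE x in lborel. (cmod (f x - g x))\<^sup>2 = 0"
    using integral_nonneg_eq_0_iff_AE[of lborel "\<lambda>x. (cmod (f x - g x))\<^sup>2"] assms(3)
    by (simp add: l2_norm_def L2_integrable_square)
  then show ?thesis
    by (simp add: ae_eq_def)
qed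

text \<open>Riesz-Fischer for sequences with geometrically shrinking steps, the form produced by a
  contraction iteration: the telescoping series converges almost everywhere, and Fatou's lemma turns
  the pointwise limit into a limit in norm.\<close>

lemma L2_complete:
  assumes h: "\<And>n. h n \<in> L2"
    and d: "\<And>n. l2_norm (\<lambda>x. h (Suc n) x - h n x) \<le> C * (1/2) ^ n"
  shows "\<exists>l\<in>L2. (\<lambda>n. l2_norm (\<lambda>x. h n x - l x)) \<longlonglongrightarrow> 0"
proof -
  have [measurable]: "h n \<in> borel_measurable borel" for n
    using h by auto
  have C: "0 \<le> C"
    using order_trans[OF l2_norm_nonneg d[of 0]] by simp
  define D where "D n x = (cmod (h (Suc n) x - h n x))\<^sup>2" for n x
  have [measurable]: "D n \<in> borel_measurable borel" for n
    unfolding D_def by measurable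
  have Dnn: "(\<integral>\<^sup>+x. ennreal (D n x) \<partial>lborel) \<le> ennreal ((C * (1/2) ^ n)\<^sup>2)" for n
  proof -
    have "(\<integral>\<^sup>+x. ennreal (D n x) \<partial>lborel) = ennreal ((l2_norm (\<lambda>x. h (Suc n) x - h n x))\<^sup>2)"
      unfolding l2_norm_power2 D_def
      by (rule nn_integral_eq_integral) (use h in \<open>auto intro!: L2_integrable_square\<close>)
    also have "\<dots> \<le> ennreal ((C * (1/2) ^ n)\<^sup>2)"
      by (intro ennreal_leI power_mono d) auto
    finally show ?thesis .
  qed
  have tri: "l2_norm (\<lambda>x. h (n + m) x - h n x) \<le> 2 * C * (1/2) ^ n" for n m
  proof -
    \<comment> \<open>The subtracted tail makes this the exact value of the geometric sum; without
      it the induction on \<open>m\<close> would not close.\<close>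
    have "l2_norm (\<lambda>x. h (n + m) x - h n x) \<le> 2 * C * (1/2) ^ n - 2 * C * (1/2) ^ (n + m)"
    proof (induction m)
      case 0
      then show ?case by (simp add: l2_norm_def)
    next
      case (Suc m)
      have "l2_norm (\<lambda>x. h (n + Suc m) x - h n x)
          = l2_norm (\<lambda>x. (h (Suc (n + m)) x - h (n + m) x) + (h (n + m) x - h n x))"
        by simp
      also have "\<dots> \<le> C * (1/2) ^ (n + m) + (2 * C * (1/2) ^ n - 2 * C * (1/2) ^ (n + m))"
        using Suc d[of "n + m"] h by (intro order_trans[OF l2_norm_triangle] add_mono) auto
      finally show ?case by simp
    qed
    also have "\<dots> \<le> 2 * C * (1/2) ^ n"
      using C by simp
    finally show ?thesis .
  qed
  \<comment> \<open>The integral of \<open>D n\<close> is at most C^2 / 4^n, so the weight 2^n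
    leaves a convergent series. Where that series is finite, \<open>D n x\<close> is at most B /
    2^n, and the steps are dominated by a geometric series of ratio 1 / sqrt 2.\<close>
  have "(\<integral>\<^sup>+x. (\<Sum>n. ennreal (2 ^ n * D n x)) \<partial>lborel) = (\<Sum>n. ennreal (2 ^ n) * (\<integral>\<^sup>+x. ennreal (D n x) \<partial>lborel))"
    by (subst nn_integral_suminf) (auto simp: ennreal_mult' nn_integral_cmult)
  also have "\<dots> \<le> (\<Sum>n. ennreal (C\<^sup>2 * (1/2) ^ n))"
  proof (intro suminf_le summableI)
    fix n
    have "ennreal (2 ^ n) * (\<integral>\<^sup>+x. ennreal (D n x) \<partial>lborel) \<le> ennreal (2 ^ n) * ennreal ((C * (1/2) ^ n)\<^sup>2)"
      by (intro mult_left_mono Dnn) auto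
    also have "\<dots> = ennreal (C\<^sup>2 * (1/2) ^ n)"
    proof -
      have "(2::real) ^ n * (C * (1/2) ^ n)\<^sup>2 = C\<^sup>2 * (2 * (1/2 * (1/2))) ^ n"
        unfolding power_mult_distrib power2_eq_square by (simp only: mult_ac)
      then show ?thesis
        by (simp add: ennreal_mult'[symmetric])
    qed
    finally show "ennreal (2 ^ n) * (\<integral>\<^sup>+x. ennreal (D n x) \<partial>lborel) \<le> ennreal (C\<^sup>2 * (1/2) ^ n)" .
  qed
  also have "\<dots> = ennreal (\<Sum>n. C\<^sup>2 * (1/2) ^ n)"
    by (intro suminf_ennreal2) (auto intro!: summable_mult summable_geometric)
  finally have "(\<integral>\<^sup>+x. (\<Sum>n. ennreal (2 ^ n * D n x)) \<partial>lborel) \<noteq> \<infinity>"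
    by (auto simp: top_unique)
  then have "AE x in lborel. (\<Sum>n. ennreal (2 ^ n * D n x)) \<noteq> \<infinity>"
    by (intro nn_integral_PInf_AE) auto
  then have conv: "AE x in lborel. convergent (\<lambda>n. h n x)"
  proof eventually_elim
    case (elim x)
    then have "summable (\<lambda>n. 2 ^ n * D n x)"
      by (intro summable_suminf_not_top) (auto simp: D_def)
    then obtain B where B: "\<And>n. \<bar>2 ^ n * D n x\<bar> \<le> B"
      using summable_imp_Bseq[of "\<lambda>n. 2 ^ n * D n x"] by (auto simp: Bseq_def)
    have B0: "0 \<le> B" using B[of 0] by linarith
    have le: "norm (h (Suc n) x - h n x) \<le> sqrt B * (1 / sqrt 2) ^ n" for n
    proof (rule power2_le_imp_le)
      have "D n x \<le> B * (1/2) ^ n"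
        using B[of n] by (simp add: field_simps D_def)
      moreover have "((1 / sqrt 2) ^ n)\<^sup>2 = (1 / 2 :: real) ^ n"
        by (simp add: power_divide flip: power_mult) (simp add: power_mult mult.commute[of n])
      ultimately show "(norm (h (Suc n) x - h n x))\<^sup>2 \<le> (sqrt B * (1 / sqrt 2) ^ n)\<^sup>2"
        unfolding power_mult_distrib D_def using B0 by simp
      show "0 \<le> sqrt B * (1 / sqrt 2) ^ n" using B0 by simp
    qed
    have "summable (\<lambda>n. h (Suc n) x - h n x)"
      by (rule summable_comparison_test'[of "\<lambda>n. sqrt B * (1 / sqrt 2) ^ n" 0])
         (use le in \<open>auto intro!: summable_mult summable_geometric\<close>)
    then have "convergent (\<lambda>n. \<Sum>i<n. h (Suc i) x - h i x)"
      by (simp add: summable_iff_convergent)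
    moreover have "(\<lambda>n. \<Sum>i<n. h (Suc i) x - h i x) = (\<lambda>n. h n x - h 0 x)"
      using sum_lessThan_telescope[of "\<lambda>n. h n x"] by (intro ext) simp
    ultimately have "convergent (\<lambda>n. h n x - h 0 x)"
      by simp
    then have "convergent (\<lambda>n. (h n x - h 0 x) + h 0 x)"
      by (intro convergent_add convergent_const)
    then show ?case by simp
  qed
  define l where "l x = lim (\<lambda>n. h n x)" for x
  have [measurable]: "l \<in> borel_measurable borel"
    unfolding l_def by measurable
  have lim: "AE x in lborel. (\<lambda>n. h n x) \<longlonglongrightarrow> l x"
    using conv unfolding l_def by eventually_elim (rule convergent_LIMSEQ_iff[THEN iffD1])
  \<comment> \<open>Fatou's lemma along the shifted sequence; it yields both that the difference of
    \<open>l\<close> and \<open>h n\<close> is square integrable and that its norm tends to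
    0.\<close>
  have bnd: "(\<integral>\<^sup>+x. ennreal ((cmod (l x - h n x))\<^sup>2) \<partial>lborel) \<le> ennreal ((2 * C * (1/2) ^ n)\<^sup>2)" for n
  proof -
    have "(\<integral>\<^sup>+x. ennreal ((cmod (l x - h n x))\<^sup>2) \<partial>lborel)
        = (\<integral>\<^sup>+x. liminf (\<lambda>m. ennreal ((cmod (h (n + m) x - h n x))\<^sup>2)) \<partial>lborel)"
    proof (rule nn_integral_cong_AE)
      show "AE x in lborel. ennreal ((cmod (l x - h n x))\<^sup>2)
          = liminf (\<lambda>m. ennreal ((cmod (h (n + m) x - h n x))\<^sup>2))"
        using lim
      proof eventually_elim
        case (elim x)
        have "(\<lambda>m. ennreal ((cmod (h (n + m) x - h n x))\<^sup>2)) \<longlonglongrightarrow> ennreal ((cmod (l x - h n x))\<^sup>2)"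
          using LIMSEQ_ignore_initial_segment[OF elim, of n]
          by (intro tendsto_ennrealI tendsto_intros) (simp add: add.commute)
        then show ?case
          by (intro lim_imp_Liminf[symmetric]) auto
      qed
    qed
    also have "\<dots> \<le> liminf (\<lambda>m. \<integral>\<^sup>+x. ennreal ((cmod (h (n + m) x - h n x))\<^sup>2) \<partial>lborel)"
      by (rule nn_integral_liminf) auto
    also have "\<dots> \<le> ennreal ((2 * C * (1/2) ^ n)\<^sup>2)"
    proof (rule Liminf_le, simp, rule always_eventually, rule allI)
      fix m
      have "(\<integral>\<^sup>+x. ennreal ((cmod (h (n + m) x - h n x))\<^sup>2) \<partial>lborel)
          = ennreal ((l2_norm (\<lambda>x. h (n + m) x - h n x))\<^sup>2)"
        unfolding l2_norm_power2
        by (rule nn_integral_eq_integral) (use h in \<open>auto intro!: L2_integrable_square\<close>)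
      also have "\<dots> \<le> ennreal ((2 * C * (1/2) ^ n)\<^sup>2)"
        by (intro ennreal_leI power_mono tri) auto
      finally show "(\<integral>\<^sup>+x. ennreal ((cmod (h (n + m) x - h n x))\<^sup>2) \<partial>lborel) \<le> ennreal ((2 * C * (1/2) ^ n)\<^sup>2)" .
    qed
    finally show ?thesis .
  qed
  have dL2: "(\<lambda>x. l x - h n x) \<in> L2" for n
    unfolding L2_def using bnd[of n]
    by (auto simp: integrable_iff_bounded intro: le_less_trans)
  have "(\<lambda>x. (l x - h 0 x) + h 0 x) \<in> L2"
    using dL2 h by (intro L2_add)
  then have lL2: "l \<in> L2" by simp
  have le: "l2_norm (\<lambda>x. h n x - l x) \<le> 2 * C * (1/2) ^ n" for n
  proof -
    have "ennreal ((l2_norm (\<lambda>x. l x - h n x))\<^sup>2) \<le> ennreal ((2 * C * (1/2) ^ n)\<^sup>2)"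
      using bnd[of n] nn_integral_eq_integral[OF L2_integrable_square[OF dL2[of n]]]
      by (simp add: l2_norm_power2)
    then have "l2_norm (\<lambda>x. l x - h n x) \<le> 2 * C * (1/2) ^ n"
      using C by (auto intro: power2_le_imp_le simp: ennreal_le_iff)
    then show ?thesis
      by (simp add: l2_norm_minus_commute)
  qed
  have "(\<lambda>n. 2 * C * (1/2) ^ n) \<longlonglongrightarrow> 0"
    by (intro tendsto_mult_right_zero LIMSEQ_power_zero) simp
  then have "(\<lambda>n. l2_norm (\<lambda>x. h n x - l x)) \<longlonglongrightarrow> 0"
    by (rule Lim_null_comparison[rotated]) (auto simp: le)
  with lL2 show ?thesis by blast
qed

section \<open>The free resolvent\<close>

text \<open>For \<open>Im k > 0\<close> this is the kernel of \<open>(- d\<^sup>2/dx\<^sup>2 - k\<^sup>2)\<^sup>-\<^sup>1\<close>; for real \<open>k > 0\<close> it is the boundary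
  value from above, and it agrees with the kernel in \<^const>\<open>T_op\<close>.\<close>

definition rkernel :: "complex \<Rightarrow> real \<Rightarrow> complex" where
  "rkernel k r = \<i> / (2 * k) * exp (\<i> * k * of_real r)"

definition free_res :: "complex \<Rightarrow> (real \<Rightarrow> complex) \<Rightarrow> real \<Rightarrow> complex" where
  "free_res k w x = (LINT y|lborel. rkernel k \<bar>x - y\<bar> * w y)"

text \<open>Spectral parameters including the real axis, where boundary values are taken. Staying
  away from 0 bounds the factor 1 / (2 k) uniformly.\<close>

definition uhp :: "real \<Rightarrow> complex set" where
  "uhp c = {k. 0 \<le> Im k \<and> c \<le> cmod k}"

text \<open>With j = 2 and both weights |V| this is the squared Hilbert-Schmidt norm of T(k') -
  T(k); j = 1 with weights |u| and |w| bounds the change of the pairing of R_0(k) w with u.\<close>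

definition kernel_diff :: "nat \<Rightarrow> complex \<Rightarrow> complex \<Rightarrow> (real \<Rightarrow> real) \<Rightarrow> (real \<Rightarrow> real) \<Rightarrow> real" where
  "kernel_diff j k k' p q =
     (LINT x|lborel. p x * (LINT y|lborel. (cmod (rkernel k' \<bar>x - y\<bar> - rkernel k \<bar>x - y\<bar>)) ^ j * q y))"

lemma rkernel_measurable [measurable]: "rkernel k \<in> borel_measurable borel"
  unfolding rkernel_def by (intro borel_measurable_continuous_onI continuous_intros)

lemma free_res_measurable [measurable]:
  assumes [measurable]: "w \<in> borel_measurable borel"
  shows "free_res k w \<in> borel_measurable borel"
  unfolding free_res_def by measurable

lemma rkernel_bound:
  assumes "0 < c" "k \<in> uhp c" "0 \<le> r"
  shows "cmod (rkernel k r) \<le> 1 / (2 * c)"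
proof -
  have "cmod (rkernel k r) = exp (- (Im k * r)) / (2 * cmod k)"
    by (simp add: rkernel_def norm_mult norm_divide)
  also have "\<dots> \<le> 1 / (2 * c)"
    using assms by (intro frac_le) (auto simp: uhp_def)
  finally show ?thesis .
qed

lemma rkernel_diff_bound:
  assumes "0 < c" "k \<in> uhp c" "k' \<in> uhp c" "0 \<le> r"
  shows "cmod (rkernel k' r - rkernel k r) \<le> 1 / c"
proof -
  have "1 / (2 * c) + 1 / (2 * c) = 1 / c"
    by (simp add: field_simps)
  then show ?thesis
    using norm_triangle_ineq4[of "rkernel k' r" "rkernel k r"] rkernel_bound[OF assms(1,2,4)]
      rkernel_bound[OF assms(1,3,4)] by linarith
qed

lemma rkernel_tendsto:
  assumes "k \<noteq> 0" "X \<longlonglongrightarrow> k"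
  shows "(\<lambda>n. rkernel (X n) r) \<longlonglongrightarrow> rkernel k r"
  unfolding rkernel_def by (intro tendsto_intros assms) (use assms in auto)

lemma rkernel_integrable:
  assumes "0 < c" "k \<in> uhp c" "integrable lborel w"
  shows "integrable lborel (\<lambda>y. rkernel k \<bar>x - y\<bar> * w y)"
proof (rule Bochner_Integration.integrable_bound[of lborel "\<lambda>y. 1 / (2 * c) * w y"])
  show "AE y in lborel. norm (rkernel k \<bar>x - y\<bar> * w y) \<le> norm (1 / (2 * c) * w y)"
    using rkernel_bound[OF assms(1,2)] assms(1)
    by (intro AE_I2) (auto simp: norm_mult norm_divide mult_right_mono simp flip: times_divide_eq_left)
qed (use assms in auto)

lemma rkernel_diff_integrable:
  assumes "0 < c" "k \<in> uhp c" "k' \<in> uhp c" "integrable lborel q"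
  shows "integrable lborel (\<lambda>y. (cmod (rkernel k' \<bar>x - y\<bar> - rkernel k \<bar>x - y\<bar>)) ^ j * q y)"
proof (rule Bochner_Integration.integrable_bound[of lborel "\<lambda>y. (1 / c) ^ j * q y"])
  show "AE y in lborel. norm ((cmod (rkernel k' \<bar>x - y\<bar> - rkernel k \<bar>x - y\<bar>)) ^ j * q y) \<le> norm ((1 / c) ^ j * q y)"
    using rkernel_diff_bound[OF assms(1-3)] assms(1)
    unfolding norm_mult norm_power by (intro AE_I2 mult_right_mono power_mono) auto
qed (use assms in auto)

lemma rkernel_diff_integral_bound:
  assumes "0 < c" "k \<in> uhp c" "k' \<in> uhp c" "integrable lborel q"
  shows "\<bar>LINT y|lborel. (cmod (rkernel k' \<bar>x - y\<bar> - rkernel k \<bar>x - y\<bar>)) ^ j * q y\<bar>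
    \<le> (1 / c) ^ j * (LINT y|lborel. \<bar>q y\<bar>)"
proof -
  have "\<bar>LINT y|lborel. (cmod (rkernel k' \<bar>x - y\<bar> - rkernel k \<bar>x - y\<bar>)) ^ j * q y\<bar>
      \<le> (LINT y|lborel. \<bar>(cmod (rkernel k' \<bar>x - y\<bar> - rkernel k \<bar>x - y\<bar>)) ^ j * q y\<bar>)"
    by (rule integral_abs_bound)
  also have "\<dots> \<le> (LINT y|lborel. (1 / c) ^ j * \<bar>q y\<bar>)"
  proof (rule integral_mono)
    show "integrable lborel (\<lambda>y. \<bar>(cmod (rkernel k' \<bar>x - y\<bar> - rkernel k \<bar>x - y\<bar>)) ^ j * q y\<bar>)"
      by (intro integrable_abs rkernel_diff_integrable[OF assms])
    show "\<bar>(cmod (rkernel k' \<bar>x - y\<bar> - rkernel k \<bar>x - y\<bar>)) ^ j * q y\<bar> \<le> (1 / c) ^ j * \<bar>q y\<bar>" for y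
      unfolding abs_mult power_abs abs_norm_cancel
      by (intro mult_right_mono power_mono rkernel_diff_bound[OF assms(1-3)]) auto
  qed (use assms in auto)
  finally show ?thesis by simp
qed

lemma kernel_diff_outer_integrable:
  assumes "0 < c" "k \<in> uhp c" "k' \<in> uhp c" "integrable lborel p" "integrable lborel q"
  shows "integrable lborel (\<lambda>x. p x * (LINT y|lborel. (cmod (rkernel k' \<bar>x - y\<bar> - rkernel k \<bar>x - y\<bar>)) ^ j * q y))"
proof (rule Bochner_Integration.integrable_bound[of lborel "\<lambda>x. p x * ((1 / c) ^ j * (LINT y|lborel. \<bar>q y\<bar>))"])
  have [measurable]: "p \<in> borel_measurable borel" "q \<in> borel_measurable borel"
    using assms by auto
  show "(\<lambda>x. p x * (LINT y|lborel. (cmod (rkernel k' \<bar>x - y\<bar> - rkernel k \<bar>x - y\<bar>)) ^ j * q y)) \<in> borel_measurable lborel"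
    by measurable
  show "AE x in lborel. norm (p x * (LINT y|lborel. (cmod (rkernel k' \<bar>x - y\<bar> - rkernel k \<bar>x - y\<bar>)) ^ j * q y))
      \<le> norm (p x * ((1 / c) ^ j * (LINT y|lborel. \<bar>q y\<bar>)))"
    using rkernel_diff_integral_bound[OF assms(1-3,5)] assms(1)
    unfolding norm_mult by (intro AE_I2 mult_left_mono) (auto simp: integral_nonneg_AE intro: order_trans[OF _ abs_ge_self])
qed (use assms in auto)

lemma kernel_diff_tendsto:
  assumes c: "0 < c" and k: "k \<in> uhp c" and p: "integrable lborel p" and q: "integrable lborel q" and "0 < j"
  shows "((\<lambda>k'. kernel_diff j k k' p q) \<longlongrightarrow> 0) (at k within uhp c)"
  unfolding tendsto_at_iff_sequentially o_def
proof (intro allI impI)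
  fix X :: "nat \<Rightarrow> complex"
  assume "\<forall>i. X i \<in> uhp c - {k}" and X: "X \<longlonglongrightarrow> k"
  then have Xu: "X i \<in> uhp c" for i by auto
  have [measurable]: "p \<in> borel_measurable borel" "q \<in> borel_measurable borel"
    using assms by auto
  have k0: "k \<noteq> 0" using c k by (auto simp: uhp_def)
  define I where "I n x = (LINT y|lborel. (cmod (rkernel (X n) \<bar>x - y\<bar> - rkernel k \<bar>x - y\<bar>)) ^ j * q y)" for n x
  have I: "(\<lambda>n. I n x) \<longlonglongrightarrow> 0" for x
  proof -
    have "(\<lambda>n. I n x) \<longlonglongrightarrow> (LINT y::real|lborel. (0::real))"
      unfolding I_def
    proof (rule integral_dominated_convergence[where w = "\<lambda>y. (1 / c) ^ j * \<bar>q y\<bar>"])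
      show "AE y in lborel. (\<lambda>n. (cmod (rkernel (X n) \<bar>x - y\<bar> - rkernel k \<bar>x - y\<bar>)) ^ j * q y) \<longlonglongrightarrow> 0"
      proof (intro AE_I2)
        fix y
        have "(\<lambda>n. (cmod (rkernel (X n) \<bar>x - y\<bar> - rkernel k \<bar>x - y\<bar>)) ^ j * q y) \<longlonglongrightarrow>
            (cmod (rkernel k \<bar>x - y\<bar> - rkernel k \<bar>x - y\<bar>)) ^ j * q y"
          by (intro tendsto_intros rkernel_tendsto k0 X)
        then show "(\<lambda>n. (cmod (rkernel (X n) \<bar>x - y\<bar> - rkernel k \<bar>x - y\<bar>)) ^ j * q y) \<longlonglongrightarrow> 0"
          using \<open>0 < j\<close> by (simp add: zero_power)
      qed
      show "AE y in lborel. norm ((cmod (rkernel (X n) \<bar>x - y\<bar> - rkernel k \<bar>x - y\<bar>)) ^ j * q y) \<le> (1 / c) ^ j * \<bar>q y\<bar>" for n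
        using rkernel_diff_bound[OF c k Xu[of n]] c unfolding norm_mult norm_power
        by (intro AE_I2 mult_mono power_mono) auto
    qed (use q in auto)
    then show ?thesis by simp
  qed
  have "(\<lambda>n. LINT x|lborel. p x * I n x) \<longlonglongrightarrow> (LINT x::real|lborel. (0::real))"
  proof (rule integral_dominated_convergence[where w = "\<lambda>x. \<bar>p x\<bar> * ((1 / c) ^ j * (LINT y|lborel. \<bar>q y\<bar>))"])
    show "AE x in lborel. (\<lambda>n. p x * I n x) \<longlonglongrightarrow> 0"
      using I by (intro AE_I2 tendsto_mult_right_zero)
    show "(\<lambda>x. p x * I n x) \<in> borel_measurable lborel" for n
      unfolding I_def by measurable
    show "AE x in lborel. norm (p x * I n x) \<le> \<bar>p x\<bar> * ((1 / c) ^ j * (LINT y|lborel. \<bar>q y\<bar>))" for n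
      using rkernel_diff_integral_bound[OF c k Xu q] unfolding I_def norm_mult real_norm_def abs_mult
      by (intro AE_I2 mult_left_mono) auto
  qed (use p in auto)
  then show "(\<lambda>n. kernel_diff j k (X n) p q) \<longlonglongrightarrow> 0"
    by (simp add: kernel_diff_def I_def)
qed

lemma free_res_bound:
  assumes "0 < c" "k \<in> uhp c" "integrable lborel w"
  shows "cmod (free_res k w x) \<le> (LINT y|lborel. cmod (w y)) / (2 * c)"
proof -
  have "cmod (free_res k w x) \<le> (LINT y|lborel. cmod (rkernel k \<bar>x - y\<bar> * w y))"
    unfolding free_res_def by (rule integral_norm_bound)
  also have "\<dots> \<le> (LINT y|lborel. 1 / (2 * c) * cmod (w y))"
  proof (rule integral_mono)
    show "cmod (rkernel k \<bar>x - y\<bar> * w y) \<le> 1 / (2 * c) * cmod (w y)" for y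
      unfolding norm_mult by (intro mult_right_mono rkernel_bound[OF assms(1,2)]) auto
  qed (use rkernel_integrable[OF assms] assms in auto)
  finally show ?thesis by simp
qed

lemma free_res_diff:
  assumes "0 < c" "k \<in> uhp c" "integrable lborel w" "integrable lborel u"
  shows "free_res k (\<lambda>y. w y - u y) x = free_res k w x - free_res k u x"
  unfolding free_res_def using assms by (simp add: right_diff_distrib rkernel_integrable)

lemma free_res_kernel_diff:
  assumes "0 < c" "k \<in> uhp c" "k' \<in> uhp c" "integrable lborel w"
  shows "cmod (free_res k' w x - free_res k w x) \<le> (LINT y|lborel. cmod (rkernel k' \<bar>x - y\<bar> - rkernel k \<bar>x - y\<bar>) * cmod (w y))"
proof -
  have "free_res k' w x - free_res k w x = (LINT y|lborel. (rkernel k' \<bar>x - y\<bar> - rkernel k \<bar>x - y\<bar>) * w y)"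
    unfolding free_res_def using assms by (simp add: left_diff_distrib rkernel_integrable)
  then show ?thesis
    using integral_norm_bound[of lborel "\<lambda>y. (rkernel k' \<bar>x - y\<bar> - rkernel k \<bar>x - y\<bar>) * w y"] by (simp add: norm_mult)
qed

lemma weighted_kernel_Cauchy_Schwarz:
  assumes "0 < c" "k \<in> uhp c" "k' \<in> uhp c" and s: "integrable lborel (\<lambda>y. (s y)\<^sup>2)" and t: "integrable lborel (\<lambda>y. (t y)\<^sup>2)"
    and [measurable]: "s \<in> borel_measurable borel" "t \<in> borel_measurable borel"
    and "\<And>y. 0 \<le> s y" "\<And>y. 0 \<le> t y"
  shows "(LINT y|lborel. cmod (rkernel k' \<bar>x - y\<bar> - rkernel k \<bar>x - y\<bar>) * (s y * t y))\<^sup>2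
    \<le> (LINT y|lborel. (cmod (rkernel k' \<bar>x - y\<bar> - rkernel k \<bar>x - y\<bar>))\<^sup>2 * (s y)\<^sup>2) * (LINT y|lborel. (t y)\<^sup>2)"
proof -
  let ?D = "\<lambda>y. cmod (rkernel k' \<bar>x - y\<bar> - rkernel k \<bar>x - y\<bar>)"
  have "(LINT y|lborel. \<bar>(?D y * s y) * t y\<bar>)\<^sup>2 \<le> (LINT y|lborel. (?D y * s y)\<^sup>2) * (LINT y|lborel. (t y)\<^sup>2)"
    using rkernel_diff_integrable[OF assms(1-3) s, of x 2] t
    by (intro Cauchy_Schwarz_integral(2)) (auto simp: power_mult_distrib)
  moreover have "\<bar>(?D y * s y) * t y\<bar> = ?D y * (s y * t y)" for y
    using assms(8,9) by (simp add: abs_mult)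
  ultimately show ?thesis
    by (simp only: power_mult_distrib)
qed

section \<open>The Birman--Schwinger equation\<close>

text \<open>\<open>c\<close> bounds |k| from below; in the final proof it is the left end sqrt
  \<alpha> of the momentum interval.\<close>

locale short_range_potential =
  fixes V :: "real \<Rightarrow> real" and c :: real
  assumes V_integrable: "integrable lborel V"
    and V_square_integrable: "integrable lborel (\<lambda>x. (V x)\<^sup>2)"
    and c_pos: "0 < c"
begin

lemma V_measurable [measurable]: "V \<in> borel_measurable borel"
  using V_integrable by auto

definition va :: "real \<Rightarrow> complex" where "va x = of_real (sqrt \<bar>V x\<bar>)"
definition vb :: "real \<Rightarrow> complex" where "vb x = of_real (signed_sqrt V x)"

definition Vnorm :: real where "Vnorm = (LINT x|lborel. \<bar>V x\<bar>)"

lemma Vnorm_nonneg: "0 \<le> Vnorm"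
  by (simp add: Vnorm_def integral_nonneg_AE)

lemma va_measurable [measurable]: "va \<in> borel_measurable borel"
  unfolding va_def by measurable

lemma vb_measurable [measurable]: "vb \<in> borel_measurable borel"
  unfolding vb_def signed_sqrt_def by measurable

lemma va_square: "(cmod (va x))\<^sup>2 = \<bar>V x\<bar>"
  by (simp add: va_def)

lemma norm_vb: "cmod (vb x) = cmod (va x)"
  by (auto simp: va_def vb_def signed_sqrt_def abs_mult sgn_if)

lemma va_vb: "va x * vb x = of_real (V x)"
  by (simp add: va_def vb_def signed_sqrt_def sgn_if flip: of_real_mult)

lemma cnj_va [simp]: "cnj (va x) = va x" and cnj_vb [simp]: "cnj (vb x) = vb x"
  by (simp_all add: va_def vb_def)

lemma va_L2: "va \<in> L2"
  using V_integrable by (simp add: L2_def va_square)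

lemma vb_L2: "vb \<in> L2"
  using V_integrable by (simp add: L2_def norm_vb va_square)

lemma l2_norm_va: "(l2_norm va)\<^sup>2 = Vnorm"
  by (simp add: l2_norm_power2 va_square Vnorm_def)

lemma vb_mult_integrable: "\<phi> \<in> L2 \<Longrightarrow> integrable lborel (\<lambda>y. vb y * \<phi> y)"
  using L2_mult_integrable[OF vb_L2] by simp

lemma vb_mult_norm: "\<phi> \<in> L2 \<Longrightarrow> (LINT y|lborel. cmod (vb y * \<phi> y)) \<le> l2_norm va * l2_norm \<phi>"
  using L2_Cauchy_Schwarz_abs[OF va_L2] by (simp add: norm_mult norm_vb)

text \<open>T(k) extended from k > 0 to complex k, in the factored form sqrt |V| R_0(k)
  V^(1/2).\<close>

definition bs_op :: "complex \<Rightarrow> (real \<Rightarrow> complex) \<Rightarrow> real \<Rightarrow> complex" where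
  "bs_op k \<phi> x = va x * free_res k (\<lambda>y. vb y * \<phi> y) x"

lemma bs_op_measurable [measurable]:
  "\<phi> \<in> borel_measurable borel \<Longrightarrow> bs_op k \<phi> \<in> borel_measurable borel"
  unfolding bs_op_def by measurable

text \<open>An integrable source gives a bounded R_0(k) w, which for real k need not be square
  integrable; the factor sqrt |V|, in L2 because V is integrable, restores square
  integrability.\<close>

lemma va_free_res_L2:
  assumes "k \<in> uhp c" "integrable lborel w"
  shows "(\<lambda>x. va x * free_res k w x) \<in> L2"
    and "l2_norm (\<lambda>x. va x * free_res k w x) \<le> l2_norm va * ((LINT y|lborel. cmod (w y)) / (2 * c))"
proof -
  have [measurable]: "w \<in> borel_measurable borel" using assms by auto
  let ?B = "(LINT y|lborel. cmod (w y)) / (2 * c)"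
  have B: "0 \<le> ?B" using c_pos by (simp add: integral_nonneg_AE)
  have le: "(cmod (va x * free_res k w x))\<^sup>2 \<le> \<bar>V x\<bar> * ?B\<^sup>2" for x
    unfolding norm_mult power_mult_distrib va_square
    by (intro mult_left_mono power_mono free_res_bound c_pos assms) auto
  have int: "integrable lborel (\<lambda>x. \<bar>V x\<bar> * ?B\<^sup>2)"
    using V_integrable by auto
  show "(\<lambda>x. va x * free_res k w x) \<in> L2"
    by (rule L2_bound[OF _ int]) (use le in auto)
  show "l2_norm (\<lambda>x. va x * free_res k w x) \<le> l2_norm va * ?B"
    by (rule l2_norm_mono[OF _ int])
       (use le mult_nonneg_nonneg[OF l2_norm_nonneg B] in \<open>auto simp: power_mult_distrib power_divide l2_norm_va Vnorm_def\<close>)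
qed

lemma bs_op_L2: "k \<in> uhp c \<Longrightarrow> \<phi> \<in> L2 \<Longrightarrow> bs_op k \<phi> \<in> L2"
  unfolding bs_op_def by (intro va_free_res_L2 vb_mult_integrable)

lemma bs_op_bound:
  assumes "k \<in> uhp c" "\<phi> \<in> L2"
  shows "l2_norm (bs_op k \<phi>) \<le> Vnorm / (2 * c) * l2_norm \<phi>"
proof -
  have "l2_norm (bs_op k \<phi>) \<le> l2_norm va * ((LINT y|lborel. cmod (vb y * \<phi> y)) / (2 * c))"
    unfolding bs_op_def by (intro va_free_res_L2 vb_mult_integrable assms)
  also have "\<dots> \<le> l2_norm va * ((l2_norm va * l2_norm \<phi>) / (2 * c))"
    using c_pos by (intro mult_left_mono divide_right_mono vb_mult_norm assms) auto
  also have "\<dots> = Vnorm / (2 * c) * l2_norm \<phi>"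
    unfolding l2_norm_va[symmetric] by (simp add: power2_eq_square)
  finally show ?thesis .
qed

lemma bs_op_diff:
  assumes "k \<in> uhp c" "\<phi> \<in> L2" "\<psi> \<in> L2"
  shows "bs_op k (\<lambda>y. \<phi> y - \<psi> y) x = bs_op k \<phi> x - bs_op k \<psi> x"
  using free_res_diff[OF c_pos assms(1) vb_mult_integrable[OF assms(2)] vb_mult_integrable[OF assms(3)]]
  by (simp add: bs_op_def right_diff_distrib)

text \<open>The Hilbert-Schmidt norm of T(k') - T(k), used as a bound on its operator norm.\<close>

definition bs_dist :: "complex \<Rightarrow> complex \<Rightarrow> real" where
  "bs_dist k k' = sqrt (kernel_diff 2 k k' (\<lambda>x. \<bar>V x\<bar>) (\<lambda>x. \<bar>V x\<bar>))"

lemma kernel_diff_nonneg: "(\<And>x. 0 \<le> p x) \<Longrightarrow> (\<And>x. 0 \<le> q x) \<Longrightarrow> 0 \<le> kernel_diff j k k' p q"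
  unfolding kernel_diff_def by (intro integral_nonneg_AE AE_I2 mult_nonneg_nonneg) auto

lemma bs_dist_tendsto: "k \<in> uhp c \<Longrightarrow> (bs_dist k \<longlongrightarrow> 0) (at k within uhp c)"
  using tendsto_real_sqrt[OF kernel_diff_tendsto[OF c_pos, of k "\<lambda>x. \<bar>V x\<bar>" "\<lambda>x. \<bar>V x\<bar>" 2]] V_integrable
  by (simp add: bs_dist_def[abs_def])

text \<open>The factorisation |w| = s t is left open because two are needed: s = sqrt |V| and t =
  |\<phi>| for T(k) acting on an L2 function, and s = t = sqrt |g| for a source that is merely
  integrable. The factor s stays with the kernel, t is split off by Cauchy-Schwarz.\<close>

lemma va_free_res_diff_bound:
  assumes k: "k \<in> uhp c" "k' \<in> uhp c" and s: "integrable lborel (\<lambda>y. (s y)\<^sup>2)" and t: "integrable lborel (\<lambda>y. (t y)\<^sup>2)"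
    and [measurable]: "s \<in> borel_measurable borel" "t \<in> borel_measurable borel"
    and st: "\<And>y. 0 \<le> s y" "\<And>y. 0 \<le> t y" and w: "integrable lborel w" "\<And>y. cmod (w y) = s y * t y"
  shows "l2_norm (\<lambda>x. va x * (free_res k' w x - free_res k w x))
    \<le> sqrt (kernel_diff 2 k k' (\<lambda>x. \<bar>V x\<bar>) (\<lambda>y. (s y)\<^sup>2)) * sqrt (LINT y|lborel. (t y)\<^sup>2)"
proof -
  have [measurable]: "w \<in> borel_measurable borel" using w by auto
  let ?T = "LINT y|lborel. (t y)\<^sup>2"
  let ?I = "\<lambda>x. LINT y|lborel. (cmod (rkernel k' \<bar>x - y\<bar> - rkernel k \<bar>x - y\<bar>))\<^sup>2 * (s y)\<^sup>2"
  have T: "0 \<le> ?T" by (simp add: integral_nonneg_AE)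
  have le: "(cmod (va x * (free_res k' w x - free_res k w x)))\<^sup>2 \<le> (\<bar>V x\<bar> * ?I x) * ?T" for x
  proof -
    have "(cmod (free_res k' w x - free_res k w x))\<^sup>2
        \<le> (LINT y|lborel. cmod (rkernel k' \<bar>x - y\<bar> - rkernel k \<bar>x - y\<bar>) * (s y * t y))\<^sup>2"
      using free_res_kernel_diff[OF c_pos k w(1)] by (intro power_mono) (auto simp: w(2))
    also have "\<dots> \<le> ?I x * ?T"
      by (rule weighted_kernel_Cauchy_Schwarz[OF c_pos k s t]) (use st in auto)
    finally show ?thesis
      unfolding norm_mult power_mult_distrib va_square by (simp add: mult_left_mono mult.assoc)
  qed
  have int: "integrable lborel (\<lambda>x. (\<bar>V x\<bar> * ?I x) * ?T)"
    using kernel_diff_outer_integrable[OF c_pos k integrable_abs[OF V_integrable] s, of 2] by auto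
  show ?thesis
    by (rule l2_norm_mono[OF _ int])
       (use le T in \<open>auto simp: power_mult_distrib kernel_diff_nonneg, simp add: kernel_diff_def\<close>)
qed

lemma bs_op_diff_bound:
  assumes "k \<in> uhp c" "k' \<in> uhp c" "\<phi> \<in> L2"
  shows "l2_norm (\<lambda>x. bs_op k' \<phi> x - bs_op k \<phi> x) \<le> bs_dist k k' * l2_norm \<phi>"
proof -
  have "l2_norm (\<lambda>x. va x * (free_res k' (\<lambda>y. vb y * \<phi> y) x - free_res k (\<lambda>y. vb y * \<phi> y) x))
    \<le> sqrt (kernel_diff 2 k k' (\<lambda>x. \<bar>V x\<bar>) (\<lambda>y. (cmod (va y))\<^sup>2)) * sqrt (LINT y|lborel. (cmod (\<phi> y))\<^sup>2)"
    by (rule va_free_res_diff_bound)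
       (use assms in \<open>auto simp: norm_mult norm_vb L2_integrable_square va_L2 vb_mult_integrable\<close>)
  then show ?thesis
    by (simp add: bs_op_def right_diff_distrib bs_dist_def va_square l2_norm_def)
qed

lemma va_free_res_tendsto:
  assumes k: "k \<in> uhp c" and g: "integrable lborel g"
  shows "((\<lambda>k'. l2_norm (\<lambda>x. va x * (free_res k' g x - free_res k g x))) \<longlongrightarrow> 0) (at k within uhp c)"
proof (rule Lim_null_comparison)
  let ?b = "\<lambda>k'. sqrt (kernel_diff 2 k k' (\<lambda>x. \<bar>V x\<bar>) (\<lambda>y. cmod (g y))) * sqrt (LINT y|lborel. cmod (g y))"
  have "l2_norm (\<lambda>x. va x * (free_res k' g x - free_res k g x)) \<le> ?b k'" if "k' \<in> uhp c" for k'
    using va_free_res_diff_bound[OF k that, of "\<lambda>y. sqrt (cmod (g y))" "\<lambda>y. sqrt (cmod (g y))" g] g by auto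
  then show "\<forall>\<^sub>F k' in at k within uhp c. norm (l2_norm (\<lambda>x. va x * (free_res k' g x - free_res k g x))) \<le> ?b k'"
    unfolding eventually_at_filter by (intro always_eventually) auto
  have "((\<lambda>k'. kernel_diff 2 k k' (\<lambda>x. \<bar>V x\<bar>) (\<lambda>y. cmod (g y))) \<longlongrightarrow> 0) (at k within uhp c)"
    by (rule kernel_diff_tendsto[OF c_pos k]) (use V_integrable g in auto)
  from tendsto_real_sqrt[OF this] show "(?b \<longlongrightarrow> 0) (at k within uhp c)"
    by (intro tendsto_mult_left_zero) simp
qed

text \<open>Invertibility of I + T(k) with an inverse of norm at most C, written as a lower bound
  together with surjectivity up to \<open>\<approx>\<close>. In this form no inverse acting on
  representatives has to be carried along, and perturbation only changes C.\<close>

definition regular_const :: "complex \<Rightarrow> real \<Rightarrow> bool" where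
  "regular_const k C \<longleftrightarrow> k \<in> uhp c \<and> 0 < C \<and>
     (\<forall>h\<in>L2. l2_norm h \<le> C * l2_norm (\<lambda>x. h x + bs_op k h x)) \<and>
     (\<forall>g\<in>L2. \<exists>h\<in>L2. ae_eq (\<lambda>x. h x + bs_op k h x) g)"

definition regular :: "complex \<Rightarrow> bool" where
  "regular k \<longleftrightarrow> (\<exists>C. regular_const k C)"

lemma regular_const_uhp: "regular_const k C \<Longrightarrow> k \<in> uhp c"
  and regular_const_pos: "regular_const k C \<Longrightarrow> 0 < C"
  and regular_const_bound: "regular_const k C \<Longrightarrow> h \<in> L2 \<Longrightarrow> l2_norm h \<le> C * l2_norm (\<lambda>x. h x + bs_op k h x)"
  and regular_const_surj: "regular_const k C \<Longrightarrow> g \<in> L2 \<Longrightarrow> \<exists>h\<in>L2. ae_eq (\<lambda>x. h x + bs_op k h x) g"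
  by (auto simp: regular_const_def)

text \<open>I + T(k) differs from I + T(k') by T(k) - T(k'), whose contribution is at most half the
  norm of h and is absorbed on the left; this costs the factor 2.\<close>

lemma regular_const_perturb_bound:
  assumes C: "regular_const k C" and k': "k' \<in> uhp c" and small: "C * bs_dist k k' \<le> 1/2" and h: "h \<in> L2"
  shows "l2_norm h \<le> 2 * C * l2_norm (\<lambda>x. h x + bs_op k' h x)"
proof -
  note k = regular_const_uhp[OF C]
  have L: "bs_op k h \<in> L2" "bs_op k' h \<in> L2"
    using k k' h by (auto intro: bs_op_L2)
  have "l2_norm h \<le> C * l2_norm (\<lambda>x. (h x + bs_op k' h x) - (bs_op k' h x - bs_op k h x))"
    using regular_const_bound[OF C h] by simp
  also have "\<dots> \<le> C * (l2_norm (\<lambda>x. h x + bs_op k' h x) + bs_dist k k' * l2_norm h)"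
  proof (rule mult_left_mono)
    have "l2_norm (\<lambda>x. (h x + bs_op k' h x) - (bs_op k' h x - bs_op k h x))
        \<le> l2_norm (\<lambda>x. h x + bs_op k' h x) + l2_norm (\<lambda>x. bs_op k' h x - bs_op k h x)"
      using L h by (intro l2_norm_triangle_diff) auto
    with bs_op_diff_bound[OF k k' h]
    show "l2_norm (\<lambda>x. (h x + bs_op k' h x) - (bs_op k' h x - bs_op k h x))
        \<le> l2_norm (\<lambda>x. h x + bs_op k' h x) + bs_dist k k' * l2_norm h"
      by linarith
  qed (use regular_const_pos[OF C] in simp)
  also have "\<dots> = C * l2_norm (\<lambda>x. h x + bs_op k' h x) + (C * bs_dist k k') * l2_norm h"
    by (simp add: algebra_simps)
  also have "\<dots> \<le> C * l2_norm (\<lambda>x. h x + bs_op k' h x) + 1/2 * l2_norm h"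
    by (intro add_left_mono mult_right_mono small) auto
  finally show ?thesis by simp
qed

text \<open>Contraction mapping: the perturbed equation is solved by iterating
  \<open>(1 + T(k)) h\<^sub>n\<^sub>+\<^sub>1 = g - (T(k') - T(k)) h\<^sub>n\<close>.\<close>

lemma regular_const_perturb:
  assumes C: "regular_const k C" and k': "k' \<in> uhp c" and small: "C * bs_dist k k' \<le> 1/2"
  shows "regular_const k' (2 * C)"
proof -
  note k = regular_const_uhp[OF C] and Cpos = regular_const_pos[OF C]
  have "\<exists>l\<in>L2. ae_eq (\<lambda>x. l x + bs_op k' l x) g" if g: "g \<in> L2" for g
  proof -
    define D where "D h x = bs_op k' h x - bs_op k h x" for h x
    have DL2: "D h \<in> L2" if "h \<in> L2" for h
      unfolding D_def using that k k' by (auto intro: bs_op_L2)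
    have "\<exists>s. \<forall>u\<in>L2. s u \<in> L2 \<and> ae_eq (\<lambda>x. s u x + bs_op k (s u) x) u"
      using regular_const_surj[OF C] by (intro bchoice) blast
    then obtain s where s: "\<And>u. u \<in> L2 \<Longrightarrow> s u \<in> L2"
      and seq: "\<And>u. u \<in> L2 \<Longrightarrow> ae_eq (\<lambda>x. s u x + bs_op k (s u) x) u" by blast
    define h where "h = rec_nat (\<lambda>x. 0) (\<lambda>n h. s (\<lambda>x. g x - D h x))"
    have hS: "h (Suc n) = s (\<lambda>x. g x - D (h n) x)" and h0: "h 0 = (\<lambda>x. 0)" for n
      by (simp_all add: h_def)
    have hL2: "h n \<in> L2" for n
      by (induction n) (auto simp: hS h0 intro!: s DL2 g L2_diff)
    have step: "ae_eq (\<lambda>x. h (Suc n) x + bs_op k (h (Suc n)) x) (\<lambda>x. g x - D (h n) x)" for n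
      unfolding hS by (intro seq L2_diff g DL2 hL2)
    have D_lin: "D (\<lambda>x. u x - v x) x = D u x - D v x" if "u \<in> L2" "v \<in> L2" for u v x
      unfolding D_def using that k k' by (simp add: bs_op_diff)
    have D_bd: "l2_norm (D u) \<le> bs_dist k k' * l2_norm u" if "u \<in> L2" for u
      using bs_op_diff_bound[OF k k' that] by (simp add: D_def[abs_def])
    have contr: "l2_norm (\<lambda>x. h (Suc (Suc n)) x - h (Suc n) x) \<le> 1/2 * l2_norm (\<lambda>x. h (Suc n) x - h n x)" for n
    proof -
      let ?d = "\<lambda>x. h (Suc (Suc n)) x - h (Suc n) x" and ?e = "\<lambda>x. h (Suc n) x - h n x"
      have dL: "?d \<in> L2" "?e \<in> L2" using hL2 by auto
      \<comment> \<open>Subtracting two consecutive equations leaves (I + T(k)) d = - D e, so the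
        lower bound at k and the size of D give the contraction factor
        \<open>C * bs_dist k k'\<close>, which is at most 1/2.\<close>
      have "ae_eq (\<lambda>x. ?d x + bs_op k ?d x) (\<lambda>x. - D ?e x)"
        using step[of n] step[of "Suc n"] unfolding ae_eq_def
        by eventually_elim (simp add: bs_op_diff[OF k hL2 hL2] D_lin[OF hL2 hL2] algebra_simps)
      then have eq: "l2_norm (\<lambda>x. ?d x + bs_op k ?d x) = l2_norm (\<lambda>x. - D ?e x)"
        by (rule l2_norm_cong[rotated 2]) (use dL bs_op_L2[OF k dL(1)] DL2[OF dL(2)] in \<open>auto intro!: L2_measurable\<close>)
      have "l2_norm ?d \<le> C * l2_norm (\<lambda>x. ?d x + bs_op k ?d x)"
        by (rule regular_const_bound[OF C dL(1)])
      also have "\<dots> = C * l2_norm (D ?e)"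
        unfolding eq by (simp add: l2_norm_minus)
      also have "\<dots> \<le> C * (bs_dist k k' * l2_norm ?e)"
        using D_bd[OF dL(2)] Cpos by (intro mult_left_mono) auto
      also have "\<dots> \<le> 1/2 * l2_norm ?e"
        unfolding mult.assoc[symmetric] by (intro mult_right_mono small) auto
      finally show ?thesis .
    qed
    have geo: "l2_norm (\<lambda>x. h (Suc n) x - h n x) \<le> l2_norm (\<lambda>x. h 1 x - h 0 x) * (1/2) ^ n" for n
    proof (induction n)
      case (Suc n)
      have "l2_norm (\<lambda>x. h (Suc (Suc n)) x - h (Suc n) x) \<le> 1/2 * (l2_norm (\<lambda>x. h 1 x - h 0 x) * (1/2) ^ n)"
        using contr[of n] Suc by linarith
      then show ?case by (simp add: mult_ac)
    qed simp
    obtain l where l: "l \<in> L2" and lim: "(\<lambda>n. l2_norm (\<lambda>x. h n x - l x)) \<longlonglongrightarrow> 0"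
      using L2_complete[OF hL2 geo] by blast
    have TL: "bs_op k l \<in> L2" "bs_op k' l \<in> L2" using l k k' by (auto intro: bs_op_L2)
    let ?K = "1 + Vnorm / (2 * c)"
    have K: "0 \<le> ?K" using Vnorm_nonneg c_pos by simp
    \<comment> \<open>The residual of the limit is rewritten with the equation satisfied by the
      iterates, so that it involves only the distances of two consecutive iterates from
      \<open>l\<close>. \<open>?K\<close> bounds the norm of I + T(k).\<close>
    have le: "l2_norm (\<lambda>x. (l x + bs_op k' l x) - g x)
        \<le> ?K * l2_norm (\<lambda>x. h (Suc n) x - l x) + bs_dist k k' * l2_norm (\<lambda>x. h n x - l x)" for n
    proof -
      let ?u = "\<lambda>x. h (Suc n) x - l x" and ?v = "\<lambda>x. h n x - l x"
      have uL: "?u \<in> L2" "?v \<in> L2" using hL2 l by auto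
      note m = bs_op_L2[OF k uL(1)] DL2[OF uL(2)]
      have "ae_eq (\<lambda>x. g x - (l x + bs_op k' l x)) (\<lambda>x. (?u x + bs_op k ?u x) + D ?v x)"
        using step[of n] unfolding ae_eq_def
        by eventually_elim (simp add: bs_op_diff[OF k hL2 l] D_lin[OF hL2 l], simp add: D_def algebra_simps)
      then have "l2_norm (\<lambda>x. g x - (l x + bs_op k' l x)) = l2_norm (\<lambda>x. (?u x + bs_op k ?u x) + D ?v x)"
        by (rule l2_norm_cong[rotated 2]) (use l g TL uL m in \<open>auto intro!: L2_measurable\<close>)
      also have "\<dots> \<le> (l2_norm ?u + l2_norm (bs_op k ?u)) + l2_norm (D ?v)"
        using uL m by (intro order_trans[OF l2_norm_triangle] add_right_mono l2_norm_triangle L2_add)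
      also have "\<dots> \<le> (l2_norm ?u + Vnorm / (2 * c) * l2_norm ?u) + bs_dist k k' * l2_norm ?v"
        by (intro add_mono order_refl bs_op_bound[OF k] D_bd uL)
      finally show ?thesis
        by (subst l2_norm_minus_commute) (simp add: distrib_right)
    qed
    have "(\<lambda>n. ?K * l2_norm (\<lambda>x. h (Suc n) x - l x) + bs_dist k k' * l2_norm (\<lambda>x. h n x - l x)) \<longlonglongrightarrow> ?K * 0 + bs_dist k k' * 0"
      by (intro tendsto_intros lim LIMSEQ_Suc[OF lim])
    then have "l2_norm (\<lambda>x. (l x + bs_op k' l x) - g x) \<le> 0"
      using le by (intro LIMSEQ_le_const[of _ 0]) auto
    then have "ae_eq (\<lambda>x. l x + bs_op k' l x) g"
      using l TL g by (intro l2_norm_zero_imp_ae_eq antisym) auto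
    with l show ?thesis by blast
  qed
  then show ?thesis
    using regular_const_perturb_bound[OF C k' small] k' Cpos by (auto simp: regular_const_def)
qed

text \<open>The constant 2 C is the same for all nearby k; the continuity of \<open>phi\<close> in k
  rests on this uniformity.\<close>

lemma regular_eventually:
  assumes "regular_const k C"
  shows "\<forall>\<^sub>F k' in at k within uhp c. regular_const k' (2 * C)"
proof -
  note Cpos = regular_const_pos[OF assms] and k = regular_const_uhp[OF assms]
  have "\<forall>\<^sub>F k' in at k within uhp c. bs_dist k k' < 1 / (2 * C)"
    using Cpos by (intro order_tendstoD(2)[OF bs_dist_tendsto[OF k]]) simp
  moreover have "\<forall>\<^sub>F k' in at k within uhp c. k' \<in> uhp c"
    by (simp add: eventually_at_filter)
  ultimately show ?thesis
  proof eventually_elim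
    case (elim k')
    then show ?case
      using Cpos by (intro regular_const_perturb[OF assms]) (auto simp: field_simps)
  qed
qed

end

section \<open>Outgoing solutions and scattering solutions\<close>

lemma integrable_lborel_product:
  fixes u w :: "real \<Rightarrow> complex" and K :: "real \<Rightarrow> real \<Rightarrow> complex"
  assumes u: "integrable lborel u" and w: "integrable lborel w"
    and K [measurable]: "(\<lambda>(x, y). K x y) \<in> borel_measurable (borel \<Otimes>\<^sub>M borel)"
    and B: "\<And>x y. cmod (K x y) \<le> B"
  shows "integrable (lborel \<Otimes>\<^sub>M lborel) (\<lambda>(x, y). K x y * w y * u x)"
proof -
  have [measurable]: "u \<in> borel_measurable borel" "w \<in> borel_measurable borel"
    using u w by auto
  have m: "(\<lambda>(x, y). w y * u x) \<in> borel_measurable (lborel \<Otimes>\<^sub>M lborel)"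
    by measurable
  have "integrable (lborel \<Otimes>\<^sub>M lborel) (\<lambda>(x, y). w y * u x)"
  proof (rule lborel_pair.Fubini_integrable[OF m])
    have "integrable lborel (\<lambda>x. (LINT y|lborel. cmod (w y)) * cmod (u x))"
      using u by auto
    then show "integrable lborel (\<lambda>x. LINT y|lborel. norm (case (x, y) of (x, y) \<Rightarrow> w y * u x))"
      by (simp add: norm_mult)
  qed (use w in auto)
  then have "integrable (lborel \<Otimes>\<^sub>M lborel) (\<lambda>z. of_real B * (case z of (x, y) \<Rightarrow> w y * u x))"
    by (rule integrable_mult_right)
  then show ?thesis
  proof (rule Bochner_Integration.integrable_bound)
    show "(\<lambda>(x, y). K x y * w y * u x) \<in> borel_measurable (lborel \<Otimes>\<^sub>M lborel)"
      by measurable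
    have B0: "0 \<le> B" using order_trans[OF norm_ge_zero B] .
    show "AE z in lborel \<Otimes>\<^sub>M lborel. norm (case z of (x, y) \<Rightarrow> K x y * w y * u x)
        \<le> norm (of_real B * (case z of (x, y) \<Rightarrow> w y * u x))"
      using B B0 by (intro AE_I2) (auto simp: norm_mult mult.assoc intro!: mult_right_mono)
  qed
qed

lemma symmetric_kernel_swap:
  fixes K :: "real \<Rightarrow> complex"
  assumes u: "integrable lborel u" and w: "integrable lborel w"
    and [measurable]: "K \<in> borel_measurable borel" and B: "\<And>r. 0 \<le> r \<Longrightarrow> cmod (K r) \<le> B"
  shows "(LINT x|lborel. (LINT y|lborel. K \<bar>x - y\<bar> * w y) * u x)
    = (LINT x|lborel. (LINT y|lborel. K \<bar>x - y\<bar> * u y) * w x)"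
proof -
  have "integrable (lborel \<Otimes>\<^sub>M lborel) (\<lambda>(x, y). K \<bar>x - y\<bar> * w y * u x)"
    by (rule integrable_lborel_product[OF u w, where B = B]) (use B in auto)
  from lborel_pair.Fubini_integral[OF this]
  have "(LINT x|lborel. LINT y|lborel. K \<bar>x - y\<bar> * w y * u x) = (LINT y|lborel. LINT x|lborel. K \<bar>x - y\<bar> * w y * u x)"
    by simp
  also have "\<dots> = (LINT x|lborel. LINT y|lborel. K \<bar>x - y\<bar> * u y * w x)"
    by (simp add: mult_ac abs_minus_commute)
  finally show ?thesis
    by simp
qed

lemma free_res_symmetric:
  assumes "0 < c" "k \<in> uhp c" "integrable lborel u" "integrable lborel w"
  shows "(LINT x|lborel. free_res k w x * u x) = (LINT x|lborel. free_res k u x * w x)"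
  unfolding free_res_def
  by (rule symmetric_kernel_swap[OF assms(3,4), where B = "1 / (2 * c)"]) (auto intro: rkernel_bound[OF assms(1,2)])

lemma free_res_mult_integrable:
  assumes "0 < c" "k \<in> uhp c" "integrable lborel u" "integrable lborel w"
  shows "integrable lborel (\<lambda>x. free_res k w x * u x)"
proof (rule Bochner_Integration.integrable_bound)
  have [measurable]: "u \<in> borel_measurable borel" "w \<in> borel_measurable borel"
    using assms by auto
  let ?B = "(LINT y|lborel. cmod (w y)) / (2 * c)"
  show "integrable lborel (\<lambda>x. of_real ?B * u x)"
    using assms by auto
  show "(\<lambda>x. free_res k w x * u x) \<in> borel_measurable lborel"
    by measurable
  show "AE x in lborel. norm (free_res k w x * u x) \<le> norm (of_real ?B * u x)"
    using free_res_bound[OF assms(1,2,4)] unfolding norm_mult norm_of_real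
    using assms(1) by (intro AE_I2 mult_right_mono) auto
qed

lemma integrable_exp_mult:
  assumes "integrable lborel w"
  shows "integrable lborel (\<lambda>x. w x * exp (\<i> * of_real (x * \<xi>)))"
proof (rule Bochner_Integration.integrable_bound[OF assms])
  have [measurable]: "w \<in> borel_measurable borel" using assms by auto
  have [measurable]: "(\<lambda>x. exp (\<i> * of_real (x * \<xi>))) \<in> borel_measurable borel"
    by (intro borel_measurable_continuous_onI continuous_intros)
  show "(\<lambda>x. w x * exp (\<i> * of_real (x * \<xi>))) \<in> borel_measurable lborel"
    by measurable
qed (simp add: norm_mult)

text \<open>The imaginary part of the boundary value of the free resolvent form is the squared
  Fourier transform on the energy shell, because \<open>Im (\<i> e\<^sup>i\<^sup>\<kappa>\<^sup>r) = cos \<kappa>r\<close>.\<close>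

lemma Im_free_res_form:
  assumes "0 < \<kappa>" and w: "integrable lborel w"
  shows "Im (LINT x|lborel. free_res (of_real \<kappa>) w x * cnj (w x))
    = ((cmod (LINT x|lborel. w x * exp (\<i> * of_real (x * \<kappa>))))\<^sup>2
      + (cmod (LINT x|lborel. w x * exp (\<i> * of_real (x * - \<kappa>))))\<^sup>2) / (4 * \<kappa>)"
proof -
  let ?k = "of_real \<kappa> :: complex"
  let ?F = "\<lambda>\<xi>. LINT x|lborel. w x * exp (\<i> * of_real (x * \<xi>))"
  let ?A = "LINT x|lborel. free_res ?k w x * cnj (w x)"
  have [measurable]: "w \<in> borel_measurable borel" using w by auto
  have k: "?k \<in> uhp \<kappa>" using assms by (simp add: uhp_def)
  have wc: "integrable lborel (\<lambda>x. cnj (w x))" using w by simp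
  have int1: "integrable lborel (\<lambda>y. rkernel ?k \<bar>x - y\<bar> * w y)" for x
    by (rule rkernel_integrable[OF assms(1) k w])
  have int2: "integrable lborel (\<lambda>y. cnj (rkernel ?k \<bar>x - y\<bar>) * w y)" for x
    using rkernel_integrable[OF assms(1) k wc, of x, THEN integrable_cnj] by simp
  \<comment> \<open>Conjugation puts the conjugated kernel against w in the other variable. The
    kernel depends only on |x - y|, so Fubini brings it back to the shape of \<open>?A\<close>, and
    \<open>?A - cnj ?A\<close> is the form of the kernel minus its conjugate.\<close>
  have "cnj ?A = (LINT x|lborel. (LINT y|lborel. cnj (rkernel ?k \<bar>x - y\<bar>) * cnj (w y)) * w x)"
    by (simp flip: Bochner_Integration.integral_cnj add: free_res_def)
  also have "\<dots> = (LINT x|lborel. (LINT y|lborel. cnj (rkernel ?k \<bar>x - y\<bar>) * w y) * cnj (w x))"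
    by (rule symmetric_kernel_swap[OF w wc, where B = "1 / (2 * \<kappa>)"])
       (auto intro: rkernel_bound[OF assms(1) k])
  finally have cA: "cnj ?A = (LINT x|lborel. (LINT y|lborel. cnj (rkernel ?k \<bar>x - y\<bar>) * w y) * cnj (w x))" .
  have intA: "integrable lborel (\<lambda>x. free_res ?k w x * cnj (w x))"
    by (rule free_res_mult_integrable[OF assms(1) k wc w])
  have intcA: "integrable lborel (\<lambda>x. (LINT y|lborel. cnj (rkernel ?k \<bar>x - y\<bar>) * w y) * cnj (w x))"
    using free_res_mult_integrable[OF assms(1) k w wc, THEN integrable_cnj]
    by (simp flip: Bochner_Integration.integral_cnj add: free_res_def)
  \<comment> \<open>The difference is i / \<kappa> times cos (\<kappa> (x - y)): evenness of the
    cosine removes the absolute value, and the addition law then separates x from y, leaving a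
    kernel of rank two.\<close>
  have kern: "rkernel ?k \<bar>x - y\<bar> - cnj (rkernel ?k \<bar>x - y\<bar>)
      = \<i> / (2 * ?k) * (exp (\<i> * of_real (x * \<kappa>)) * exp (\<i> * of_real (y * - \<kappa>))
        + exp (\<i> * of_real (x * - \<kappa>)) * exp (\<i> * of_real (y * \<kappa>)))" for x y
  proof -
    have "rkernel ?k \<bar>x - y\<bar> - cnj (rkernel ?k \<bar>x - y\<bar>)
      = \<i> / (2 * ?k) * (exp (\<i> * of_real (\<kappa> * \<bar>x - y\<bar>)) + exp (\<i> * of_real (- \<kappa> * \<bar>x - y\<bar>)))"
      by (simp add: rkernel_def exp_cnj distrib_left mult_ac)
    also have "exp (\<i> * of_real (\<kappa> * \<bar>x - y\<bar>)) + exp (\<i> * of_real (- \<kappa> * \<bar>x - y\<bar>))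
      = exp (\<i> * of_real (\<kappa> * (x - y))) + exp (\<i> * of_real (- \<kappa> * (x - y)))"
      by (cases "0 \<le> x - y") (auto simp: abs_if algebra_simps)
    also have "\<dots> = exp (\<i> * of_real (x * \<kappa>)) * exp (\<i> * of_real (y * - \<kappa>))
        + exp (\<i> * of_real (x * - \<kappa>)) * exp (\<i> * of_real (y * \<kappa>))"
      by (simp add: exp_add[symmetric] algebra_simps)
    finally show ?thesis .
  qed
  have inner: "(LINT y|lborel. rkernel ?k \<bar>x - y\<bar> * w y) - (LINT y|lborel. cnj (rkernel ?k \<bar>x - y\<bar>) * w y)
     = \<i> / (2 * ?k) * (exp (\<i> * of_real (x * \<kappa>)) * ?F (- \<kappa>) + exp (\<i> * of_real (x * - \<kappa>)) * ?F \<kappa>)" for x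
  proof -
    have "(LINT y|lborel. rkernel ?k \<bar>x - y\<bar> * w y) - (LINT y|lborel. cnj (rkernel ?k \<bar>x - y\<bar>) * w y)
      = (LINT y|lborel. (rkernel ?k \<bar>x - y\<bar> - cnj (rkernel ?k \<bar>x - y\<bar>)) * w y)"
      using int1 int2 by (simp add: left_diff_distrib)
    also have "\<dots> = (LINT y|lborel. (\<i> / (2 * ?k) * exp (\<i> * of_real (x * \<kappa>))) * (w y * exp (\<i> * of_real (y * - \<kappa>)))
        + (\<i> / (2 * ?k) * exp (\<i> * of_real (x * - \<kappa>))) * (w y * exp (\<i> * of_real (y * \<kappa>))))"
      unfolding kern by (simp only: distrib_left distrib_right mult_ac)
    also have "\<dots> = (\<i> / (2 * ?k) * exp (\<i> * of_real (x * \<kappa>))) * ?F (- \<kappa>)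
        + (\<i> / (2 * ?k) * exp (\<i> * of_real (x * - \<kappa>))) * ?F \<kappa>"
      by (subst Bochner_Integration.integral_add)
         (intro integrable_mult_right integrable_exp_mult w, intro integrable_mult_right integrable_exp_mult w,
          simp only: integral_mult_right_zero)
    finally show ?thesis by (simp only: distrib_left mult_ac)
  qed
  have Fc: "cnj (?F \<xi>) = (LINT x|lborel. cnj (w x) * exp (\<i> * of_real (x * - \<xi>)))" for \<xi>
    by (simp flip: Bochner_Integration.integral_cnj add: exp_cnj)
  have "?A - cnj ?A = (LINT x|lborel. (\<i> / (2 * ?k) * ?F (- \<kappa>)) * (cnj (w x) * exp (\<i> * of_real (x * \<kappa>)))
      + (\<i> / (2 * ?k) * ?F \<kappa>) * (cnj (w x) * exp (\<i> * of_real (x * - \<kappa>))))"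
  proof -
    have "?A - cnj ?A = (LINT x|lborel. free_res ?k w x * cnj (w x)
        - (LINT y|lborel. cnj (rkernel ?k \<bar>x - y\<bar>) * w y) * cnj (w x))"
      unfolding cA using intA intcA by (rule Bochner_Integration.integral_diff[symmetric])
    also have "\<dots> = (LINT x|lborel. ((LINT y|lborel. rkernel ?k \<bar>x - y\<bar> * w y)
        - (LINT y|lborel. cnj (rkernel ?k \<bar>x - y\<bar>) * w y)) * cnj (w x))"
      unfolding free_res_def by (simp only: left_diff_distrib)
    finally show ?thesis
      unfolding inner by (simp only: distrib_left distrib_right mult_ac)
  qed
  also have "\<dots> = (\<i> / (2 * ?k) * ?F (- \<kappa>)) * cnj (?F (- \<kappa>)) + (\<i> / (2 * ?k) * ?F \<kappa>) * cnj (?F \<kappa>)"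
    unfolding Fc minus_minus
    by (subst Bochner_Integration.integral_add)
       (intro integrable_mult_right integrable_exp_mult wc, intro integrable_mult_right integrable_exp_mult wc,
        simp only: integral_mult_right_zero)
  also have "\<dots> = \<i> / (2 * ?k) * of_real ((cmod (?F \<kappa>))\<^sup>2 + (cmod (?F (- \<kappa>)))\<^sup>2)"
    by (simp add: complex_norm_square distrib_left mult_ac del: of_real_power)
  finally have "\<i> * of_real (2 * Im ?A) = \<i> * of_real (((cmod (?F \<kappa>))\<^sup>2 + (cmod (?F (- \<kappa>)))\<^sup>2) / (2 * \<kappa>))"
    by (simp add: complex_diff_cnj mult.commute)
  then have "2 * Im ?A = ((cmod (?F \<kappa>))\<^sup>2 + (cmod (?F (- \<kappa>)))\<^sup>2) / (2 * \<kappa>)"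
    by (simp only: mult_cancel_left of_real_eq_iff complex_i_not_zero simp_thms)
  then show ?thesis
    by simp
qed

section \<open>Solutions for an integrable source and their continuity in k\<close>

context short_range_potential begin

text \<open>The candidate for sqrt |V| v, where v is the solution sought. It lies in L2 also for
  real k, where v itself is only known to be bounded.\<close>

definition phi :: "(real \<Rightarrow> complex) \<Rightarrow> complex \<Rightarrow> real \<Rightarrow> complex" where
  "phi g k = (SOME \<phi>. \<phi> \<in> L2 \<and> ae_eq (\<lambda>x. \<phi> x + bs_op k \<phi> x) (\<lambda>x. va x * free_res k g x))"

definition source :: "(real \<Rightarrow> complex) \<Rightarrow> complex \<Rightarrow> real \<Rightarrow> complex" where
  "source g k y = g y - vb y * phi g k y"

text \<open>\<open>sol g k\<close> solves \<open>- v'' + V v - k\<^sup>2 v = g\<close>, and \<open>vb * phi g k\<close> is \<open>V\<close> times it.\<close>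

definition sol :: "(real \<Rightarrow> complex) \<Rightarrow> complex \<Rightarrow> real \<Rightarrow> complex" where
  "sol g k = free_res k (source g k)"

lemma regular_constD: "regular_const k C \<Longrightarrow> regular k"
  by (auto simp: regular_def)

lemma regular_uhp: "regular k \<Longrightarrow> k \<in> uhp c"
  by (auto simp: regular_def regular_const_def)

lemma
  assumes "regular k" "integrable lborel g"
  shows phi_L2: "phi g k \<in> L2"
    and phi_eq: "ae_eq (\<lambda>x. phi g k x + bs_op k (phi g k) x) (\<lambda>x. va x * free_res k g x)"
proof -
  have "\<exists>\<phi>. \<phi> \<in> L2 \<and> ae_eq (\<lambda>x. \<phi> x + bs_op k \<phi> x) (\<lambda>x. va x * free_res k g x)"
    using assms va_free_res_L2(1)[OF regular_uhp[OF assms(1)] assms(2)] regular_const_surj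
    unfolding regular_def by blast
  from someI_ex[OF this]
  show "phi g k \<in> L2" "ae_eq (\<lambda>x. phi g k x + bs_op k (phi g k) x) (\<lambda>x. va x * free_res k g x)"
    unfolding phi_def by auto
qed

lemma source_integrable:
  assumes "regular k" "integrable lborel g"
  shows "integrable lborel (source g k)"
  unfolding source_def using assms vb_mult_integrable[OF phi_L2[OF assms]] by auto

lemma sol_measurable [measurable]:
  assumes "regular k" "integrable lborel g"
  shows "sol g k \<in> borel_measurable borel"
  unfolding sol_def using source_integrable[OF assms] by (intro free_res_measurable) auto

text \<open>Moving \<open>bs_op k (phi g k)\<close> to the right of the defining equation leaves
  sqrt |V| R_0(k) applied to \<open>source g k\<close>. This identifies the auxiliary
  \<open>phi\<close> with sqrt |V| times the solution.\<close>

lemma va_sol: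
  assumes "regular k" "integrable lborel g"
  shows "AE x in lborel. va x * sol g k x = phi g k x"
  using phi_eq[OF assms] unfolding ae_eq_def
proof eventually_elim
  case (elim x)
  have "sol g k x = free_res k g x - free_res k (\<lambda>y. vb y * phi g k y) x"
    unfolding sol_def source_def
    by (rule free_res_diff[OF c_pos regular_uhp[OF assms(1)] assms(2) vb_mult_integrable[OF phi_L2[OF assms]]])
  then show ?case
    using elim by (simp add: right_diff_distrib bs_op_def[symmetric] diff_eq_eq)
qed

lemma V_sol:
  assumes "regular k" "integrable lborel g"
  shows "AE x in lborel. vb x * phi g k x = of_real (V x) * sol g k x"
  using va_sol[OF assms]
proof eventually_elim
  case (elim x)
  then show ?case
    by (simp flip: elim va_vb add: mult_ac)
qed

text \<open>The difference d of the two functions satisfies (I + T(k')) d = sqrt |V| (R_0(k') -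
  R_0(k)) g - (T(k') - T(k)) phi(k). The right side is small, and the inverse on the left is bounded
  uniformly for k' near k.\<close>

lemma phi_tendsto:
  assumes k: "regular k" and g: "integrable lborel g"
  shows "((\<lambda>k'. l2_norm (\<lambda>x. phi g k' x - phi g k x)) \<longlongrightarrow> 0) (at k within uhp c)"
proof -
  obtain C where C: "regular_const k C" using k by (auto simp: regular_def)
  note Cpos = regular_const_pos[OF C] and ku = regular_const_uhp[OF C] and pL = phi_L2[OF k g]
  let ?b = "\<lambda>k'. 2 * C * (l2_norm (\<lambda>x. va x * (free_res k' g x - free_res k g x)) + bs_dist k k' * l2_norm (phi g k))"
  have ev: "\<forall>\<^sub>F k' in at k within uhp c. norm (l2_norm (\<lambda>x. phi g k' x - phi g k x)) \<le> ?b k'"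
    using regular_eventually[OF C]
  proof eventually_elim
    case (elim k')
    note gk = regular_constD[OF elim] and ku' = regular_const_uhp[OF elim]
    note pL' = phi_L2[OF gk g]
    let ?d = "\<lambda>x. phi g k' x - phi g k x"
    let ?u = "\<lambda>x. va x * (free_res k' g x - free_res k g x)"
    have uL: "?u \<in> L2"
      using L2_diff[OF va_free_res_L2(1)[OF ku' g] va_free_res_L2(1)[OF ku g]]
      by (simp add: right_diff_distrib)
    have dL: "?d \<in> L2" using pL pL' by auto
    have bL: "(\<lambda>x. bs_op k' (phi g k) x - bs_op k (phi g k) x) \<in> L2"
      using bs_op_L2[OF ku' pL] bs_op_L2[OF ku pL] by auto
    have "ae_eq (\<lambda>x. ?d x + bs_op k' ?d x) (\<lambda>x. ?u x - (bs_op k' (phi g k) x - bs_op k (phi g k) x))"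
      using phi_eq[OF k g] phi_eq[OF gk g] unfolding ae_eq_def
    proof eventually_elim
      case (elim x)
      have "?d x + bs_op k' ?d x = (phi g k' x + bs_op k' (phi g k') x) - (phi g k x + bs_op k (phi g k) x)
         - (bs_op k' (phi g k) x - bs_op k (phi g k) x)"
        by (simp add: bs_op_diff[OF ku' pL' pL])
      then show ?case
        unfolding elim by (simp add: right_diff_distrib)
    qed
    then have eq: "l2_norm (\<lambda>x. ?d x + bs_op k' ?d x) = l2_norm (\<lambda>x. ?u x - (bs_op k' (phi g k) x - bs_op k (phi g k) x))"
      by (rule l2_norm_cong[rotated 2]) (intro L2_measurable L2_add L2_diff dL uL bL bs_op_L2[OF ku' dL])+
    have "l2_norm ?d \<le> 2 * C * l2_norm (\<lambda>x. ?d x + bs_op k' ?d x)"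
      by (rule regular_const_bound[OF elim dL])
    also have "\<dots> \<le> ?b k'"
      unfolding eq
    proof (rule mult_left_mono)
      show "l2_norm (\<lambda>x. ?u x - (bs_op k' (phi g k) x - bs_op k (phi g k) x))
          \<le> l2_norm ?u + bs_dist k k' * l2_norm (phi g k)"
        using l2_norm_triangle_diff[OF uL bL] bs_op_diff_bound[OF ku ku' pL] by linarith
    qed (use Cpos in simp)
    finally show ?case by simp
  qed
  have "(?b \<longlongrightarrow> 2 * C * (0 + 0 * l2_norm (phi g k))) (at k within uhp c)"
    by (intro tendsto_intros va_free_res_tendsto[OF ku g] bs_dist_tendsto[OF ku])
  then have lim: "(?b \<longlongrightarrow> 0) (at k within uhp c)"
    by simp
  show ?thesis
    by (rule Lim_null_comparison[OF ev lim])
qed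

lemma source_tendsto:
  assumes k: "regular k" and g: "integrable lborel g"
  shows "((\<lambda>k'. LINT x|lborel. cmod (source g k' x - source g k x)) \<longlongrightarrow> 0) (at k within uhp c)"
proof (rule Lim_null_comparison)
  let ?b = "\<lambda>k'. l2_norm va * l2_norm (\<lambda>x. phi g k' x - phi g k x)"
  obtain C where C: "regular_const k C" using k by (auto simp: regular_def)
  show "\<forall>\<^sub>F k' in at k within uhp c. norm (LINT x|lborel. cmod (source g k' x - source g k x)) \<le> ?b k'"
    using regular_eventually[OF C]
  proof eventually_elim
    case (elim k')
    note gk = regular_constD[OF elim]
    have "(\<lambda>x. phi g k' x - phi g k x) \<in> L2" using phi_L2[OF k g] phi_L2[OF gk g] by auto
    from vb_mult_norm[OF this]
    have "(LINT x|lborel. cmod (source g k' x - source g k x)) \<le> ?b k'"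
      by (simp add: source_def right_diff_distrib[symmetric] norm_minus_commute norm_mult)
    then show ?case
      by (simp add: integral_nonneg_AE)
  qed
  show "(?b \<longlongrightarrow> 0) (at k within uhp c)"
    by (intro tendsto_mult_right_zero phi_tendsto k g)
qed

lemma pairing_tendsto:
  assumes k: "regular k" and g: "integrable lborel g" and u: "integrable lborel u"
  shows "((\<lambda>k'. LINT x|lborel. sol g k' x * u x) \<longlongrightarrow> (LINT x|lborel. sol g k x * u x)) (at k within uhp c)"
proof -
  note ku = regular_uhp[OF k] and wk = source_integrable[OF k g]
  obtain C where C: "regular_const k C" using k by (auto simp: regular_def)
  let ?U = "LINT x|lborel. cmod (u x)"
  let ?b = "\<lambda>k'. (LINT y|lborel. cmod (source g k' y - source g k y)) / (2 * c) * ?U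
      + kernel_diff 1 k k' (\<lambda>x. cmod (u x)) (\<lambda>y. cmod (source g k y))"
  have ev: "\<forall>\<^sub>F k' in at k within uhp c. norm ((LINT x|lborel. sol g k' x * u x) - (LINT x|lborel. sol g k x * u x)) \<le> ?b k'"
    using regular_eventually[OF C]
  proof eventually_elim
    case (elim k')
    note gk = regular_constD[OF elim] and ku' = regular_const_uhp[OF elim]
    note wk' = source_integrable[OF gk g]
    let ?d = "\<lambda>y. source g k' y - source g k y"
    have dI: "integrable lborel ?d" using wk wk' by auto
    let ?B = "(LINT y|lborel. cmod (?d y)) / (2 * c)"
    let ?I = "\<lambda>x. LINT y|lborel. (cmod (rkernel k' \<bar>x - y\<bar> - rkernel k \<bar>x - y\<bar>)) ^ 1 * cmod (source g k y)"
    have int: "integrable lborel (\<lambda>x. sol g k' x * u x - sol g k x * u x)"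
      unfolding sol_def using free_res_mult_integrable[OF c_pos ku' u wk'] free_res_mult_integrable[OF c_pos ku u wk] by auto
    have int2: "integrable lborel (\<lambda>x. cmod (u x) * ?I x)"
      by (rule kernel_diff_outer_integrable[OF c_pos ku ku']) (use u wk in auto)
    have "norm ((LINT x|lborel. sol g k' x * u x) - (LINT x|lborel. sol g k x * u x))
        = norm (LINT x|lborel. sol g k' x * u x - sol g k x * u x)"
      unfolding sol_def using free_res_mult_integrable[OF c_pos ku' u wk'] free_res_mult_integrable[OF c_pos ku u wk] by simp
    also have "\<dots> \<le> (LINT x|lborel. norm (sol g k' x * u x - sol g k x * u x))"
      by (rule integral_norm_bound)
    also have "\<dots> \<le> (LINT x|lborel. ?B * cmod (u x) + cmod (u x) * ?I x)"
    proof (rule integral_mono)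
      fix x
      have "cmod (sol g k' x - sol g k x) \<le> cmod (free_res k' ?d x) + cmod (free_res k' (source g k) x - free_res k (source g k) x)"
        using free_res_diff[OF c_pos ku' wk' wk, of x] norm_triangle_ineq[of "free_res k' ?d x" "free_res k' (source g k) x - free_res k (source g k) x"]
        by (simp add: sol_def)
      also have "\<dots> \<le> ?B + ?I x"
        using free_res_bound[OF c_pos ku' dI, of x] free_res_kernel_diff[OF c_pos ku ku' wk, of x] by simp
      finally have "cmod (sol g k' x - sol g k x) * cmod (u x) \<le> (?B + ?I x) * cmod (u x)"
        by (intro mult_right_mono) auto
      then show "norm (sol g k' x * u x - sol g k x * u x) \<le> ?B * cmod (u x) + cmod (u x) * ?I x"
        by (simp only: left_diff_distrib[symmetric] norm_mult distrib_right mult.commute[of "cmod (u x)"])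
    qed (use int int2 u in auto)
    also have "\<dots> = ?b k'"
      using int2 u by (simp add: kernel_diff_def)
    finally show ?case .
  qed
  have "(?b \<longlongrightarrow> 0 / (2 * c) * ?U + 0) (at k within uhp c)"
    using c_pos u wk by (intro tendsto_intros source_tendsto k g kernel_diff_tendsto[OF c_pos ku]) auto
  then have lim: "(?b \<longlongrightarrow> 0) (at k within uhp c)"
    by simp
  show ?thesis
    by (rule LIM_zero_cancel[OF Lim_null_comparison[OF ev lim]])
qed

end

lemma fourier_integral_continuous:
  assumes w: "integrable lborel w"
  shows "continuous_on UNIV (\<lambda>\<xi>. LINT x|lborel. w x * exp (\<i> * of_real (x * \<xi>)))"
  unfolding continuous_on_sequentially o_def
proof (intro allI ballI impI)
  fix X :: "nat \<Rightarrow> real" and \<xi> assume "(\<forall>n. X n \<in> UNIV) \<and> X \<longlonglongrightarrow> \<xi>"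
  then have X: "X \<longlonglongrightarrow> \<xi>" by simp
  show "(\<lambda>n. LINT x|lborel. w x * exp (\<i> * of_real (x * X n))) \<longlonglongrightarrow> (LINT x|lborel. w x * exp (\<i> * of_real (x * \<xi>)))"
  proof (rule integral_dominated_convergence[where w = "\<lambda>x. cmod (w x)"])
    show "AE x in lborel. (\<lambda>n. w x * exp (\<i> * of_real (x * X n))) \<longlonglongrightarrow> w x * exp (\<i> * of_real (x * \<xi>))"
      by (intro AE_I2 tendsto_intros X)
  qed (use integrable_exp_mult[OF w] w in \<open>auto simp: norm_mult\<close>)
qed

context short_range_potential begin

text \<open>The limit in \<open>source_tendsto\<close> avoids the point k, whereas X may hit it; the
  expression vanishes at k, so it is continuous there and composition is allowed.\<close>

lemma
  assumes "regular k" "integrable lborel g" "\<And>n. X n \<in> uhp c" "(X \<longlongrightarrow> k) F"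
  shows source_tendsto_compose: "((\<lambda>n. LINT x|lborel. cmod (source g (X n) x - source g k x)) \<longlongrightarrow> 0) F"
proof -
  have "continuous (at k within uhp c) (\<lambda>k'. LINT x|lborel. cmod (source g k' x - source g k x))"
    using source_tendsto[OF assms(1,2)] by (simp add: continuous_within)
  from continuous_within_tendsto_compose[OF this _ assms(4)] show ?thesis
    using assms(3) by simp
qed

lemma pairing_continuous_on:
  assumes "integrable lborel g" "integrable lborel u" "\<And>k. k \<in> S \<Longrightarrow> regular k"
  shows "continuous_on S (\<lambda>k. LINT x|lborel. sol g k x * u x)"
  unfolding continuous_on_def
proof
  fix k assume "k \<in> S"
  show "((\<lambda>k. LINT x|lborel. sol g k x * u x) \<longlongrightarrow> (LINT x|lborel. sol g k x * u x)) (at k within S)"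
    by (rule tendsto_within_subset[OF pairing_tendsto]) (use assms \<open>k \<in> S\<close> regular_uhp in auto)
qed

lemma source_fourier_continuous_on:
  assumes g: "integrable lborel g" and S: "\<And>\<xi>. \<xi> \<in> S \<Longrightarrow> regular (of_real \<bar>\<xi>\<bar>)"
  shows "continuous_on S (\<lambda>\<xi>. LINT x|lborel. source g (of_real \<bar>\<xi>\<bar>) x * exp (\<i> * of_real (x * \<xi>)))"
  unfolding continuous_on_sequentially o_def
proof (intro allI ballI impI)
  fix X :: "nat \<Rightarrow> real" and \<xi> assume \<xi>: "\<xi> \<in> S" and "(\<forall>n. X n \<in> S) \<and> X \<longlonglongrightarrow> \<xi>"
  then have XS: "\<And>n. X n \<in> S" and X: "X \<longlonglongrightarrow> \<xi>" by auto
  let ?k = "\<lambda>\<xi>. of_real \<bar>\<xi>\<bar> :: complex"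
  let ?e = "\<lambda>\<xi> x. exp (\<i> * of_real (x * \<xi>)) :: complex"
  note w = source_integrable[OF S[OF \<xi>] g] and wX = source_integrable[OF S[OF XS] g]
  have D: "(\<lambda>n. LINT x|lborel. cmod (source g (?k (X n)) x - source g (?k \<xi>) x)) \<longlonglongrightarrow> 0"
    by (rule source_tendsto_compose[OF S[OF \<xi>] g regular_uhp[OF S[OF XS]]]) (intro tendsto_intros X)
  have a: "(\<lambda>n. LINT x|lborel. (source g (?k (X n)) x - source g (?k \<xi>) x) * ?e (X n) x) \<longlonglongrightarrow> 0"
  proof (rule Lim_null_comparison[OF always_eventually[rule_format] D])
    fix n
    show "norm (LINT x|lborel. (source g (?k (X n)) x - source g (?k \<xi>) x) * ?e (X n) x)
        \<le> (LINT x|lborel. cmod (source g (?k (X n)) x - source g (?k \<xi>) x))"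
      by (rule order_trans[OF integral_norm_bound]) (simp add: norm_mult)
  qed
  have b: "(\<lambda>n. LINT x|lborel. source g (?k \<xi>) x * ?e (X n) x) \<longlonglongrightarrow> (LINT x|lborel. source g (?k \<xi>) x * ?e \<xi> x)"
    using fourier_integral_continuous[OF w] X unfolding continuous_on_sequentially o_def by blast
  have "(LINT x|lborel. (source g (?k (X n)) x - source g (?k \<xi>) x) * ?e (X n) x) + (LINT x|lborel. source g (?k \<xi>) x * ?e (X n) x)
      = (LINT x|lborel. source g (?k (X n)) x * ?e (X n) x)" for n
    using integrable_exp_mult[OF wX, of n "X n"] integrable_exp_mult[OF w, of "X n"]
    by (simp add: left_diff_distrib)
  then show "(\<lambda>n. LINT x|lborel. source g (?k (X n)) x * ?e (X n) x) \<longlonglongrightarrow> (LINT x|lborel. source g (?k \<xi>) x * ?e \<xi> x)"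
    using tendsto_add[OF a b] by simp
qed

section \<open>The scattering solutions at real energies\<close>

lemma T_op_eq_bs_op:
  shows "T_op V \<kappa> \<phi> x = bs_op (of_real \<kappa>) \<phi> x"
proof -
  \<comment> \<open>At \<kappa> = 0 both sides are 0, since division by zero gives 0.\<close>
  have "- (1 / (2 * \<i> * of_real \<kappa>)) = (\<i> / (2 * of_real \<kappa>) :: complex)"
    by (cases "\<kappa> = 0") (auto simp: field_simps)
  then show ?thesis
    unfolding T_op_def bs_op_def free_res_def rkernel_def va_def vb_def
    by (subst integral_mult_right_zero[symmetric], intro Bochner_Integration.integral_cong)
       (auto simp: mult_ac simp del: minus_divide_left)
qed

lemma regular_of_inverse:
  assumes "c \<le> \<kappa>" and "l2_has_bounded_inverse (\<lambda>\<phi> x. \<phi> x + T_op V \<kappa> \<phi> x)"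
  shows "regular (of_real \<kappa>)"
proof -
  let ?k = "of_real \<kappa> :: complex"
  have k: "?k \<in> uhp c" using assms(1) c_pos by (simp add: uhp_def)
  obtain S C where SL: "\<And>f. f \<in> L2 \<Longrightarrow> S f \<in> L2" and SC: "\<And>f. f \<in> L2 \<Longrightarrow> l2_norm (S f) \<le> C * l2_norm f"
    and inv: "\<And>f. f \<in> L2 \<Longrightarrow> ae_eq (\<lambda>x. S f x + bs_op ?k (S f) x) f"
      "\<And>f. f \<in> L2 \<Longrightarrow> ae_eq (S (\<lambda>x. f x + bs_op ?k f x)) f"
    using assms(2) unfolding l2_has_bounded_inverse_def l2_bounded_op_def T_op_eq_bs_op by blast
  \<comment> \<open>The bound C of the inverse may be 0 or negative, while
    \<open>regular_const\<close> asks for a positive constant.\<close>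
  have "regular_const ?k (\<bar>C\<bar> + 1)"
    unfolding regular_const_def
  proof (intro conjI ballI k)
    fix h assume h: "h \<in> L2"
    have Bh: "(\<lambda>x. h x + bs_op ?k h x) \<in> L2" using h bs_op_L2[OF k h] by auto
    have "l2_norm h = l2_norm (S (\<lambda>x. h x + bs_op ?k h x))"
      using inv(2)[OF h] h SL[OF Bh] by (intro l2_norm_cong) (auto intro: ae_eq_sym L2_measurable)
    also have "\<dots> \<le> C * l2_norm (\<lambda>x. h x + bs_op ?k h x)"
      by (rule SC[OF Bh])
    also have "\<dots> \<le> (\<bar>C\<bar> + 1) * l2_norm (\<lambda>x. h x + bs_op ?k h x)"
      by (intro mult_right_mono) auto
    finally show "l2_norm h \<le> (\<bar>C\<bar> + 1) * l2_norm (\<lambda>x. h x + bs_op ?k h x)" .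
  next
    fix g assume "g \<in> L2"
    then show "\<exists>h\<in>L2. ae_eq (\<lambda>x. h x + bs_op ?k h x) g"
      using inv(1) SL by blast
  qed simp
  then show ?thesis by (rule regular_constD)
qed

lemma
  assumes "regular (of_real \<bar>\<xi>\<bar>)"
  shows psi_L2: "psi V \<xi> \<in> L2"
    and psi_eq: "ae_eq (\<lambda>x. psi V \<xi> x + bs_op (of_real \<bar>\<xi>\<bar>) (psi V \<xi>) x) (\<lambda>x. va x * exp (\<i> * of_real (x * \<xi>)))"
proof -
  have [measurable]: "(\<lambda>x. exp (\<i> * of_real (x * \<xi>))) \<in> borel_measurable borel"
    by (intro borel_measurable_continuous_onI continuous_intros)
  have "(\<lambda>x. exp (\<i> * of_real (x * \<xi>)) * va x) \<in> L2"
    by (rule L2_mult_bounded[OF va_L2, where B = 1]) auto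
  then have "\<exists>\<phi>. \<phi> \<in> L2 \<and> ae_eq (\<lambda>x. \<phi> x + bs_op (of_real \<bar>\<xi>\<bar>) \<phi> x) (\<lambda>x. va x * exp (\<i> * of_real (x * \<xi>)))"
    using assms regular_const_surj unfolding regular_def by (fastforce simp: mult.commute)
  from someI_ex[OF this]
  show "psi V \<xi> \<in> L2" "ae_eq (\<lambda>x. psi V \<xi> x + bs_op (of_real \<bar>\<xi>\<bar>) (psi V \<xi>) x) (\<lambda>x. va x * exp (\<i> * of_real (x * \<xi>)))"
    unfolding psi_def T_op_eq_bs_op va_def by auto
qed

lemma eigenfn_eq:
  "eigenfn V x \<xi> = exp (\<i> * of_real (x * \<xi>)) - free_res (of_real \<bar>\<xi>\<bar>) (\<lambda>y. vb y * psi V \<xi> y) x"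
proof -
  have i: "1 / (2 * \<i> * of_real \<bar>\<xi>\<bar>) = (- (\<i> / (2 * of_real \<bar>\<xi>\<bar>)) :: complex)"
    by (cases "\<xi> = 0") (auto simp: field_simps)
  have "free_res (of_real \<bar>\<xi>\<bar>) (\<lambda>y. vb y * psi V \<xi> y) x = \<i> / (2 * of_real \<bar>\<xi>\<bar>) *
     (LINT y|lborel. exp (\<i> * of_real (\<bar>\<xi>\<bar> * \<bar>x - y\<bar>)) * of_real (signed_sqrt V y) * psi V \<xi> y)"
    unfolding free_res_def rkernel_def vb_def
    by (subst integral_mult_right_zero[symmetric], intro Bochner_Integration.integral_cong) (auto simp: mult_ac)
  then show ?thesis
    unfolding eigenfn_def i by simp
qed

text \<open>Transposing the Lippmann--Schwinger equation moves the scattering solution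
  from the plane wave to the source.\<close>

lemma eigenfn_pairing:
  assumes k: "regular (of_real \<bar>\<xi>\<bar>)" and g: "integrable lborel g"
  shows "(LINT x|lborel. g x * eigenfn V x \<xi>)
    = (LINT x|lborel. source g (of_real \<bar>\<xi>\<bar>) x * exp (\<i> * of_real (x * \<xi>)))"
proof -
  let ?k = "of_real \<bar>\<xi>\<bar> :: complex"
  let ?w = "source g ?k" and ?v = "sol g ?k" and ?p = "\<lambda>y. vb y * psi V \<xi> y" and ?q = "\<lambda>y. vb y * phi g ?k y"
  let ?pw = "\<lambda>x. exp (\<i> * of_real (x * \<xi>)) :: complex" and ?e = "\<lambda>x. eigenfn V x \<xi>"
  note ku = regular_uhp[OF k] and w = source_integrable[OF k g]
  note p = vb_mult_integrable[OF psi_L2[OF k]] and q = vb_mult_integrable[OF phi_L2[OF k g]]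
  have [measurable]: "?pw \<in> borel_measurable borel"
    by (intro borel_measurable_continuous_onI continuous_intros)
  have [measurable]: "?p \<in> borel_measurable borel" "?w \<in> borel_measurable borel" "?q \<in> borel_measurable borel"
    "?v \<in> borel_measurable borel" "psi V \<xi> \<in> borel_measurable borel" "phi g ?k \<in> borel_measurable borel"
    using p w q sol_measurable[OF k g] psi_L2[OF k] phi_L2[OF k g] by auto
  have em [measurable]: "?e \<in> borel_measurable borel"
    unfolding eigenfn_eq by measurable
  have int_e: "integrable lborel (\<lambda>x. u x * ?e x)" if u: "integrable lborel u" for u
    unfolding eigenfn_eq right_diff_distrib
    using free_res_mult_integrable[OF c_pos ku u p]
    by (intro Bochner_Integration.integrable_diff integrable_exp_mult[OF u]) (simp only: mult.commute)
  \<comment> \<open>The Lippmann-Schwinger equation multiplied by sqrt |V|: \<open>psi\<close> plays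
    for the plane wave the part that \<open>phi\<close> plays for the source.\<close>
  have "AE x in lborel. va x * ?e x = psi V \<xi> x"
    using psi_eq[OF k] unfolding ae_eq_def
  proof eventually_elim
    case (elim x)
    then show ?case
      by (simp add: eigenfn_eq right_diff_distrib bs_op_def[symmetric] diff_eq_eq)
  qed
  \<comment> \<open>Both products are V v e, with one factor sqrt |V| absorbed into v on the left
    and into e on the right.\<close>
  with va_sol[OF k g] have ae: "AE x in lborel. ?q x * ?e x = ?v x * ?p x"
  proof eventually_elim
    case (elim x)
    show ?case by (simp flip: elim add: mult_ac)
  qed
  have "(LINT x|lborel. g x * ?e x) = (LINT x|lborel. ?w x * ?e x + ?q x * ?e x)"
    by (simp add: source_def left_diff_distrib)
  also have "\<dots> = (LINT x|lborel. ?w x * ?e x) + (LINT x|lborel. ?q x * ?e x)"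
    by (rule Bochner_Integration.integral_add[OF int_e[OF w] int_e[OF q]])
  also have "(LINT x|lborel. ?q x * ?e x) = (LINT x|lborel. ?v x * ?p x)"
    using ae by (intro integral_cong_AE) auto
  \<comment> \<open>Symmetry of R_0(k) turns this term into the scattered part of the eigenfunction
    paired with w; it cancels against the same term coming from w times the eigenfunction.\<close>
  also have "\<dots> = (LINT x|lborel. free_res ?k ?p x * ?w x)"
    unfolding sol_def by (rule free_res_symmetric[OF c_pos ku p w])
  also have "(LINT x|lborel. ?w x * ?e x) = (LINT x|lborel. ?w x * ?pw x) - (LINT x|lborel. free_res ?k ?p x * ?w x)"
  proof -
    have "(LINT x|lborel. ?w x * ?e x) = (LINT x|lborel. ?w x * ?pw x - free_res ?k ?p x * ?w x)"
      unfolding eigenfn_eq right_diff_distrib by (simp only: mult.commute[of "?w _" "free_res _ _ _"])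
    also have "\<dots> = (LINT x|lborel. ?w x * ?pw x) - (LINT x|lborel. free_res ?k ?p x * ?w x)"
      by (rule Bochner_Integration.integral_diff[OF integrable_exp_mult[OF w] free_res_mult_integrable[OF c_pos ku w p]])
    finally show ?thesis .
  qed
  finally show ?thesis by (simp only: diff_add_cancel)
qed

lemma Im_pairing:
  assumes \<kappa>: "regular (of_real \<kappa>)" "0 < \<kappa>" and g: "integrable lborel g"
  shows "Im (LINT x|lborel. sol g (of_real \<kappa>) x * cnj (g x))
    = ((cmod (LINT x|lborel. g x * eigenfn V x \<kappa>))\<^sup>2 + (cmod (LINT x|lborel. g x * eigenfn V x (- \<kappa>)))\<^sup>2) / (4 * \<kappa>)"
proof -
  let ?k = "of_real \<kappa> :: complex"
  let ?w = "source g ?k" and ?v = "sol g ?k" and ?q = "\<lambda>y. vb y * phi g ?k y"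
  note k = \<kappa>(1)
  note ku = regular_uhp[OF k] and w = source_integrable[OF k g] and q = vb_mult_integrable[OF phi_L2[OF k g]]
  have [measurable]: "?w \<in> borel_measurable borel" "?q \<in> borel_measurable borel"
    "?v \<in> borel_measurable borel" "phi g ?k \<in> borel_measurable borel"
    using w q sol_measurable[OF k g] phi_L2[OF k g] by auto
  have int: "integrable lborel (\<lambda>x. ?v x * u x)" if "integrable lborel u" for u
    unfolding sol_def by (rule free_res_mult_integrable[OF c_pos ku that w])
  have "(LINT x|lborel. ?v x * cnj (?q x)) = (LINT x|lborel. of_real (V x * (cmod (?v x))\<^sup>2))"
  proof (rule integral_cong_AE)
    show "AE x in lborel. ?v x * cnj (?q x) = of_real (V x * (cmod (?v x))\<^sup>2)"
      using V_sol[OF k g]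
    proof eventually_elim
      case (elim x)
      show ?case
        unfolding elim by (simp add: complex_norm_square mult_ac del: of_real_power)
    qed
  qed auto
  then have real: "Im (LINT x|lborel. ?v x * cnj (?q x)) = 0"
    by (simp only: integral_complex_of_real Im_complex_of_real)
  have "(LINT x|lborel. ?v x * cnj (g x)) = (LINT x|lborel. ?v x * cnj (?w x) + ?v x * cnj (?q x))"
    by (simp add: source_def right_diff_distrib)
  also have "\<dots> = (LINT x|lborel. ?v x * cnj (?w x)) + (LINT x|lborel. ?v x * cnj (?q x))"
    using int[of "\<lambda>x. cnj (?w x)"] int[of "\<lambda>x. cnj (?q x)"] w q
    by (intro Bochner_Integration.integral_add) (auto simp del: complex_cnj_mult)
  finally have "Im (LINT x|lborel. ?v x * cnj (g x)) = Im (LINT x|lborel. ?v x * cnj (?w x))"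
    using real by simp
  also have "\<dots> = ((cmod (LINT x|lborel. ?w x * exp (\<i> * of_real (x * \<kappa>))))\<^sup>2
      + (cmod (LINT x|lborel. ?w x * exp (\<i> * of_real (x * - \<kappa>))))\<^sup>2) / (4 * \<kappa>)"
    unfolding sol_def by (rule Im_free_res_form[OF \<kappa>(2) w])
  \<comment> \<open>Both \<xi> = \<kappa> and \<xi> = -\<kappa> belong to the parameter k =
    \<kappa>, hence to the same source.\<close>
  finally show ?thesis
    using eigenfn_pairing[of \<kappa> g] eigenfn_pairing[of "- \<kappa>" g] k \<kappa>(2) g by simp
qed

end

section \<open>Test functions and weak derivatives\<close>

lemma test_functions_vderiv:
  assumes "\<phi> \<in> test_functions"
  shows "(\<phi> has_vector_derivative vderiv \<phi> x) (at x)"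
proof -
  have "(vderiv ^^ 0) \<phi> differentiable (at x)"
    using assms unfolding test_functions_def by blast
  then show ?thesis
    by (simp add: vderiv_def vector_derivative_works)
qed

lemma test_functions_zero_outside:
  assumes "\<phi> \<in> test_functions"
  obtains R where "0 \<le> R" "\<And>x. R < \<bar>x\<bar> \<Longrightarrow> \<phi> x = 0"
proof -
  have "bounded {x. \<phi> x \<noteq> 0}"
    using assms by (simp add: test_functions_def)
  then obtain R where R: "\<And>x. \<phi> x \<noteq> 0 \<Longrightarrow> \<bar>x\<bar> \<le> R"
    by (auto simp: bounded_iff)
  show thesis
    by (rule that[of "max 0 R"]) (use R in force)+
qed

lemma vderiv_test_functions:
  assumes "\<phi> \<in> test_functions"
  shows "vderiv \<phi> \<in> test_functions"
proof -
  obtain R where R: "0 \<le> R" "\<And>x. R < \<bar>x\<bar> \<Longrightarrow> \<phi> x = 0"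
    using test_functions_zero_outside[OF assms] by blast
  have "vderiv \<phi> x = 0" if "R < \<bar>x\<bar>" for x
  proof -
    have "open {x::real. R < \<bar>x\<bar>}"
      by (intro open_Collect_less continuous_intros)
    then have "\<forall>\<^sub>F y in nhds x. \<phi> y = 0"
      using that R(2) by (auto simp: eventually_nhds)
    moreover have "((\<lambda>_. 0) has_vector_derivative (0 :: complex)) (at x)"
      by simp
    ultimately have "(\<phi> has_vector_derivative 0) (at x)"
      using that R(2) by (subst has_vector_derivative_cong_ev[where g = "\<lambda>_. 0"]) auto
    then show ?thesis
      using test_functions_vderiv[OF assms] vector_derivative_unique_at by blast
  qed
  then have "{x. vderiv \<phi> x \<noteq> 0} \<subseteq> cball 0 R"
    by force
  then have "bounded {x. vderiv \<phi> x \<noteq> 0}"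
    using bounded_cball bounded_subset by blast
  moreover have "(vderiv ^^ n) (vderiv \<phi>) differentiable (at x)" for n x
  proof -
    have "(vderiv ^^ Suc n) \<phi> differentiable (at x)"
      using assms unfolding test_functions_def by blast
    then show ?thesis by (simp add: funpow_swap1)
  qed
  ultimately show ?thesis
    by (simp add: test_functions_def)
qed

lemma test_functions_continuous: "\<phi> \<in> test_functions \<Longrightarrow> continuous_on S \<phi>"
  by (meson continuous_at_imp_continuous_on test_functions_vderiv has_vector_derivative_continuous)

lemma test_functions_measurable: "\<phi> \<in> test_functions \<Longrightarrow> \<phi> \<in> borel_measurable borel"
  by (intro borel_measurable_continuous_onI test_functions_continuous)

lemma test_functions_bounded:
  assumes "\<phi> \<in> test_functions"
  obtains B where "\<And>x. cmod (\<phi> x) \<le> B"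
proof -
  obtain R where R: "0 \<le> R" "\<And>x. R < \<bar>x\<bar> \<Longrightarrow> \<phi> x = 0"
    using test_functions_zero_outside[OF assms] by blast
  have "compact (\<phi> ` {-R..R})"
    by (intro compact_continuous_image test_functions_continuous assms compact_Icc)
  then obtain B where B: "\<And>x. x \<in> {-R..R} \<Longrightarrow> cmod (\<phi> x) \<le> B"
    by (meson compact_imp_bounded bounded_iff imageI)
  have "cmod (\<phi> x) \<le> B" for x
  proof (cases "x \<in> {-R..R}")
    case False
    then have "\<phi> x = 0" using R(2)[of x] by auto
    then show ?thesis using order_trans[OF norm_ge_zero B[of 0]] R(1) by simp
  qed (rule B)
  then show thesis by (rule that)
qed

lemma compactly_supported_integrable:
  fixes h :: "real \<Rightarrow> 'a::{banach, second_countable_topology}"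
  assumes "continuous_on UNIV h" "\<And>x. R < \<bar>x\<bar> \<Longrightarrow> h x = 0"
  shows "integrable lborel h"
proof -
  have "integrable lborel (\<lambda>x. indicator {-R..R} x *\<^sub>R h x)"
    by (intro borel_integrable_compact compact_Icc continuous_on_subset[OF assms(1)]) auto
  moreover have "indicator {-R..R} x *\<^sub>R h x = h x" for x
    using assms(2)[of x] by (cases "x \<in> {-R..R}") auto
  ultimately show ?thesis by simp
qed

lemma test_functions_integrable:
  assumes "\<phi> \<in> test_functions"
  shows "integrable lborel \<phi>"
proof -
  obtain R where "\<And>x. R < \<bar>x\<bar> \<Longrightarrow> \<phi> x = 0"
    using test_functions_zero_outside[OF assms] by blast
  then show ?thesis
    by (intro compactly_supported_integrable test_functions_continuous assms)
qed

lemma test_functions_L2: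
  assumes "\<phi> \<in> test_functions"
  shows "\<phi> \<in> L2"
proof -
  obtain R where "\<And>x. R < \<bar>x\<bar> \<Longrightarrow> \<phi> x = 0"
    using test_functions_zero_outside[OF assms] by blast
  then have "integrable lborel (\<lambda>x. (cmod (\<phi> x))\<^sup>2)"
    by (intro compactly_supported_integrable[where R = R] continuous_intros test_functions_continuous assms) auto
  then show ?thesis
    using test_functions_measurable[OF assms] by (simp add: L2_def)
qed

section \<open>Weak derivatives of the free resolvent\<close>

lemma exp_affine_has_vector_derivative:
  fixes m :: complex
  shows "((\<lambda>x. exp (m * of_real (x - a))) has_vector_derivative m * exp (m * of_real (x - a))) (at x within S)"
proof -
  have "((\<lambda>z. exp (m * (z - of_real a))) has_field_derivative m * exp (m * (of_real x - of_real a))) (at (of_real x))"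
    by (auto intro!: derivative_eq_intros)
  from has_vector_derivative_real_field[OF this] show ?thesis
    by simp
qed

text \<open>The integrands are the exact derivatives of exp (i k |x - a|) \<phi>(x) on the two
  half-lines, so only the boundary value at a remains.\<close>

lemma
  assumes \<phi>: "\<phi> \<in> test_functions"
  shows test_half_line_right:
    "(LINT x|lborel. indicator {a..} x *\<^sub>R (exp (\<i> * k * of_real \<bar>x - a\<bar>) * (\<i> * k * \<phi> x + vderiv \<phi> x))) = - \<phi> a"
    and test_half_line_left:
    "(LINT x|lborel. indicator {..a} x *\<^sub>R (exp (\<i> * k * of_real \<bar>x - a\<bar>) * (vderiv \<phi> x - \<i> * k * \<phi> x))) = \<phi> a"
proof -
  note \<phi>' = vderiv_test_functions[OF \<phi>]
  obtain R1 where R1: "0 \<le> R1" "\<And>x. R1 < \<bar>x\<bar> \<Longrightarrow> \<phi> x = 0"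
    using test_functions_zero_outside[OF \<phi>] by blast
  obtain R2 where R2: "0 \<le> R2" "\<And>x. R2 < \<bar>x\<bar> \<Longrightarrow> vderiv \<phi> x = 0"
    using test_functions_zero_outside[OF \<phi>'] by blast
  \<comment> \<open>Large enough for a to lie in [-R, R] and, because of the added 1, for \<phi> and
    its derivative to vanish already at the end points.\<close>
  define R where "R = \<bar>a\<bar> + R1 + R2 + 1"
  have R: "\<phi> x = 0" "vderiv \<phi> x = 0" if "R \<le> \<bar>x\<bar>" for x
    using that R1 R2 by (auto simp: R_def)
  have Ra: "a \<le> R" "- R \<le> a" "0 \<le> R" using R1(1) R2(1) by (auto simp: R_def)
  let ?f = "\<lambda>x. exp (\<i> * k * of_real (x - a)) * (\<i> * k * \<phi> x + vderiv \<phi> x)"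
  have "(LINT x|lborel. indicator {a..R} x *\<^sub>R ?f x) = exp (\<i> * k * of_real (R - a)) * \<phi> R - exp (\<i> * k * of_real (a - a)) * \<phi> a"
  proof (rule integral_FTC_Icc[OF Ra(1)])
    fix x
    show "((\<lambda>x. exp (\<i> * k * of_real (x - a)) * \<phi> x) has_vector_derivative ?f x) (at x within {a..R})"
      using has_vector_derivative_mult[OF exp_affine_has_vector_derivative[of "\<i> * k" a x "{a..R}"]
          has_vector_derivative_at_within[OF test_functions_vderiv[OF \<phi>]]]
      by (simp add: algebra_simps)
  qed (intro continuous_intros test_functions_continuous \<phi> \<phi>')
  also have "\<dots> = - \<phi> a"
    using R(1)[of R] Ra by simp
  also have "(\<lambda>x. indicator {a..R} x *\<^sub>R ?f x)
      = (\<lambda>x. indicator {a..} x *\<^sub>R (exp (\<i> * k * of_real \<bar>x - a\<bar>) * (\<i> * k * \<phi> x + vderiv \<phi> x)))"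
    using R Ra by (auto simp: fun_eq_iff indicator_def)
  finally show "(LINT x|lborel. indicator {a..} x *\<^sub>R (exp (\<i> * k * of_real \<bar>x - a\<bar>) * (\<i> * k * \<phi> x + vderiv \<phi> x))) = - \<phi> a" .
  let ?g = "\<lambda>x. exp (\<i> * k * of_real (a - x)) * (vderiv \<phi> x - \<i> * k * \<phi> x)"
  have "(LINT x|lborel. indicator {-R..a} x *\<^sub>R ?g x) = exp (\<i> * k * of_real (a - a)) * \<phi> a - exp (\<i> * k * of_real (a - (-R))) * \<phi> (-R)"
  proof (rule integral_FTC_Icc[OF Ra(2)])
    fix x
    show "((\<lambda>x. exp (\<i> * k * of_real (a - x)) * \<phi> x) has_vector_derivative ?g x) (at x within {-R..a})"
      using has_vector_derivative_mult[OF exp_affine_has_vector_derivative[of "- (\<i> * k)" a x "{-R..a}"]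
          has_vector_derivative_at_within[OF test_functions_vderiv[OF \<phi>]]]
      by (simp add: algebra_simps)
  qed (intro continuous_intros test_functions_continuous \<phi> \<phi>')
  also have "\<dots> = \<phi> a"
    using R(1)[of "-R"] Ra by simp
  also have "(\<lambda>x. indicator {-R..a} x *\<^sub>R ?g x)
      = (\<lambda>x. indicator {..a} x *\<^sub>R (exp (\<i> * k * of_real \<bar>x - a\<bar>) * (vderiv \<phi> x - \<i> * k * \<phi> x)))"
    using R Ra by (auto simp: fun_eq_iff indicator_def abs_if)
  finally show "(LINT x|lborel. indicator {..a} x *\<^sub>R (exp (\<i> * k * of_real \<bar>x - a\<bar>) * (vderiv \<phi> x - \<i> * k * \<phi> x))) = \<phi> a" .
qed

text \<open>The derivative of \<open>rkernel k \<bar>r\<bar>\<close> in r, in which the factor 1 / k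
  cancels. It jumps by -1 at r = 0, which produces the delta function.\<close>

definition drkernel :: "complex \<Rightarrow> real \<Rightarrow> complex" where
  "drkernel k r = - of_real (sgn r) / 2 * exp (\<i> * k * of_real \<bar>r\<bar>)"

lemma drkernel_measurable [measurable]: "drkernel k \<in> borel_measurable borel"
proof -
  have [measurable]: "(\<lambda>r. exp (\<i> * k * of_real \<bar>r\<bar>)) \<in> borel_measurable borel"
    by (intro borel_measurable_continuous_onI continuous_intros)
  show ?thesis unfolding drkernel_def by measurable
qed

lemma integrable_exp_abs_mult:
  assumes "0 \<le> Im k" "integrable lborel u"
  shows "integrable lborel (\<lambda>x. exp (\<i> * k * of_real \<bar>x - a\<bar>) * u x)"
proof (rule Bochner_Integration.integrable_bound[OF assms(2)])
  have [measurable]: "u \<in> borel_measurable borel" using assms by auto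
  have [measurable]: "(\<lambda>x. exp (\<i> * k * of_real \<bar>x - a\<bar>)) \<in> borel_measurable borel"
    by (intro borel_measurable_continuous_onI continuous_intros)
  show "(\<lambda>x. exp (\<i> * k * of_real \<bar>x - a\<bar>) * u x) \<in> borel_measurable lborel"
    by measurable
  show "AE x in lborel. cmod (exp (\<i> * k * of_real \<bar>x - a\<bar>) * u x) \<le> cmod (u x)"
    using assms by (intro AE_I2) (simp add: norm_mult mult_left_le_one_le)
qed

text \<open>In distributional terms, the kernel K with pole a has the derivative dK, and the
  derivative of dK is - k^2 K minus the delta function at a. In the even kernel the boundary values
  from the two half-lines cancel; in the odd one they combine to \<phi>(a).\<close>

lemma
  assumes k: "0 \<le> Im k" "k \<noteq> 0" and \<phi>: "\<phi> \<in> test_functions"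
  shows rkernel_weak_deriv:
    "(LINT x|lborel. rkernel k \<bar>x - a\<bar> * vderiv \<phi> x) = - (LINT x|lborel. drkernel k (x - a) * \<phi> x)"
    and drkernel_weak_deriv:
    "(LINT x|lborel. drkernel k (x - a) * vderiv \<phi> x) = k\<^sup>2 * (LINT x|lborel. rkernel k \<bar>x - a\<bar> * \<phi> x) + \<phi> a"
proof -
  note \<phi>' = vderiv_test_functions[OF \<phi>]
  let ?e = "\<lambda>x. exp (\<i> * k * of_real \<bar>x - a\<bar>)"
  define R where "R u = (LINT x|lborel. indicator {a..} x *\<^sub>R (?e x * u x))" for u
  define L where "L u = (LINT x|lborel. indicator {..a} x *\<^sub>R (?e x * u x))" for u
  have iR: "integrable lborel (\<lambda>x. indicator {a..} x *\<^sub>R (?e x * u x))"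
    and iL: "integrable lborel (\<lambda>x. indicator {..a} x *\<^sub>R (?e x * u x))" if "integrable lborel u" for u
    using integrable_exp_abs_mult[OF k(1) that, of a] by (auto intro!: integrable_mult_indicator)
  have int: "integrable lborel \<phi>" "integrable lborel (vderiv \<phi>)"
    using \<phi> \<phi>' by (auto intro: test_functions_integrable)
  have R': "R (vderiv \<phi>) = - \<phi> a - \<i> * k * R \<phi>"
  proof -
    have "- \<phi> a = (LINT x|lborel. \<i> * k * (indicator {a..} x *\<^sub>R (?e x * \<phi> x)) + indicator {a..} x *\<^sub>R (?e x * vderiv \<phi> x))"
    proof (subst test_half_line_right[OF \<phi>, of a k, symmetric], rule Bochner_Integration.integral_cong[OF refl])
      fix x
      have "?e x * (\<i> * k * \<phi> x + vderiv \<phi> x) = \<i> * k * (?e x * \<phi> x) + ?e x * vderiv \<phi> x"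
        by (simp only: distrib_left distrib_right mult_ac)
      then show "indicator {a..} x *\<^sub>R (?e x * (\<i> * k * \<phi> x + vderiv \<phi> x))
          = \<i> * k * (indicator {a..} x *\<^sub>R (?e x * \<phi> x)) + indicator {a..} x *\<^sub>R (?e x * vderiv \<phi> x)"
        by (cases "x \<in> {a..}") simp_all
    qed
    also have "\<dots> = \<i> * k * R \<phi> + R (vderiv \<phi>)"
      unfolding R_def
      by (subst Bochner_Integration.integral_add)
         (intro integrable_mult_right iR int, intro iR int, simp only: integral_mult_right_zero)
    finally show ?thesis by simp
  qed
  have L': "L (vderiv \<phi>) = \<phi> a + \<i> * k * L \<phi>"
  proof -
    have "\<phi> a = (LINT x|lborel. indicator {..a} x *\<^sub>R (?e x * vderiv \<phi> x) - \<i> * k * (indicator {..a} x *\<^sub>R (?e x * \<phi> x)))"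
    proof (subst (1) test_half_line_left[OF \<phi>, of a k, symmetric], rule Bochner_Integration.integral_cong[OF refl])
      fix x
      have "?e x * (vderiv \<phi> x - \<i> * k * \<phi> x) = ?e x * vderiv \<phi> x - \<i> * k * (?e x * \<phi> x)"
        by (simp only: right_diff_distrib left_diff_distrib mult_ac)
      then show "indicator {..a} x *\<^sub>R (?e x * (vderiv \<phi> x - \<i> * k * \<phi> x))
          = indicator {..a} x *\<^sub>R (?e x * vderiv \<phi> x) - \<i> * k * (indicator {..a} x *\<^sub>R (?e x * \<phi> x))"
        by (cases "x \<in> {..a}") simp_all
    qed
    also have "\<dots> = L (vderiv \<phi>) - \<i> * k * L \<phi>"
      unfolding L_def
      by (subst Bochner_Integration.integral_diff)
         (intro iL int, intro integrable_mult_right iL int, simp only: integral_mult_right_zero)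
    finally show ?thesis by simp
  qed
  \<comment> \<open>The two closed half-lines overlap in a, which is a null set.\<close>
  have ne: "AE x in lborel. x \<noteq> a"
    by (rule AE_lborel_singleton)
  have E: "(LINT x|lborel. rkernel k \<bar>x - a\<bar> * u x) = \<i> / (2 * k) * (R u + L u)" if u: "integrable lborel u" for u
  proof -
    have [measurable]: "u \<in> borel_measurable borel" "?e \<in> borel_measurable borel"
      using u by (auto intro!: borel_measurable_continuous_onI continuous_intros)
    have "(LINT x|lborel. rkernel k \<bar>x - a\<bar> * u x)
      = (LINT x|lborel. \<i> / (2 * k) * (indicator {a..} x *\<^sub>R (?e x * u x) + indicator {..a} x *\<^sub>R (?e x * u x)))"
    proof (rule integral_cong_AE)
      show "AE x in lborel. rkernel k \<bar>x - a\<bar> * u x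
          = \<i> / (2 * k) * (indicator {a..} x *\<^sub>R (?e x * u x) + indicator {..a} x *\<^sub>R (?e x * u x))"
        using ne by eventually_elim (auto simp: rkernel_def indicator_def)
    qed auto
    then show ?thesis
      unfolding R_def L_def using iR[OF u] iL[OF u] by simp
  qed
  have S: "(LINT x|lborel. drkernel k (x - a) * u x) = - 1 / 2 * (R u - L u)" if u: "integrable lborel u" for u
  proof -
    have [measurable]: "u \<in> borel_measurable borel" "?e \<in> borel_measurable borel"
      using u by (auto intro!: borel_measurable_continuous_onI continuous_intros)
    have "(LINT x|lborel. drkernel k (x - a) * u x)
      = (LINT x|lborel. - 1 / 2 * (indicator {a..} x *\<^sub>R (?e x * u x) - indicator {..a} x *\<^sub>R (?e x * u x)))"
    proof (rule integral_cong_AE)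
      show "AE x in lborel. drkernel k (x - a) * u x
          = - 1 / 2 * (indicator {a..} x *\<^sub>R (?e x * u x) - indicator {..a} x *\<^sub>R (?e x * u x))"
        using ne by eventually_elim (auto simp: drkernel_def indicator_def sgn_if)
    qed auto
    also have "\<dots> = - 1 / 2 * (LINT x|lborel. indicator {a..} x *\<^sub>R (?e x * u x) - indicator {..a} x *\<^sub>R (?e x * u x))"
      by (rule integral_mult_right_zero)
    finally show ?thesis
      unfolding R_def L_def using iR[OF u] iL[OF u] by simp
  qed
  show "(LINT x|lborel. rkernel k \<bar>x - a\<bar> * vderiv \<phi> x) = - (LINT x|lborel. drkernel k (x - a) * \<phi> x)"
    unfolding E[OF int(2)] S[OF int(1)] R' L' using k(2) by (simp add: field_simps)
  show "(LINT x|lborel. drkernel k (x - a) * vderiv \<phi> x) = k\<^sup>2 * (LINT x|lborel. rkernel k \<bar>x - a\<bar> * \<phi> x) + \<phi> a"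
    unfolding E[OF int(1)] S[OF int(2)] R' L' using k(2) by (simp add: field_simps power2_eq_square)
qed

lemma integrable_exp_abs:
  fixes \<eta> :: real
  assumes "0 < \<eta>"
  shows "integrable lborel (\<lambda>x. exp (- (\<eta> * \<bar>x\<bar>)))"
proof -
  let ?h = "\<lambda>x::real. indicator {0::real..} x *\<^sub>R exp (- \<eta> * x)"
  have "(\<lambda>x. exp (- \<eta> * x)) absolutely_integrable_on {0..}"
    using has_integral_exp_minus_to_infinity[OF assms, of 0]
    by (intro nonnegative_absolutely_integrable_1) (auto simp: has_integral_integrable)
  then have "integrable lebesgue ?h"
    by (simp add: set_integrable_def)
  then have h: "integrable lborel ?h"
    by (subst (asm) integrable_completion) auto
  have h': "integrable lborel (\<lambda>x. ?h (0 + (-1) * x))"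
    by (rule lborel_integrable_real_affine[OF h]) simp
  show ?thesis
    by (rule Bochner_Integration.integrable_bound[OF Bochner_Integration.integrable_add[OF h h']])
       (auto simp: indicator_def abs_if)
qed

text \<open>Young's inequality for an L2 kernel and an L1 function: Cauchy-Schwarz with respect to
  |w(y)| dy bounds the square by an integral of |K|^2 against |w|, which Fubini integrates in x.
  Boundedness of K makes the integrand integrable at every x.\<close>

lemma convolution_L2:
  fixes K :: "real \<Rightarrow> complex"
  assumes K [measurable]: "K \<in> borel_measurable borel" and K2: "integrable lborel (\<lambda>x. (cmod (K x))\<^sup>2)"
    and B: "\<And>x. cmod (K x) \<le> B" and w: "integrable lborel w"
  shows "(\<lambda>x. LINT y|lborel. K (x - y) * w y) \<in> L2"
proof -
  have [measurable]: "w \<in> borel_measurable borel" using w by auto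
  let ?I = "\<lambda>x. LINT y|lborel. (cmod (K (x - y)))\<^sup>2 * cmod (w y)"
  have m: "(\<lambda>(y, x). (cmod (K (x - y)))\<^sup>2 * cmod (w y)) \<in> borel_measurable (lborel \<Otimes>\<^sub>M lborel)"
    by measurable
  have tr: "integrable lborel (\<lambda>x. (cmod (K (x - y)))\<^sup>2)"
    and trI: "(LINT x|lborel. (cmod (K (x - y)))\<^sup>2) = (LINT x|lborel. (cmod (K x))\<^sup>2)" for y
    using lborel_integrable_real_affine[OF K2, of 1 "-y"]
      lborel_integral_real_affine[of 1 "\<lambda>x. (cmod (K x))\<^sup>2" "-y"] by auto
  have "integrable (lborel \<Otimes>\<^sub>M lborel) (\<lambda>(y, x). (cmod (K (x - y)))\<^sup>2 * cmod (w y))"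
  proof (rule lborel_pair.Fubini_integrable[OF m])
    show "integrable lborel (\<lambda>y. LINT x|lborel. norm (case (y, x) of (y, x) \<Rightarrow> (cmod (K (x - y)))\<^sup>2 * cmod (w y)))"
      using w by (simp add: trI)
  qed (use tr in auto)
  from lborel_pair.integrable_snd[OF this]
  have int: "integrable lborel (\<lambda>x. ?I x * (LINT y|lborel. cmod (w y)))"
    by simp
  show ?thesis
  proof (rule L2_bound[OF _ int], measurable, intro AE_I2)
    fix x
    have KB: "(cmod (K (x - y)))\<^sup>2 \<le> B\<^sup>2" for y
      using B by (intro power_mono) auto
    have i1: "integrable lborel (\<lambda>y. (cmod (K (x - y)))\<^sup>2 * cmod (w y))"
    proof (rule Bochner_Integration.integrable_bound)
      show "integrable lborel (\<lambda>y. B\<^sup>2 * cmod (w y))" using w by auto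
    qed (use KB in \<open>auto intro!: mult_right_mono\<close>)
    have "(cmod (LINT y|lborel. K (x - y) * w y))\<^sup>2 \<le> (LINT y|lborel. \<bar>(cmod (K (x - y)) * sqrt (cmod (w y))) * sqrt (cmod (w y))\<bar>)\<^sup>2"
      by (intro power_mono order_trans[OF integral_norm_bound]) (auto simp: norm_mult mult.assoc)
    also have "\<dots> \<le> (LINT y|lborel. (cmod (K (x - y)) * sqrt (cmod (w y)))\<^sup>2) * (LINT y|lborel. (sqrt (cmod (w y)))\<^sup>2)"
      using i1 w by (intro Cauchy_Schwarz_integral(2)) (auto simp: power_mult_distrib)
    also have "\<dots> = ?I x * (LINT y|lborel. cmod (w y))"
      by (simp add: power_mult_distrib)
    finally show "(cmod (LINT y|lborel. K (x - y) * w y))\<^sup>2 \<le> ?I x * (LINT y|lborel. cmod (w y))" .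
  qed
qed

definition dfree_res :: "complex \<Rightarrow> (real \<Rightarrow> complex) \<Rightarrow> real \<Rightarrow> complex" where
  "dfree_res k w x = (LINT y|lborel. drkernel k (x - y) * w y)"

text \<open>Im k > 0 makes both kernels decay exponentially, hence square integrable; on the real
  axis this fails.\<close>

lemma
  assumes k: "0 < Im k" and w: "integrable lborel w"
  shows free_res_L2: "free_res k w \<in> L2" and dfree_res_L2: "dfree_res k w \<in> L2"
proof -
  have sq: "(exp (- (Im k * \<bar>x\<bar>)))\<^sup>2 = exp (- ((2 * Im k) * \<bar>x\<bar>))" for x
    by (simp add: power2_eq_square exp_add[symmetric])
  have e: "integrable lborel (\<lambda>x. exp (- ((2 * Im k) * \<bar>x\<bar>)))"
    using k by (intro integrable_exp_abs) simp
  have n1: "cmod (rkernel k \<bar>x\<bar>) = exp (- (Im k * \<bar>x\<bar>)) / (2 * cmod k)" for x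
    by (simp add: rkernel_def norm_mult norm_divide)
  have n2: "cmod (drkernel k x) = \<bar>sgn x\<bar> / 2 * exp (- (Im k * \<bar>x\<bar>))" for x
    by (simp add: drkernel_def norm_mult norm_divide)
  have le1: "exp (- (Im k * \<bar>x\<bar>)) \<le> 1" for x
    using k by simp
  have le2: "exp (- (Im k * \<bar>x\<bar>)) \<le> 2" for x
    using le1[of x] by linarith
  show "free_res k w \<in> L2"
    unfolding free_res_def[abs_def]
  proof (rule convolution_L2[where K = "\<lambda>x. rkernel k \<bar>x\<bar>"])
    show "integrable lborel (\<lambda>x. (cmod (rkernel k \<bar>x\<bar>))\<^sup>2)"
      unfolding n1 power_divide sq using e by auto
    show "cmod (rkernel k \<bar>x\<bar>) \<le> 1 / (2 * cmod k)" for x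
      unfolding n1 using le1 by (intro divide_right_mono) auto
  qed (use w in auto)
  show "dfree_res k w \<in> L2"
    unfolding dfree_res_def[abs_def]
  proof (rule convolution_L2)
    show "integrable lborel (\<lambda>x. (cmod (drkernel k x))\<^sup>2)"
      unfolding n2 power_mult_distrib sq
      by (rule Bochner_Integration.integrable_bound[OF e]) (auto simp: power_divide abs_sgn_eq intro!: AE_I2)
    show "cmod (drkernel k x) \<le> 1" for x
      unfolding n2 using le2[of x] by (auto simp: abs_sgn_eq)
  qed (use w in auto)
qed

text \<open>Fubini moves the derivative of the test function onto the kernel, whose weak derivatives
  are known; the delta function returns the term - w.\<close>

lemma
  assumes k: "0 < Im k" and w: "integrable lborel w"
  shows free_res_weak_derivative: "weak_derivative (free_res k w) (dfree_res k w)"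
    and dfree_res_weak_derivative: "weak_derivative (dfree_res k w) (\<lambda>x. - k\<^sup>2 * free_res k w x - w x)"
proof -
  have k0: "k \<noteq> 0" and k1: "0 \<le> Im k" using k by auto
  have cpos: "0 < cmod k" and ku: "k \<in> uhp (cmod k)" using k0 k1 by (auto simp: uhp_def)
  have bd: "cmod (drkernel k x) \<le> 1" for x
  proof -
    have "exp (- (Im k * \<bar>x\<bar>)) \<le> 2"
      using k by (rule_tac order_trans[of _ 1]) auto
    then show ?thesis
      by (simp add: drkernel_def norm_mult norm_divide abs_sgn_eq)
  qed
  have [measurable]: "w \<in> borel_measurable borel" using w by auto
  have dswap: "(LINT x|lborel. dfree_res k w x * u x) = (LINT y|lborel. (LINT x|lborel. drkernel k (x - y) * u x) * w y)"
    if u: "integrable lborel u" for u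
  proof -
    have "integrable (lborel \<Otimes>\<^sub>M lborel) (\<lambda>(x, y). drkernel k (x - y) * w y * u x)"
      by (rule integrable_lborel_product[OF u w _ bd]) measurable
    from lborel_pair.Fubini_integral[OF this]
    have "(LINT x|lborel. LINT y|lborel. drkernel k (x - y) * w y * u x) = (LINT y|lborel. LINT x|lborel. drkernel k (x - y) * w y * u x)"
      by simp
    also have "\<dots> = (LINT y|lborel. LINT x|lborel. drkernel k (x - y) * u x * w y)"
      by (simp add: mult_ac)
    finally show ?thesis by (simp add: dfree_res_def)
  qed
  have swap: "(LINT x|lborel. free_res k w x * u x) = (LINT y|lborel. (LINT x|lborel. rkernel k \<bar>x - y\<bar> * u x) * w y)"
    if u: "integrable lborel u" for u
    using free_res_symmetric[OF cpos ku u w] by (simp add: free_res_def abs_minus_commute)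
  show "weak_derivative (free_res k w) (dfree_res k w)"
    unfolding weak_derivative_def
  proof
    fix \<phi> assume \<phi>: "\<phi> \<in> test_functions"
    note i = test_functions_integrable[OF \<phi>] test_functions_integrable[OF vderiv_test_functions[OF \<phi>]]
    show "(LINT x|lborel. free_res k w x * vderiv \<phi> x) = - (LINT x|lborel. dfree_res k w x * \<phi> x)"
      unfolding swap[OF i(2)] dswap[OF i(1)] rkernel_weak_deriv[OF k1 k0 \<phi>] by simp
  qed
  show "weak_derivative (dfree_res k w) (\<lambda>x. - k\<^sup>2 * free_res k w x - w x)"
    unfolding weak_derivative_def
  proof
    fix \<phi> assume \<phi>: "\<phi> \<in> test_functions"
    note i = test_functions_integrable[OF \<phi>] test_functions_integrable[OF vderiv_test_functions[OF \<phi>]]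
    obtain B where B: "\<And>x. cmod (\<phi> x) \<le> B" using test_functions_bounded[OF \<phi>] by blast
    have B0: "0 \<le> B" using order_trans[OF norm_ge_zero B] .
    have [measurable]: "\<phi> \<in> borel_measurable borel" using test_functions_measurable[OF \<phi>] .
    have w\<phi>: "integrable lborel (\<lambda>x. w x * \<phi> x)"
      by (rule Bochner_Integration.integrable_bound[OF integrable_mult_right[OF w, of "of_real B"]])
         (use B B0 in \<open>auto simp: norm_mult mult.commute intro!: mult_right_mono\<close>)
    have v\<phi>: "integrable lborel (\<lambda>x. free_res k w x * \<phi> x)"
      by (rule free_res_mult_integrable[OF cpos ku i(1) w])
    have J: "integrable lborel (\<lambda>y. (LINT x|lborel. rkernel k \<bar>x - y\<bar> * \<phi> x) * w y)"
      using free_res_mult_integrable[OF cpos ku w i(1)] by (simp add: free_res_def abs_minus_commute)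
    have "(LINT x|lborel. dfree_res k w x * vderiv \<phi> x)
        = (LINT y|lborel. k\<^sup>2 * ((LINT x|lborel. rkernel k \<bar>x - y\<bar> * \<phi> x) * w y) + w y * \<phi> y)"
      unfolding dswap[OF i(2)] drkernel_weak_deriv[OF k1 k0 \<phi>] by (simp only: distrib_right mult.assoc mult.commute[of "w _" "\<phi> _"])
    also have "\<dots> = k\<^sup>2 * (LINT x|lborel. free_res k w x * \<phi> x) + (LINT x|lborel. w x * \<phi> x)"
      unfolding swap[OF i(1)] using J w\<phi> by (subst Bochner_Integration.integral_add) auto
    also have "\<dots> = - (LINT x|lborel. - k\<^sup>2 * (free_res k w x * \<phi> x) - w x * \<phi> x)"
      using v\<phi> w\<phi> by (subst Bochner_Integration.integral_diff) auto
    finally show "(LINT x|lborel. dfree_res k w x * vderiv \<phi> x)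
        = - (LINT x|lborel. (- k\<^sup>2 * free_res k w x - w x) * \<phi> x)"
      by (simp add: left_diff_distrib mult.assoc)
  qed
qed

section \<open>Smooth bump functions and the density of test functions\<close>

text \<open>Derivatives of the bump function \<open>exp (- m / ((x - a) (b - x)))\<close> stay in the family
  \<open>p / ((x - a) (b - x)) ^ j * exp (- m / ((x - a) (b - x)))\<close> with \<open>p\<close> a polynomial.\<close>

definition bump_poly :: "real \<Rightarrow> real \<Rightarrow> real poly" where
  "bump_poly a b = [:- a, 1:] * [:b, - 1:]"

definition bump :: "real \<Rightarrow> real \<Rightarrow> real \<Rightarrow> real poly \<Rightarrow> nat \<Rightarrow> real \<Rightarrow> real" where
  "bump m a b p j x = (if a < x \<and> x < b
     then poly p x / poly (bump_poly a b) x ^ j * exp (- m / poly (bump_poly a b) x) else 0)"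

lemma poly_bump_poly: "poly (bump_poly a b) x = (x - a) * (b - x)"
  by (simp add: bump_poly_def algebra_simps)

text \<open>From exp y \<ge> (1 + y / n)^n \<ge> (y / n)^n with y = m / D: the exponential beats
  every negative power of D.\<close>

lemma exp_minus_inverse_le:
  fixes m D :: real
  assumes "0 < m" "0 < D" "0 < n"
  shows "exp (- m / D) \<le> (real n / m) ^ n * D ^ n"
proof -
  have y: "0 < m / D" using assms by simp
  have "(m / D / n) ^ n \<le> (1 + m / D / n) ^ n"
    using assms by (intro power_mono) auto
  also have "\<dots> \<le> exp (m / D)"
    using y assms(3) by (intro exp_ge_one_plus_x_over_n_power_n) (auto simp: le_less_trans less_imp_le)
  finally have le: "(m / D / n) ^ n \<le> exp (m / D)" .
  have pos: "0 < (m / D / n) ^ n" using assms by simp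
  have "exp (- m / D) = inverse (exp (m / D))"
    by (simp add: exp_minus)
  also have "\<dots> \<le> inverse ((m / D / n) ^ n)"
    using le pos by (rule le_imp_inverse_le)
  also have "\<dots> = (real n / m) ^ n * D ^ n"
    by (simp add: power_inverse[symmetric] power_mult_distrib[symmetric] divide_inverse mult_ac)
  finally show ?thesis .
qed

text \<open>For c outside the open interval, D = (x - a)(b - x) is at most (b - a) |x - c|.
  Estimating the exponential by D^n with n = j + 2 cancels D^j and leaves D^2, a bound of second
  order at c, which forces the derivative there to be 0.\<close>

lemma bump_quadratic_bound:
  assumes "0 < m" and c: "c \<le> a \<or> b \<le> c"
  obtains K where "\<And>x. \<bar>bump m a b p j x\<bar> \<le> K * (x - c)\<^sup>2"
proof -
  let ?D = "\<lambda>x. poly (bump_poly a b) x"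
  have "compact (poly p ` {a..b})"
    by (intro compact_continuous_image continuous_on_poly continuous_on_id compact_Icc)
  then obtain P where P: "\<And>x. x \<in> {a..b} \<Longrightarrow> \<bar>poly p x\<bar> \<le> P"
    by (metis compact_imp_bounded bounded_iff imageI real_norm_def)
  define n where "n = j + 2"
  have n: "0 < n" by (simp add: n_def)
  let ?K = "\<bar>P\<bar> * (real n / m) ^ n * (b - a)\<^sup>2"
  have "\<bar>bump m a b p j x\<bar> \<le> ?K * (x - c)\<^sup>2" for x
  proof (cases "a < x \<and> x < b")
    case True
    then have D: "0 < ?D x" by (simp add: poly_bump_poly)
    have "?D x \<le> (b - a) * \<bar>x - c\<bar>"
      using c
    proof
      assume "c \<le> a"
      then have "(x - a) * (b - x) \<le> \<bar>x - c\<bar> * (b - a)"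
        using True by (intro mult_mono) auto
      then show ?thesis by (simp add: poly_bump_poly mult.commute)
    next
      assume "b \<le> c"
      then have "(x - a) * (b - x) \<le> (b - a) * \<bar>x - c\<bar>"
        using True by (intro mult_mono) auto
      then show ?thesis by (simp add: poly_bump_poly)
    qed
    then have D2: "(?D x)\<^sup>2 \<le> (b - a)\<^sup>2 * (x - c)\<^sup>2"
      using D power_mono[of "?D x" "(b - a) * \<bar>x - c\<bar>" 2] by (simp add: power_mult_distrib)
    have "\<bar>bump m a b p j x\<bar> = \<bar>poly p x\<bar> / ?D x ^ j * exp (- m / ?D x)"
      using True D by (simp add: bump_def abs_mult)
    also have "\<dots> \<le> \<bar>P\<bar> / ?D x ^ j * ((real n / m) ^ n * ?D x ^ n)"
      using True D P[of x] assms(1) n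
      by (intro mult_mono divide_right_mono exp_minus_inverse_le) auto
    also have "\<dots> = \<bar>P\<bar> * (real n / m) ^ n * (?D x)\<^sup>2"
      using D by (simp add: n_def power_add power2_eq_square)
    also have "\<dots> \<le> \<bar>P\<bar> * (real n / m) ^ n * ((b - a)\<^sup>2 * (x - c)\<^sup>2)"
      using D2 assms(1) by (intro mult_left_mono) auto
    finally show ?thesis by (simp add: mult.assoc)
  next
    case False
    then have "bump m a b p j x = 0" by (auto simp: bump_def)
    then show ?thesis using assms(1) by simp
  qed
  then show thesis by (rule that)
qed

text \<open>Differentiating the quotient raises the power of D by one, differentiating the
  exponential by two; \<open>q\<close> is the numerator over the common denominator
  \<open>D ^ (j + 2)\<close>.\<close>

lemma bump_has_derivative:
  fixes m a b :: real
  assumes m: "0 < m"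
  defines "D \<equiv> bump_poly a b"
  defines "q \<equiv> \<lambda>p j. pderiv p * D * D - of_nat j * p * pderiv D * D + smult m (p * pderiv D)"
  shows "(bump m a b p j has_field_derivative bump m a b (q p j) (j + 2) x) (at x)"
proof (cases "a < x \<and> x < b")
  case True
  then have pos: "poly D x \<noteq> 0" by (simp add: D_def poly_bump_poly)
  have "((\<lambda>x. poly p x / poly D x ^ j * exp (- m / poly D x)) has_field_derivative
      poly (q p j) x / poly D x ^ (j + 2) * exp (- m / poly D x)) (at x)"
  proof -
    have "((\<lambda>x. poly p x / poly D x ^ j * exp (- m / poly D x)) has_field_derivative
      ((poly (pderiv p) x * poly D x ^ j - poly p x * (real j * poly D x ^ (j - 1) * poly (pderiv D) x)) / (poly D x ^ j * poly D x ^ j)) * exp (- m / poly D x)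
      + poly p x / poly D x ^ j * (exp (- m / poly D x) * (m * poly (pderiv D) x / (poly D x * poly D x)))) (at x)"
    proof (rule DERIV_mult'[THEN DERIV_cong])
      show "((\<lambda>x. poly p x / poly D x ^ j) has_field_derivative
        (poly (pderiv p) x * poly D x ^ j - poly p x * (real j * poly D x ^ (j - 1) * poly (pderiv D) x)) / (poly D x ^ j * poly D x ^ j)) (at x)"
        using pos by (auto intro!: derivative_eq_intros simp: mult_ac)
      show "((\<lambda>x. exp (- m / poly D x)) has_field_derivative exp (- m / poly D x) * (m * poly (pderiv D) x / (poly D x * poly D x))) (at x)"
        using pos by (auto intro!: derivative_eq_intros)
    qed (simp only: add.commute)
    moreover have "((poly (pderiv p) x * poly D x ^ j - poly p x * (real j * poly D x ^ (j - 1) * poly (pderiv D) x)) / (poly D x ^ j * poly D x ^ j)) * exp (- m / poly D x)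
      + poly p x / poly D x ^ j * (exp (- m / poly D x) * (m * poly (pderiv D) x / (poly D x * poly D x)))
      = poly (q p j) x / poly D x ^ (j + 2) * exp (- m / poly D x)"
    \<comment> \<open>The case j = 0 is separate because \<open>j - 1\<close> is truncated
      there.\<close>
    proof (cases j)
      case 0
      then show ?thesis using pos by (simp add: q_def field_simps power2_eq_square)
    next
      case (Suc i)
      then show ?thesis using pos by (simp add: q_def divide_simps power2_eq_square) (simp add: algebra_simps)
    qed
    ultimately show ?thesis by simp
  qed
  moreover have "\<forall>\<^sub>F y in nhds x. a < y \<and> y < b"
    using True eventually_nhds_in_open[of "{a<..<b}" x] by auto
  then have "\<forall>\<^sub>F y in nhds x. poly p y / poly D y ^ j * exp (- m / poly D y) = bump m a b p j y"
    by eventually_elim (simp add: bump_def D_def)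
  ultimately show ?thesis
    using True by (subst (asm) DERIV_cong_ev[OF refl _ refl]) (auto simp: bump_def D_def)
next
  case False
  then obtain K where K: "\<And>y. \<bar>bump m a b p j y\<bar> \<le> K * (y - x)\<^sup>2"
    using bump_quadratic_bound[OF m, of x a b p j] by (meson not_le)
  have z: "bump m a b r i x = 0" for r i using False by (auto simp: bump_def)
  have "((\<lambda>y. (bump m a b p j y - bump m a b p j x) / (y - x)) \<longlongrightarrow> 0) (at x)"
  proof (rule Lim_null_comparison)
    show "\<forall>\<^sub>F y in at x. norm ((bump m a b p j y - bump m a b p j x) / (y - x)) \<le> K * \<bar>y - x\<bar>"
      unfolding eventually_at_filter
    proof (intro always_eventually allI impI)
      fix y assume "y \<noteq> x"
      then show "norm ((bump m a b p j y - bump m a b p j x) / (y - x)) \<le> K * \<bar>y - x\<bar>"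
        using K[of y] unfolding z by (simp add: divide_le_eq power2_eq_square abs_mult[symmetric] mult.assoc)
    qed
    have "((\<lambda>y. K * \<bar>y - x\<bar>) \<longlongrightarrow> K * \<bar>x - x\<bar>) (at x)"
      by (intro tendsto_intros)
    then show "((\<lambda>y. K * \<bar>y - x\<bar>) \<longlongrightarrow> 0) (at x)" by simp
  qed
  then show ?thesis
    by (simp add: has_field_derivative_iff z)
qed

lemma vderiv_bump:
  assumes "0 < m"
  shows "\<exists>q. vderiv (\<lambda>x. complex_of_real (bump m a b p j x)) = (\<lambda>x. complex_of_real (bump m a b q (j + 2) x))"
    and "(\<lambda>x. complex_of_real (bump m a b p j x)) differentiable (at x)"
proof -
  obtain q where q: "\<And>x. (bump m a b p j has_field_derivative bump m a b q (j + 2) x) (at x)"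
    using bump_has_derivative[OF assms] by blast
  then have v: "((\<lambda>x. complex_of_real (bump m a b p j x)) has_vector_derivative of_real (bump m a b q (j + 2) x)) (at x)" for x
    by (intro has_vector_derivative_of_real) (simp add: has_real_derivative_iff_has_vector_derivative)
  then show "\<exists>q. vderiv (\<lambda>x. complex_of_real (bump m a b p j x)) = (\<lambda>x. complex_of_real (bump m a b q (j + 2) x))"
    unfolding vderiv_def by (intro exI[of _ q] ext vector_derivative_at)
  show "(\<lambda>x. complex_of_real (bump m a b p j x)) differentiable (at x)"
    using v differentiableI_vector by blast
qed

lemma bump_test_functions:
  assumes "0 < m"
  shows "(\<lambda>x. complex_of_real (bump m a b p j x)) \<in> test_functions"
proof -
  have ex: "\<exists>q i. (vderiv ^^ n) (\<lambda>x. complex_of_real (bump m a b p j x)) = (\<lambda>x. complex_of_real (bump m a b q i x))" for n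
  proof (induction n)
    case (Suc n)
    then show ?case using vderiv_bump(1)[OF assms] by (metis funpow.simps(2) comp_apply)
  qed auto
  have "(vderiv ^^ n) (\<lambda>x. complex_of_real (bump m a b p j x)) differentiable (at x)" for n x
    using ex[of n] vderiv_bump(2)[OF assms] by metis
  moreover have "{x. complex_of_real (bump m a b p j x) \<noteq> 0} \<subseteq> {a..b}"
    by (auto simp: bump_def split: if_splits)
  then have "bounded {x. complex_of_real (bump m a b p j x) \<noteq> 0}"
    using bounded_closed_interval bounded_subset by blast
  ultimately show ?thesis
    by (simp add: test_functions_def)
qed

lemma L2_indicator_mult_integrable:
  assumes "w \<in> L2"
  shows "integrable lborel (\<lambda>x. indicator {a<..<b} x * w x)"
proof -
  have "(\<lambda>x::real. indicator {a<..<b} x :: complex) \<in> L2"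
  proof (rule L2_bound)
    show "integrable lborel (\<lambda>x::real. indicator {a<..<b} x :: real)"
      using emeasure_bounded_finite[OF bounded_subset[OF bounded_closed_interval[of a b] greaterThanLessThan_subseteq_atLeastAtMost_iff[THEN iffD2]]]
      by (auto simp: integrable_indicator_iff)
    show "AE x in lborel. (cmod (indicator {a<..<b} x))\<^sup>2 \<le> indicat_real {a<..<b} x"
      by (auto simp: indicator_def)
  qed auto
  from L2_mult_integrable[OF this assms] show ?thesis .
qed

text \<open>As m = 1 / (n + 1) tends to 0, the bumps exp (- m / ((x - a)(b - x))) tend to the
  indicator of the interval while staying below it.\<close>

lemma interval_integral_zero:
  assumes w: "w \<in> L2" and orth: "\<And>\<phi>. \<phi> \<in> test_functions \<Longrightarrow> (LINT x|lborel. w x * \<phi> x) = 0"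
  shows "(LINT x|lborel. indicator {a<..<b} x * w x) = 0"
proof -
  define \<phi> where "\<phi> n x = complex_of_real (bump (1 / Suc n) a b 1 0 x)" for n x
  have test: "\<phi> n \<in> test_functions" for n
    unfolding \<phi>_def by (intro bump_test_functions) simp
  have [measurable]: "w \<in> borel_measurable borel" using w by auto
  have [measurable]: "\<phi> n \<in> borel_measurable borel" for n
    using test by (rule test_functions_measurable)
  have bound: "cmod (\<phi> n x) \<le> indicator {a<..<b} x" for n x
  proof (cases "a < x \<and> x < b")
    case True
    then have "0 < (x - a) * (b - x)" by simp
    then show ?thesis using True by (simp add: \<phi>_def bump_def poly_bump_poly)
  qed (auto simp: \<phi>_def bump_def)
  have lim: "(\<lambda>n. \<phi> n x) \<longlonglongrightarrow> indicator {a<..<b} x" for x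
  proof (cases "a < x \<and> x < b")
    case True
    let ?D = "(x - a) * (b - x)"
    have "(\<lambda>n. complex_of_real (exp (- (1 / real (Suc n)) / ?D))) \<longlonglongrightarrow> complex_of_real (exp (- 0 / ?D))"
      using True by (intro tendsto_intros lim_1_over_real_power[where s = 1, simplified] LIMSEQ_Suc lim_1_over_n) auto
    then show ?thesis using True by (simp add: \<phi>_def bump_def poly_bump_poly)
  qed (auto simp: \<phi>_def bump_def)
  have "(\<lambda>n. LINT x|lborel. w x * \<phi> n x) \<longlonglongrightarrow> (LINT x|lborel. w x * indicator {a<..<b} x)"
  proof (rule integral_dominated_convergence[where w = "\<lambda>x. cmod (indicator {a<..<b} x * w x)"])
    show "integrable lborel (\<lambda>x. cmod (indicator {a<..<b} x * w x))"
      using L2_indicator_mult_integrable[OF w] by (rule integrable_norm)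
    show "AE x in lborel. (\<lambda>n. w x * \<phi> n x) \<longlonglongrightarrow> w x * indicator {a<..<b} x"
      by (intro AE_I2 tendsto_intros lim)
    show "AE x in lborel. norm (w x * \<phi> n x) \<le> cmod (indicator {a<..<b} x * w x)" for n
    proof (intro AE_I2)
      fix x
      show "norm (w x * \<phi> n x) \<le> cmod (indicator {a<..<b} x * w x)"
        using mult_left_mono[OF bound[of n x] norm_ge_zero[of "w x"]]
        by (cases "a < x \<and> x < b") (auto simp: norm_mult mult.commute)
    qed
  qed auto
  then have "(\<lambda>n. 0) \<longlonglongrightarrow> (LINT x|lborel. w x * indicator {a<..<b} x)"
    by (simp add: orth[OF test])
  then show ?thesis
    by (simp add: LIMSEQ_const_iff mult.commute)
qed

text \<open>Dynkin's argument: open intervals form an intersection-stable generator of the Borel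
  sets, and vanishing of the integral passes to countable disjoint unions. Vanishing of the total
  integral serves the step to complements.\<close>

lemma integral_zero_on_intervals_imp_AE_zero:
  fixes h :: "real \<Rightarrow> real"
  assumes h: "integrable lborel h" and total: "(LINT x|lborel. h x) = 0"
    and int: "\<And>a b. (LINT x:{a<..<b}|lborel. h x) = 0"
  shows "AE x in lborel. h x = 0"
proof -
  let ?G = "range (\<lambda>(a, b). {a<..<b::real})"
  have stable: "Int_stable ?G"
  proof (rule Int_stableI)
    fix A B assume "A \<in> ?G" "B \<in> ?G"
    then obtain a b c d where "A = {a<..<b}" "B = {c<..<d}" by auto
    then have "A \<inter> B = {max a c<..<min b d}" by auto
    then show "A \<inter> B \<in> ?G" by auto
  qed
  have borel: "sets borel = sigma_sets UNIV ?G"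
  proof -
    have "(\<lambda>(a, b). box a b) = (\<lambda>(a, b). {a<..<b::real})"
      by (auto simp: fun_eq_iff)
    then have "sets (sigma UNIV (range (\<lambda>(a, b). box a b))) = sets (sigma UNIV ?G)"
      by (simp only:)
    then show ?thesis by (subst borel_eq_box) (simp only: sets_measure_of subset_UNIV Pow_UNIV)
  qed
  have G: "?G \<subseteq> Pow UNIV" by auto
  have seti: "set_integrable lborel A h" if "A \<in> sets borel" for A
    unfolding set_integrable_def using h that by (intro integrable_mult_indicator) auto
  have zero: "(LINT x:A|lborel. h x) = 0" if A: "A \<in> sets borel" for A
    using stable G A[unfolded borel]
  proof (induction rule: sigma_sets_induct_disjoint)
    case (compl A)
    then have "A \<in> sets borel" by (simp add: borel)
    then have "(LINT x:UNIV|lborel. h x) = (LINT x:A|lborel. h x) + (LINT x:UNIV - A|lborel. h x)"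
      by (subst set_integral_Un[symmetric]) (auto intro: seti simp: Un_absorb1)
    then show ?case
      using compl(2) total by (simp add: set_lebesgue_integral_def)
  next
    case (union A)
    then have "\<And>i. A i \<in> sets borel" by (auto simp: borel)
    then have "(LINT x:(\<Union>i. A i)|lborel. h x) = (\<Sum>i. (LINT x:(A i)|lborel. h x))"
      using union(1) by (intro lebesgue_integral_countable_add seti) (auto simp: disjoint_family_on_def)
    then show ?case using union(3) by simp
  qed (use int in \<open>auto simp: set_lebesgue_integral_def\<close>)
  show ?thesis
    by (rule density_unique_real[OF h, of "\<lambda>_. 0"]) (use zero in auto)
qed

text \<open>An L2 function need not be integrable on the line, so it is cut off to (-n, n), and its
  real and imaginary parts are treated separately by the interval criterion.\<close>

lemma test_functions_dense:
  assumes w: "w \<in> L2" and orth: "\<And>\<phi>. \<phi> \<in> test_functions \<Longrightarrow> (LINT x|lborel. w x * \<phi> x) = 0"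
  shows "AE x in lborel. w x = 0"
proof -
  have "AE x in lborel. \<forall>n::nat. x \<in> {- real n<..<real n} \<longrightarrow> w x = 0"
    unfolding AE_all_countable
  proof
    fix n :: nat
    let ?I = "{- real n<..<real n}"
    have i: "integrable lborel (\<lambda>x. indicator ?I x * w x)"
      by (rule L2_indicator_mult_integrable[OF w])
    have eq: "indicator {a<..<b} x * (indicator ?I x * w x) = indicator {max a (- real n)<..<min b (real n)} x * w x" for a b x
      by (auto simp: indicator_def)
    have z: "(LINT x|lborel. indicator {a<..<b} x * (indicator ?I x * w x)) = 0" for a b
      unfolding eq by (rule interval_integral_zero[OF w orth])
    have ii: "integrable lborel (\<lambda>x. indicator {a<..<b} x * (indicator ?I x * w x))" for a b
      unfolding eq by (rule L2_indicator_mult_integrable[OF w])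
    have Re: "AE x in lborel. Re (indicator ?I x * w x) = 0"
    proof (rule integral_zero_on_intervals_imp_AE_zero)
      show "(LINT x|lborel. Re (indicator ?I x * w x)) = 0"
        using integral_Re[OF i] interval_integral_zero[OF w orth, of "- real n" "real n"] by simp
      show "(LINT x:{a<..<b}|lborel. Re (indicator ?I x * w x)) = 0" for a b
      proof -
        have "(LINT x:{a<..<b}|lborel. Re (indicator ?I x * w x)) = (LINT x|lborel. Re (indicator {a<..<b} x * (indicator ?I x * w x)))"
          unfolding set_lebesgue_integral_def by (intro Bochner_Integration.integral_cong) (auto simp: indicator_def)
        then show ?thesis using integral_Re[OF ii[of a b]] z by simp
      qed
    qed (rule integrable_Re[OF i])
    have Im: "AE x in lborel. Im (indicator ?I x * w x) = 0"
    proof (rule integral_zero_on_intervals_imp_AE_zero)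
      show "(LINT x|lborel. Im (indicator ?I x * w x)) = 0"
        using integral_Im[OF i] interval_integral_zero[OF w orth, of "- real n" "real n"] by simp
      show "(LINT x:{a<..<b}|lborel. Im (indicator ?I x * w x)) = 0" for a b
      proof -
        have "(LINT x:{a<..<b}|lborel. Im (indicator ?I x * w x)) = (LINT x|lborel. Im (indicator {a<..<b} x * (indicator ?I x * w x)))"
          unfolding set_lebesgue_integral_def by (intro Bochner_Integration.integral_cong) (auto simp: indicator_def)
        then show ?thesis using integral_Im[OF ii[of a b]] z by simp
      qed
    qed (rule integrable_Im[OF i])
    from Re Im show "AE x in lborel. x \<in> ?I \<longrightarrow> w x = 0"
      by eventually_elim (auto simp: complex_eq_iff)
  qed
  then show ?thesis
  proof eventually_elim
    case (elim x)
    obtain n :: nat where "\<bar>x\<bar> < real n" using reals_Archimedean2 by blast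
    then show ?case using elim[rule_format, of n] by (auto simp: abs_less_iff)
  qed
qed

section \<open>The resolvent of the Schroedinger operator\<close>

lemma self_adjoint_L2:
  assumes "l2_self_adjoint H" "(u, h) \<in> H"
  shows "u \<in> L2" "h \<in> L2"
  using assms by (auto simp: l2_self_adjoint_def l2_adjoint_def)

lemma self_adjoint_symmetric:
  assumes "l2_self_adjoint H" "(u, h) \<in> H" "(u', h') \<in> H"
  shows "l2_inner h u' = l2_inner u h'"
proof -
  have "(u', h') \<in> l2_adjoint H"
    using assms by (simp add: l2_self_adjoint_def)
  then show ?thesis
    using assms(2) by (auto simp: l2_adjoint_def)
qed

lemma self_adjointI:
  assumes "l2_self_adjoint H" "u \<in> L2" "h \<in> L2"
    and "\<And>u' h'. (u', h') \<in> H \<Longrightarrow> l2_inner h' u = l2_inner u' h"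
  shows "(u, h) \<in> H"
proof -
  have "(u, h) \<in> l2_adjoint H"
    using assms(2-4) by (auto simp: l2_adjoint_def)
  then show ?thesis
    using assms(1) by (simp add: l2_self_adjoint_def)
qed

text \<open>\<open>H\<close> is only a relation between representatives; that it is closed under
  \<open>\<approx>\<close> follows from its being its own adjoint.\<close>

lemma self_adjoint_cong:
  assumes "l2_self_adjoint H" "(u, h) \<in> H" "u' \<in> L2" "h' \<in> L2" "ae_eq u u'" "ae_eq h h'"
  shows "(u', h') \<in> H"
proof (rule self_adjointI[OF assms(1,3,4)])
  fix v k assume v: "(v, k) \<in> H"
  note L = self_adjoint_L2[OF assms(1,2)] self_adjoint_L2[OF assms(1) v]
  have "l2_inner k u' = l2_inner k u" "l2_inner v h' = l2_inner v h"
    using L assms(3-6) by (auto intro!: l2_inner_cong intro: ae_eq_sym)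
  then show "l2_inner k u' = l2_inner v h'"
    using self_adjoint_symmetric[OF assms(1) v assms(2)] by simp
qed

lemma self_adjoint_lincomb:
  assumes "l2_self_adjoint H" "(u, h) \<in> H" "(u', h') \<in> H"
  shows "(\<lambda>x. a * u x + u' x, \<lambda>x. a * h x + h' x) \<in> H"
proof (rule self_adjointI[OF assms(1)])
  note L = self_adjoint_L2[OF assms(1,2)] self_adjoint_L2[OF assms(1,3)]
  show "(\<lambda>x. a * u x + u' x) \<in> L2" "(\<lambda>x. a * h x + h' x) \<in> L2"
    using L by auto
  fix v k assume v: "(v, k) \<in> H"
  note L = L self_adjoint_L2[OF assms(1) v]
  show "l2_inner k (\<lambda>x. a * u x + u' x) = l2_inner v (\<lambda>x. a * h x + h' x)"
    using L by (simp add: l2_inner_add_right l2_inner_cmult_right L2_cmult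
        self_adjoint_symmetric[OF assms(1) v assms(2)] self_adjoint_symmetric[OF assms(1) v assms(3)])
qed

text \<open>k and - cnj k have the same imaginary part and conjugate squares, so conjugation maps
  the resolvent kernel at energy k^2 to the one at cnj (k^2).\<close>

lemma cnj_rkernel: "cnj (rkernel k r) = rkernel (- cnj k) r"
  by (simp add: rkernel_def exp_cnj)

lemma cnj_free_res: "cnj (free_res k w x) = free_res (- cnj k) (\<lambda>y. cnj (w y)) x"
  unfolding free_res_def by (simp flip: Bochner_Integration.integral_cnj add: cnj_rkernel)

context short_range_potential begin

text \<open>v is bounded, so V v inherits square integrability from V. This puts the source, and
  with it the second weak derivative of v, into L2.\<close>

lemma potential_times_sol_L2:
  assumes k: "regular k" and g: "integrable lborel g"
  shows "(\<lambda>x. vb x * phi g k x) \<in> L2"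
proof -
  note w = source_integrable[OF k g]
  have [measurable]: "phi g k \<in> borel_measurable borel" using phi_L2[OF k g] by auto
  let ?B = "(LINT y|lborel. cmod (source g k y)) / (2 * c)"
  have int: "integrable lborel (\<lambda>x. (V x)\<^sup>2 * ?B\<^sup>2)" using V_square_integrable by auto
  show ?thesis
  proof (rule L2_bound[OF _ int])
    show "AE x in lborel. (cmod (vb x * phi g k x))\<^sup>2 \<le> (V x)\<^sup>2 * ?B\<^sup>2"
      using V_sol[OF k g]
    proof eventually_elim
      case (elim x)
      have "cmod (sol g k x) \<le> ?B"
        unfolding sol_def by (rule free_res_bound[OF c_pos regular_uhp[OF k] w])
      then have "(cmod (sol g k x))\<^sup>2 \<le> ?B\<^sup>2"
        by (intro power_mono) auto
      then show ?case
        unfolding elim by (simp add: norm_mult power_mult_distrib mult_left_mono)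
    qed
  qed measurable
qed

text \<open>The domain \<open>W22\<close> is prescribed, the action of \<open>H\<close> on it is
  not. Since u is in the domain it has some image h; symmetry of \<open>H\<close> against the
  minimal operator determines the pairings of h with all test functions, and these determine h
  almost everywhere.\<close>

lemma sol_in_graph:
  assumes H: "schroedinger_operator V H" and f: "f \<in> test_functions" and k: "regular k" "0 < Im k"
  defines "u \<equiv> \<lambda>x. cnj (sol (\<lambda>y. cnj (f y)) k x)"
  shows "(u, \<lambda>x. f x + cnj (k\<^sup>2) * u x) \<in> H"
proof -
  have sa: "l2_self_adjoint H" and minH: "minimal_schroedinger V \<subseteq> H" and dom: "Domain H = W22"
    using H by (auto simp: schroedinger_operator_def)
  let ?g = "\<lambda>y. cnj (f y)"
  let ?w = "source ?g k" and ?v = "sol ?g k" and ?q = "\<lambda>x. vb x * phi ?g k x" and ?k = "- cnj k"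
  have fL: "f \<in> L2" and fI: "integrable lborel f"
    using f by (auto intro: test_functions_L2 test_functions_integrable)
  have g: "integrable lborel ?g" using fI by simp
  note w = source_integrable[OF k(1) g]
  have wc: "integrable lborel (\<lambda>y. cnj (?w y))" using w by simp
  have k': "0 < Im ?k" using k(2) by simp
  have qL: "?q \<in> L2" by (rule potential_times_sol_L2[OF k(1) g])
  have wL: "?w \<in> L2"
    unfolding source_def using qL L2_cnj[OF fL] by auto
  have vL: "?v \<in> L2"
    unfolding sol_def by (rule free_res_L2[OF k(2) w])
  have u: "u = free_res ?k (\<lambda>y. cnj (?w y))"
    unfolding u_def sol_def by (simp add: fun_eq_iff cnj_free_res)
  have uL: "u \<in> L2" unfolding u by (rule free_res_L2[OF k' wc])
  have "u \<in> W22"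
    unfolding W22_def
  proof (intro CollectI conjI bexI uL)
    show "weak_derivative u (dfree_res ?k (\<lambda>y. cnj (?w y)))"
      unfolding u by (rule free_res_weak_derivative[OF k' wc])
    show "weak_derivative (dfree_res ?k (\<lambda>y. cnj (?w y))) (\<lambda>x. - ?k\<^sup>2 * u x - cnj (?w x))"
      unfolding u by (rule dfree_res_weak_derivative[OF k' wc])
    show "dfree_res ?k (\<lambda>y. cnj (?w y)) \<in> L2"
      by (rule dfree_res_L2[OF k' wc])
    show "(\<lambda>x. - ?k\<^sup>2 * u x - cnj (?w x)) \<in> L2"
      by (intro L2_diff L2_cmult uL L2_cnj wL)
  qed
  then obtain h where uh: "(u, h) \<in> H"
    using dom by (metis DomainE)
  note hL = self_adjoint_L2(2)[OF sa uh]
  \<comment> \<open>Stated for conjugates because \<open>l2_inner\<close> conjugates its second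
    argument: pairing a test function \<phi> with u then produces the integral of \<phi> v without
    conjugation, as in \<open>weak_derivative\<close>.\<close>
  let ?d = "\<lambda>x. cnj (h x) - k\<^sup>2 * ?v x - ?g x"
  have dL: "?d \<in> L2"
    by (intro L2_diff L2_cmult L2_cnj hL vL fL)
  have "AE x in lborel. ?d x = 0"
  proof (rule test_functions_dense[OF dL])
    fix \<phi> assume \<phi>: "\<phi> \<in> test_functions"
    note \<phi>1 = vderiv_test_functions[OF \<phi>] and \<phi>2 = vderiv_test_functions[OF vderiv_test_functions[OF \<phi>]]
    note \<phi>L = test_functions_L2[OF \<phi>] and \<phi>2L = test_functions_L2[OF \<phi>2]
    obtain B where B: "\<And>x. cmod (\<phi> x) \<le> B" using test_functions_bounded[OF \<phi>] by blast
    have VL: "(\<lambda>x. complex_of_real (V x)) \<in> L2"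
      using V_square_integrable by (simp add: L2_def)
    have V\<phi>L: "(\<lambda>x. of_real (V x) * \<phi> x) \<in> L2"
      using L2_mult_bounded[OF VL, of \<phi> B] B test_functions_measurable[OF \<phi>] by (simp add: mult.commute[of "\<phi> _"])
    have [measurable]: "\<phi> \<in> borel_measurable borel" "?v \<in> borel_measurable borel" "phi ?g k \<in> borel_measurable borel"
      using test_functions_measurable[OF \<phi>] vL phi_L2[OF k(1) g] by auto
    have "(\<phi>, \<lambda>x. - vderiv (vderiv \<phi>) x + of_real (V x) * \<phi> x) \<in> H"
      using minH \<phi> by (auto simp: minimal_schroedinger_def)
    from self_adjoint_symmetric[OF sa this uh]
    have "(LINT x|lborel. (- vderiv (vderiv \<phi>) x + of_real (V x) * \<phi> x) * ?v x) = (LINT x|lborel. \<phi> x * cnj (h x))"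
      by (simp add: l2_inner_def u_def)
    also have "(LINT x|lborel. (- vderiv (vderiv \<phi>) x + of_real (V x) * \<phi> x) * ?v x)
        = (LINT x|lborel. of_real (V x) * \<phi> x * ?v x) - (LINT x|lborel. ?v x * vderiv (vderiv \<phi>) x)"
      using L2_mult_integrable[OF V\<phi>L vL] L2_mult_integrable[OF vL \<phi>2L]
      by (subst Bochner_Integration.integral_diff[symmetric]) (auto simp: algebra_simps intro!: Bochner_Integration.integral_cong)
    also have "(LINT x|lborel. of_real (V x) * \<phi> x * ?v x) = (LINT x|lborel. ?q x * \<phi> x)"
    proof (rule integral_cong_AE)
      show "AE x in lborel. of_real (V x) * \<phi> x * ?v x = ?q x * \<phi> x"
        using V_sol[OF k(1) g] by eventually_elim simp
    qed measurable
    \<comment> \<open>Both derivatives are moved onto v by the weak derivatives of the free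
      resolvent; the potential term then completes w to g.\<close>
    also have "(LINT x|lborel. ?v x * vderiv (vderiv \<phi>) x) = (LINT x|lborel. (- k\<^sup>2 * ?v x - ?w x) * \<phi> x)"
      using free_res_weak_derivative[OF k(2) w] dfree_res_weak_derivative[OF k(2) w] \<phi> \<phi>1
      unfolding weak_derivative_def sol_def by simp
    also have "(LINT x|lborel. ?q x * \<phi> x) - (LINT x|lborel. (- k\<^sup>2 * ?v x - ?w x) * \<phi> x)
        = (LINT x|lborel. (k\<^sup>2 * ?v x + ?g x) * \<phi> x)"
      using L2_mult_integrable[OF qL \<phi>L] L2_mult_integrable[OF L2_diff[OF L2_cmult[OF vL, of "- k\<^sup>2"] wL] \<phi>L]
      by (subst Bochner_Integration.integral_diff[symmetric]) (auto simp: source_def algebra_simps intro!: Bochner_Integration.integral_cong)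
    finally have "(LINT x|lborel. cnj (h x) * \<phi> x) = (LINT x|lborel. (k\<^sup>2 * ?v x + ?g x) * \<phi> x)"
      by (simp add: mult.commute)
    then have "(LINT x|lborel. cnj (h x) * \<phi> x) - (LINT x|lborel. (k\<^sup>2 * ?v x + ?g x) * \<phi> x) = 0"
      by simp
    then have "(LINT x|lborel. cnj (h x) * \<phi> x - (k\<^sup>2 * ?v x + ?g x) * \<phi> x) = 0"
      using L2_mult_integrable[OF L2_cnj[OF hL] \<phi>L] L2_mult_integrable[OF L2_add[OF L2_cmult[OF vL, of "k\<^sup>2"] L2_cnj[OF fL]] \<phi>L]
      by (subst Bochner_Integration.integral_diff) auto
    then show "(LINT x|lborel. ?d x * \<phi> x) = 0"
      by (simp add: algebra_simps)
  qed
  then have "ae_eq h (\<lambda>x. f x + cnj (k\<^sup>2) * u x)"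
    unfolding ae_eq_def
  proof eventually_elim
    case (elim x)
    then have "cnj (cnj (h x)) = cnj (?g x + k\<^sup>2 * ?v x)"
      by (simp add: algebra_simps)
    then show ?case by (simp add: u_def)
  qed
  then show ?thesis
    using self_adjoint_cong[OF sa uh uL] uL fL by (auto simp: L2_add L2_cmult)
qed

end

section \<open>Spectral distributions\<close>

lemma l2_inner_sum_left:
  assumes "\<And>i. i \<in> I \<Longrightarrow> f i \<in> L2" "g \<in> L2"
  shows "l2_inner (\<lambda>x. \<Sum>i\<in>I. f i x) g = (\<Sum>i\<in>I. l2_inner (f i) g)"
  using assms(1)
proof (induction I rule: infinite_finite_induct)
  case (insert i I)
  then show ?case by (simp add: l2_inner_add_left L2_sum assms(2))
qed (simp_all add: l2_inner_def)

lemma ae_eqI_inner: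
  assumes "f \<in> L2" "f' \<in> L2" "\<And>g. g \<in> L2 \<Longrightarrow> l2_inner f g = l2_inner f' g"
  shows "ae_eq f f'"
proof (rule l2_norm_zero_imp_ae_eq[OF assms(1,2)])
  have d: "(\<lambda>x. f x - f' x) \<in> L2" using assms by auto
  have "l2_inner (\<lambda>x. f x - f' x) (\<lambda>x. f x - f' x) = 0"
    using assms(3)[OF d] assms(1,2) d by (simp add: l2_inner_diff_left)
  then show "l2_norm (\<lambda>x. f x - f' x) = 0"
    by (simp add: l2_inner_self)
qed

locale spectral_resolution =
  fixes H :: l2_graph and P :: "real set \<Rightarrow> (real \<Rightarrow> complex) \<Rightarrow> real \<Rightarrow> complex"
  assumes sa: "l2_self_adjoint H" and spec: "spectral_measure_of H P"
begin

abbreviation sdist :: "(real \<Rightarrow> complex) \<Rightarrow> real measure" where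
  "sdist f \<equiv> spectral_distribution P f"

lemma pvm: "projection_valued_measure P"
  using spec by (simp add: spectral_measure_of_def)

lemma proj: "A \<in> sets borel \<Longrightarrow> l2_orthogonal_projection (P A)"
  using pvm by (simp add: projection_valued_measure_def)

lemma P_L2 [intro]: "A \<in> sets borel \<Longrightarrow> f \<in> L2 \<Longrightarrow> P A f \<in> L2"
  using proj by (simp add: l2_orthogonal_projection_def l2_bounded_op_def)

lemma P_sym: "A \<in> sets borel \<Longrightarrow> f \<in> L2 \<Longrightarrow> g \<in> L2 \<Longrightarrow> l2_inner (P A f) g = l2_inner f (P A g)"
  using proj by (simp add: l2_orthogonal_projection_def)

lemma P_Int: "A \<in> sets borel \<Longrightarrow> B \<in> sets borel \<Longrightarrow> f \<in> L2 \<Longrightarrow> ae_eq (P A (P B f)) (P (A \<inter> B) f)"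
  using pvm by (simp add: projection_valued_measure_def)

lemma P_empty: "f \<in> L2 \<Longrightarrow> ae_eq (P {} f) (\<lambda>x. 0)"
  and P_UNIV: "f \<in> L2 \<Longrightarrow> ae_eq (P UNIV f) f"
  using pvm by (simp_all add: projection_valued_measure_def)

lemma P_lin: "A \<in> sets borel \<Longrightarrow> f \<in> L2 \<Longrightarrow> g \<in> L2 \<Longrightarrow> ae_eq (P A (\<lambda>x. a * f x + g x)) (\<lambda>x. a * P A f x + P A g x)"
  using proj by (simp add: l2_orthogonal_projection_def l2_bounded_op_def)

lemma P_cong:
  assumes "A \<in> sets borel" "f \<in> L2" "g \<in> L2" "ae_eq f g"
  shows "ae_eq (P A f) (P A g)"
proof (rule ae_eqI_inner)
  fix h assume h: "h \<in> L2"
  have "l2_inner f (P A h) = l2_inner g (P A h)"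
    using assms h by (intro l2_inner_cong P_L2) auto
  then show "l2_inner (P A f) h = l2_inner (P A g) h"
    using assms h by (simp add: P_sym)
qed (use assms in auto)

lemma P_inner_self:
  assumes "A \<in> sets borel" "f \<in> L2"
  shows "l2_inner (P A f) f = of_real ((l2_norm (P A f))\<^sup>2)"
proof -
  have "l2_inner (P A f) (P A f) = l2_inner f (P A (P A f))"
    using assms by (simp add: P_sym P_L2)
  also have "\<dots> = l2_inner f (P A f)"
    using assms P_Int[of A A f] by (intro l2_inner_cong) auto
  also have "\<dots> = l2_inner (P A f) f"
    using assms by (simp add: P_sym)
  finally show ?thesis by (simp add: l2_inner_self)
qed

text \<open>Strong countable additivity is turned into additivity of the diagonal form by
  Cauchy-Schwarz against f.\<close>

lemma P_sums:
  assumes A: "range A \<subseteq> sets borel" "disjoint_family A" and f: "f \<in> L2"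
  shows "(\<lambda>n::nat. (l2_norm (P (A n) f))\<^sup>2) sums (l2_norm (P (\<Union>n. A n) f))\<^sup>2"
proof -
  let ?U = "P (\<Union>n. A n) f"
  have Am: "A n \<in> sets borel" for n using A by auto
  have U: "(\<Union>n. A n) \<in> sets borel" using A by auto
  have S: "(\<lambda>x. \<Sum>n<N. P (A n) f x) \<in> L2" for N
    by (intro L2_sum P_L2 Am f)
  have "(\<lambda>N. l2_norm (\<lambda>x. ?U x - (\<Sum>n<N. P (A n) f x))) \<longlonglongrightarrow> 0"
    using pvm[unfolded projection_valued_measure_def] A f by blast
  then have lim: "(\<lambda>N. l2_norm (\<lambda>x. ?U x - (\<Sum>n<N. P (A n) f x)) * l2_norm f) \<longlonglongrightarrow> 0 * l2_norm f"
    by (intro tendsto_intros)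
  have eq: "l2_inner (\<lambda>x. ?U x - (\<Sum>n<N. P (A n) f x)) f
      = of_real ((l2_norm ?U)\<^sup>2 - (\<Sum>n<N. (l2_norm (P (A n) f))\<^sup>2))" for N
    using Am U f S by (simp add: l2_inner_diff_left P_L2 l2_inner_sum_left P_inner_self)
  have "\<bar>(\<Sum>n<N. (l2_norm (P (A n) f))\<^sup>2) - (l2_norm ?U)\<^sup>2\<bar> \<le> l2_norm (\<lambda>x. ?U x - (\<Sum>n<N. P (A n) f x)) * l2_norm f" for N
  proof -
    have "(\<lambda>x. ?U x - (\<Sum>n<N. P (A n) f x)) \<in> L2" using P_L2[OF U f] S by auto
    from l2_Cauchy_Schwarz[OF this f] show ?thesis
      unfolding eq norm_of_real by (simp add: abs_minus_commute)
  qed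
  then have "\<forall>\<^sub>F N in sequentially. norm ((\<Sum>n<N. (l2_norm (P (A n) f))\<^sup>2) - (l2_norm ?U)\<^sup>2)
      \<le> l2_norm (\<lambda>x. ?U x - (\<Sum>n<N. P (A n) f x)) * l2_norm f"
    by simp
  from Lim_null_comparison[OF this] lim
  have "(\<lambda>N. (\<Sum>n<N. (l2_norm (P (A n) f))\<^sup>2) - (l2_norm ?U)\<^sup>2) \<longlonglongrightarrow> 0"
    by simp
  then show ?thesis
    unfolding sums_def by (rule LIM_zero_cancel)
qed

lemma space_sdist [simp]: "space (sdist f) = UNIV"
  unfolding spectral_distribution_def by (rule space_measure_of) auto

lemma sets_sdist [simp, measurable_cong]: "sets (sdist f) = sets borel"
  unfolding spectral_distribution_def using sets.sigma_sets_eq[of borel] by (simp add: sets_measure_of_conv)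

text \<open>\<open>measure_of\<close> gives the zero measure when the set function is not a measure,
  so positivity and countable additivity have to be verified before any value can be read
  off.\<close>

lemma emeasure_sdist:
  assumes "f \<in> L2" "A \<in> sets borel"
  shows "emeasure (sdist f) A = ennreal ((l2_norm (P A f))\<^sup>2)"
proof -
  let ?\<mu> = "\<lambda>A. ennreal (Re (l2_inner (P A f) f))"
  have \<mu>: "?\<mu> A = ennreal ((l2_norm (P A f))\<^sup>2)" if "A \<in> sets borel" for A
    using P_inner_self[OF that assms(1)] by simp
  have "sigma_algebra UNIV (sets borel)"
    using sets.sigma_algebra_axioms[of borel] by simp
  moreover have "positive (sets borel) ?\<mu>"
  proof -
    have "l2_norm (P {} f) = l2_norm (\<lambda>x. 0)"
      by (rule l2_norm_cong) (use P_L2[of "{}"] P_empty assms in \<open>auto intro!: L2_measurable\<close>)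
    then have "?\<mu> {} = 0"
      by (subst \<mu>) (auto simp: l2_norm_def)
    then show ?thesis by (simp add: positive_def)
  qed
  moreover have "countably_additive (sets borel) ?\<mu>"
    unfolding countably_additive_def
  proof (intro allI impI)
    fix A :: "nat \<Rightarrow> real set" assume A: "range A \<subseteq> sets borel" "disjoint_family A" "\<Union> (range A) \<in> sets borel"
    have "(\<Sum>i. ennreal ((l2_norm (P (A i) f))\<^sup>2)) = ennreal ((l2_norm (P (\<Union> (range A)) f))\<^sup>2)"
      by (rule suminf_ennreal_eq) (use P_sums[OF A(1,2) assms(1)] in auto)
    moreover have "A i \<in> sets borel" for i using A by auto
    ultimately show "(\<Sum>i. ?\<mu> (A i)) = ?\<mu> (\<Union> (range A))"
      using A(3) by (simp only: \<mu>)
  qed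
  ultimately have "emeasure (sdist f) A = ?\<mu> A"
    unfolding spectral_distribution_def by (rule emeasure_measure_of_sigma[OF _ _ _ assms(2)])
  then show ?thesis using \<mu>[OF assms(2)] by simp
qed

lemma measure_sdist: "f \<in> L2 \<Longrightarrow> A \<in> sets borel \<Longrightarrow> measure (sdist f) A = (l2_norm (P A f))\<^sup>2"
  by (simp add: measure_def emeasure_sdist)

lemma finite_measure_sdist: "f \<in> L2 \<Longrightarrow> finite_measure (sdist f)"
  by (rule finite_measureI) (simp add: emeasure_sdist)

lemma measure_sdist_UNIV:
  assumes "f \<in> L2"
  shows "measure (sdist f) UNIV = (l2_norm f)\<^sup>2"
proof -
  have "l2_norm (P UNIV f) = l2_norm f"
    using assms P_L2[of UNIV f] by (intro l2_norm_cong P_UNIV) (auto intro!: L2_measurable)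
  then show ?thesis using measure_sdist[OF assms, of UNIV] by simp
qed

lemma sdist_cong:
  assumes "f \<in> L2" "g \<in> L2" "ae_eq f g"
  shows "sdist f = sdist g"
proof (rule measure_eqI)
  fix A assume "A \<in> sets (sdist f)"
  then have A: "A \<in> sets borel" by simp
  have "l2_norm (P A f) = l2_norm (P A g)"
    using P_L2[OF A] assms by (intro l2_norm_cong P_cong A) (auto intro!: L2_measurable)
  then show "emeasure (sdist f) A = emeasure (sdist g) A"
    using A assms by (simp add: emeasure_sdist)
qed simp

lemma sdist_P:
  assumes A: "A \<in> sets borel" and f: "f \<in> L2"
  shows "sdist (P A f) = density (sdist f) (indicator A)"
proof (rule measure_eqI)
  fix B assume "B \<in> sets (sdist (P A f))"
  then have B: "B \<in> sets borel" by simp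
  have "l2_norm (P B (P A f)) = l2_norm (P (B \<inter> A) f)"
    using A B f by (intro l2_norm_cong P_Int) (auto intro!: L2_measurable)
  then have "emeasure (sdist (P A f)) B = emeasure (sdist f) (A \<inter> B)"
    using A B f by (simp add: emeasure_sdist P_L2 Int_commute)
  also have "\<dots> = emeasure (density (sdist f) (indicator A)) B"
    using A B by (subst emeasure_density) (auto simp: indicator_inter_arith[symmetric])
  finally show "emeasure (sdist (P A f)) B = emeasure (density (sdist f) (indicator A)) B" .
qed simp

lemma
  fixes g :: "real \<Rightarrow> real"
  assumes A: "A \<in> sets borel" and f: "f \<in> L2" and g: "g \<in> borel_measurable borel"
  shows integrable_sdist_P: "integrable (sdist (P A f)) g \<longleftrightarrow> integrable (sdist f) (\<lambda>t. indicator A t * g t)"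
    and integral_sdist_P: "(LINT t|sdist (P A f). g t) = (LINT t|sdist f. indicator A t * g t)"
proof -
  have e: "(indicator A :: real \<Rightarrow> ennreal) = (\<lambda>t. ennreal (indicator A t))"
    by (auto simp: fun_eq_iff indicator_def)
  show "integrable (sdist (P A f)) g \<longleftrightarrow> integrable (sdist f) (\<lambda>t. indicator A t * g t)"
    unfolding sdist_P[OF A f] e using A g by (subst integrable_density) auto
  show "(LINT t|sdist (P A f). g t) = (LINT t|sdist f. indicator A t * g t)"
    unfolding sdist_P[OF A f] e using A g by (subst integral_density) auto
qed

section \<open>Reduction of \<open>H\<close> by the spectral projections\<close>

lemma domain_iff: "(\<exists>h. (u, h) \<in> H) \<longleftrightarrow> u \<in> L2 \<and> integrable (sdist u) (\<lambda>t. t\<^sup>2)"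
  using spec unfolding spectral_measure_of_def by (auto simp: set_eq_iff Domain_iff)

lemma graph_form: "(u, h) \<in> H \<Longrightarrow> l2_inner h u = of_real (LINT t|sdist u. t)"
  using spec unfolding spectral_measure_of_def by auto

lemma integrable_first_moment:
  assumes "(u, h) \<in> H"
  shows "integrable (sdist u) (\<lambda>t. t)"
proof -
  have u: "u \<in> L2" and i: "integrable (sdist u) (\<lambda>t. t\<^sup>2)"
    using assms domain_iff by blast+
  interpret finite_measure "sdist u" by (rule finite_measure_sdist[OF u])
  have le: "\<bar>t\<bar> \<le> 1 + t\<^sup>2" for t :: real
    using mult_le_sum_squares[of 1 "\<bar>t\<bar>"] by simp
  show ?thesis
    by (rule Bochner_Integration.integrable_bound[of _ "\<lambda>t. 1 + t\<^sup>2"])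
       (use i le in \<open>auto intro: order_trans[OF _ abs_ge_self]\<close>)
qed

text \<open>Projecting restricts the spectral distribution to A, which keeps the second moment
  finite, and finiteness of that moment characterises the domain.\<close>

lemma P_domain:
  assumes A: "A \<in> sets borel" and u: "(u, h) \<in> H"
  shows "\<exists>k. (P A u, k) \<in> H"
proof -
  have u': "u \<in> L2" "integrable (sdist u) (\<lambda>t. t\<^sup>2)"
    using u domain_iff by blast+
  have "integrable (sdist u) (\<lambda>t. indicator A t *\<^sub>R t\<^sup>2)"
    using u'(2) A by (intro integrable_mult_indicator) auto
  then show ?thesis
    unfolding domain_iff using A u'(1) by (simp add: integrable_sdist_P P_L2)
qed

lemma P_domain_bounded:
  assumes A: "A \<in> sets borel" "bounded A" and u: "u \<in> L2"
  shows "\<exists>k. (P A u, k) \<in> H"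
proof -
  interpret finite_measure "sdist u" by (rule finite_measure_sdist[OF u])
  obtain B where B: "\<And>t. t \<in> A \<Longrightarrow> \<bar>t\<bar> \<le> B"
    using A(2) by (auto simp: bounded_iff)
  have "integrable (sdist u) (\<lambda>t. indicator A t * t\<^sup>2)"
  proof (rule integrable_const_bound[of _ "B\<^sup>2"])
    show "AE t in sdist u. norm (indicator A t * t\<^sup>2) \<le> B\<^sup>2"
      using power_mono[OF B abs_ge_zero, of _ 2] by (auto simp: indicator_def)
  qed (use A in measurable)
  then show ?thesis
    unfolding domain_iff using A u by (simp add: integrable_sdist_P P_L2)
qed

lemma P_compl_zero:
  assumes A: "A \<in> sets borel" and f: "f \<in> L2" "ae_eq (P A f) f"
  shows "ae_eq (P (- A) f) (\<lambda>x. 0)"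
proof -
  have cA: "- A \<in> sets borel" using A by auto
  have "ae_eq (P (- A) f) (P (- A) (P A f))"
    using A f cA by (intro P_cong) (auto intro: ae_eq_sym)
  also have "ae_eq \<dots> (P (- A \<inter> A) f)"
    by (rule P_Int[OF cA A f(1)])
  finally (ae_eq_trans) show ?thesis
    using P_empty[OF f(1)] by (auto intro: ae_eq_trans)
qed

text \<open>The spectral distribution of u = p + q restricts to that of p on A and to that of q on
  the complement, so (Hu, u) has no cross terms; by symmetry of \<open>H\<close> these add up to
  twice the real part of (Hp, q).\<close>

lemma graph_orthogonal_Re:
  assumes A: "A \<in> sets borel"
    and p: "(p, hp) \<in> H" "ae_eq (P A p) p" and q: "(q, hq) \<in> H" "ae_eq (P (- A) q) q"
  shows "Re (l2_inner hp q) = 0"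
proof -
  have cA: "- A \<in> sets borel" using A by auto
  note L = self_adjoint_L2[OF sa p(1)] self_adjoint_L2[OF sa q(1)]
  let ?u = "\<lambda>x. 1 * p x + q x"
  have uH: "(?u, \<lambda>x. 1 * hp x + hq x) \<in> H"
    by (rule self_adjoint_lincomb[OF sa p(1) q(1)])
  have uL: "?u \<in> L2" using L by auto
  have "ae_eq (P A q) (\<lambda>x. 0)"
    using P_compl_zero[OF cA L(3) q(2)] by simp
  with P_lin[OF A L(1) L(3), of 1] p(2) have PA: "ae_eq (P A ?u) p"
    unfolding ae_eq_def by eventually_elim simp
  have PB: "ae_eq (P (- A) ?u) q"
    using P_lin[OF cA L(1) L(3), of 1] q(2) P_compl_zero[OF A L(1) p(2)] unfolding ae_eq_def
    by eventually_elim simp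
  have int: "integrable (sdist ?u) (\<lambda>t. t)"
    by (rule integrable_first_moment[OF uH])
  have "(LINT t|sdist ?u. t) = (LINT t|sdist ?u. indicator A t * t + indicator (- A) t * t)"
    by (intro Bochner_Integration.integral_cong) (auto simp: indicator_def)
  also have "\<dots> = (LINT t|sdist ?u. indicator A t * t) + (LINT t|sdist ?u. indicator (- A) t * t)"
    using integrable_mult_indicator[OF _ int, of A] integrable_mult_indicator[OF _ int, of "- A"] A
    by (intro Bochner_Integration.integral_add) auto
  also have "\<dots> = (LINT t|sdist (P A ?u). t) + (LINT t|sdist (P (- A) ?u). t)"
    using integral_sdist_P[OF A uL, of "\<lambda>t. t"] integral_sdist_P[OF cA uL, of "\<lambda>t. t"] by simp
  also have "sdist (P A ?u) = sdist p"
    by (rule sdist_cong[OF P_L2[OF A uL] L(1) PA])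
  also have "sdist (P (- A) ?u) = sdist q"
    by (rule sdist_cong[OF P_L2[OF cA uL] L(3) PB])
  finally have "l2_inner (\<lambda>x. 1 * hp x + hq x) ?u = l2_inner hp p + l2_inner hq q"
    using graph_form[OF uH] graph_form[OF p(1)] graph_form[OF q(1)] by simp
  moreover have "l2_inner (\<lambda>x. 1 * hp x + hq x) ?u = l2_inner hp p + l2_inner hp q + (l2_inner hq p + l2_inner hq q)"
    using L by (simp add: l2_inner_add_left l2_inner_add_right L2_add)
  moreover have "l2_inner hq p = cnj (l2_inner hp q)"
    using self_adjoint_symmetric[OF sa q(1) p(1)] l2_inner_commute[of q hp] by simp
  ultimately have "l2_inner hp q + cnj (l2_inner hp q) = 0"
    by (simp add: algebra_simps)
  then have "Re (l2_inner hp q + cnj (l2_inner hp q)) = 0"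
    by simp
  then show ?thesis by simp
qed

text \<open>Multiplying p by i turns the imaginary part into a real part.\<close>

lemma graph_orthogonal:
  assumes A: "A \<in> sets borel"
    and p: "(p, hp) \<in> H" "ae_eq (P A p) p" and q: "(q, hq) \<in> H" "ae_eq (P (- A) q) q"
  shows "l2_inner hp q = 0"
proof -
  note L = self_adjoint_L2[OF sa p(1)] self_adjoint_L2[OF sa q(1)]
  have zH: "((\<lambda>x. 0), (\<lambda>x. 0)) \<in> H"
    by (rule self_adjointI[OF sa]) (auto simp: l2_inner_def)
  have ip: "(\<lambda>x. \<i> * p x, \<lambda>x. \<i> * hp x) \<in> H"
    using self_adjoint_lincomb[OF sa p(1) zH, of \<i>] by simp
  have "ae_eq (P A (\<lambda>x. \<i> * p x + 0)) (\<lambda>x. \<i> * P A p x + P A (\<lambda>x. 0) x)"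
    using L by (intro P_lin A) auto
  moreover have "ae_eq (P A (\<lambda>x. 0 * p x + 0)) (\<lambda>x. 0 * P A p x + P A (\<lambda>x. 0) x)"
    using L by (intro P_lin A) auto
  moreover have "ae_eq (P A (\<lambda>x. 0)) (\<lambda>x. 0)"
  proof (rule ae_eqI_inner)
    fix g assume "g \<in> L2"
    then show "l2_inner (P A (\<lambda>x. 0)) g = l2_inner (\<lambda>x. 0) g"
      using A by (subst P_sym) (auto simp: l2_inner_def)
  qed (use A in auto)
  ultimately have "ae_eq (P A (\<lambda>x. \<i> * p x)) (\<lambda>x. \<i> * p x)"
    using p(2) unfolding ae_eq_def by (auto elim!: eventually_rev_mp)
  from graph_orthogonal_Re[OF A ip this q] have "Im (l2_inner hp q) = 0"
    by (simp add: l2_inner_cmult_left)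
  with graph_orthogonal_Re[OF A p q] show ?thesis
    by (simp add: complex_eq_iff)
qed

lemma P_idem: "A \<in> sets borel \<Longrightarrow> f \<in> L2 \<Longrightarrow> ae_eq (P A (P A f)) (P A f)"
  using P_Int[of A A f] by simp

text \<open>Additivity on vectors is recovered from norms: the two parts are orthogonal and the
  squares of their norms add up to that of f, so f minus their sum has norm 0.\<close>

lemma P_decomp:
  assumes A: "A \<in> sets borel" and f: "f \<in> L2"
  shows "ae_eq f (\<lambda>x. P A f x + P (- A) f x)"
proof -
  have cA: "- A \<in> sets borel" using A by auto
  let ?p = "P A f" and ?q = "P (- A) f"
  have L: "?p \<in> L2" "?q \<in> L2" using A cA f by auto
  interpret finite_measure "sdist f" by (rule finite_measure_sdist[OF f])
  have "(l2_norm f)\<^sup>2 = measure (sdist f) (A \<union> - A)"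
    using measure_sdist_UNIV[OF f] by (simp add: Un_commute)
  also have "\<dots> = measure (sdist f) A + measure (sdist f) (- A)"
    using A cA by (intro finite_measure_Union) auto
  finally have n: "(l2_norm f)\<^sup>2 = (l2_norm ?p)\<^sup>2 + (l2_norm ?q)\<^sup>2"
    using A cA f by (simp add: measure_sdist)
  have "l2_inner ?p ?q = l2_inner (P (- A) (P A f)) f"
    using P_sym[OF cA L(1) f] by simp
  also have "\<dots> = l2_inner (\<lambda>x. 0) f"
    using P_compl_zero[OF A L(1) P_idem[OF A f]] P_L2[OF cA L(1)] f by (intro l2_inner_cong) auto
  finally have pq: "l2_inner ?p ?q = 0" by (simp add: l2_inner_def)
  let ?s = "\<lambda>x. ?p x + ?q x"
  have sL: "?s \<in> L2" using L by auto
  have "l2_inner ?s f = of_real ((l2_norm f)\<^sup>2)"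
    using L f A cA n by (simp add: l2_inner_add_left P_inner_self)
  then have fs: "Re (l2_inner f ?s) = (l2_norm f)\<^sup>2"
    using l2_inner_commute[of f ?s] by simp
  have "(l2_norm (\<lambda>x. f x + (-1) * ?s x))\<^sup>2 = (l2_norm f)\<^sup>2 + (l2_norm (\<lambda>x. (-1) * ?s x))\<^sup>2 + 2 * Re (l2_inner f (\<lambda>x. (-1) * ?s x))"
    by (rule l2_norm_add_power2[OF f L2_cmult[OF sL]])
  also have "\<dots> = 0"
    using l2_norm_add_power2[OF L] pq n fs unfolding l2_norm_cmult l2_inner_cmult_right by simp
  finally have "l2_norm (\<lambda>x. f x - ?s x) = 0"
    by (simp add: algebra_simps)
  then show ?thesis
    by (rule l2_norm_zero_imp_ae_eq[OF f sL])
qed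

text \<open>The off-diagonal parts vanish by \<open>graph_orthogonal\<close>, so the projection can
  be carried across \<open>H\<close> inside inner products with any (v, k) in the graph;
  self-adjointness then gives membership.\<close>

lemma P_commutes:
  assumes A: "A \<in> sets borel" and u: "(u, h) \<in> H"
  shows "(P A u, P A h) \<in> H"
proof (rule self_adjointI[OF sa])
  have cA: "- A \<in> sets borel" using A by auto
  note L = self_adjoint_L2[OF sa u]
  show "P A u \<in> L2" "P A h \<in> L2" using A L by auto
  fix v k assume v: "(v, k) \<in> H"
  note L = L self_adjoint_L2[OF sa v]
  obtain a where a: "(P A u, a) \<in> H" using P_domain[OF A u] by blast
  obtain b where b: "(P A v, b) \<in> H" using P_domain[OF A v] by blast
  obtain u2 where u2: "(P (- A) u, u2) \<in> H" using P_domain[OF cA u] by blast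
  obtain v2 where v2: "(P (- A) v, v2) \<in> H" using P_domain[OF cA v] by blast
  note L = L self_adjoint_L2[OF sa a] self_adjoint_L2[OF sa b] self_adjoint_L2[OF sa u2] self_adjoint_L2[OF sa v2]
  have split: "l2_inner w y = l2_inner w (P A y) + l2_inner w (P (- A) y)" if "w \<in> L2" "y \<in> L2" for w y
  proof -
    have "l2_inner w y = l2_inner w (\<lambda>x. P A y x + P (- A) y x)"
      by (intro l2_inner_cong P_decomp L2_add P_L2 that A cA ae_eq_refl)
    then show ?thesis using that A cA by (simp add: l2_inner_add_right P_L2)
  qed
  have av: "l2_inner a (P (- A) v) = 0"
    by (rule graph_orthogonal[OF A a P_idem[OF A L(1)] v2 P_idem[OF cA L(3)]])
  have bu: "l2_inner b (P (- A) u) = 0"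
    by (rule graph_orthogonal[OF A b P_idem[OF A L(3)] u2 P_idem[OF cA L(1)]])
  have "l2_inner k (P A u) = l2_inner v a"
    by (rule self_adjoint_symmetric[OF sa v a])
  also have "\<dots> = cnj (l2_inner a v)"
    by (rule l2_inner_commute)
  also have "l2_inner a v = l2_inner a (P A v)"
    using split[of a v] av L by simp
  also have "\<dots> = l2_inner (P A u) b"
    by (rule self_adjoint_symmetric[OF sa a b])
  also have "cnj \<dots> = l2_inner b (P A u)"
    by (rule l2_inner_commute[symmetric])
  also have "\<dots> = l2_inner b u"
    using split[of b u] bu L by simp
  also have "\<dots> = l2_inner (P A v) h"
    by (rule self_adjoint_symmetric[OF sa b u])
  also have "\<dots> = l2_inner v (P A h)"
    using L A by (simp add: P_sym)
  finally show "l2_inner k (P A u) = l2_inner v (P A h)" .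
qed

section \<open>The norm of the resolvent as a spectral integral\<close>

lemma quadratic_form_bound:
  assumes A: "A \<in> sets borel" and \<delta>: "\<And>t. t \<in> A \<Longrightarrow> \<bar>t - t0\<bar> \<le> \<delta>"
    and q: "(q, hq) \<in> H" "ae_eq (P A q) q"
  shows "Re (l2_inner (\<lambda>x. hq x - of_real t0 * q x) q) \<le> \<delta> * (l2_norm q)\<^sup>2"
    and "- (\<delta> * (l2_norm q)\<^sup>2) \<le> Re (l2_inner (\<lambda>x. hq x - of_real t0 * q x) q)"
proof -
  note L = self_adjoint_L2[OF sa q(1)]
  interpret finite_measure "sdist q" by (rule finite_measure_sdist[OF L(1)])
  have M: "sdist (P A q) = sdist q"
    by (rule sdist_cong[OF P_L2[OF A L(1)] L(1) q(2)])
  have int: "integrable (sdist q) (\<lambda>t. t)"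
    by (rule integrable_first_moment[OF q(1)])
  have tot: "measure (sdist q) (space (sdist q)) = (l2_norm q)\<^sup>2"
    using measure_sdist_UNIV[OF L(1)] by simp
  have "l2_inner (\<lambda>x. hq x - of_real t0 * q x) q = of_real (LINT t|sdist q. t) - of_real t0 * of_real ((l2_norm q)\<^sup>2)"
    using L by (simp add: l2_inner_diff_left L2_cmult l2_inner_cmult_left graph_form[OF q(1)] l2_inner_self)
  then have "Re (l2_inner (\<lambda>x. hq x - of_real t0 * q x) q) = (LINT t|sdist q. t) - t0 * measure (sdist q) (space (sdist q))"
    unfolding tot by simp
  also have "\<dots> = (LINT t|sdist q. t - t0)"
    using int by simp
  also have "\<dots> = (LINT t|sdist q. indicator A t * (t - t0))"
    using integral_sdist_P[OF A L(1), of "\<lambda>t. t - t0"] M by simp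
  finally have eq: "Re (l2_inner (\<lambda>x. hq x - of_real t0 * q x) q) = (LINT t|sdist q. indicator A t * (t - t0))" .
  have "\<bar>LINT t|sdist q. indicator A t * (t - t0)\<bar> \<le> (LINT t|sdist q. \<bar>indicator A t * (t - t0)\<bar>)"
    by (rule integral_abs_bound)
  also have "\<dots> \<le> (LINT t|sdist q. indicator A t * \<delta>)"
    using int A \<delta> integrable_mult_indicator[of A "sdist q" "\<lambda>t. t - t0"] integrable_mult_indicator[of A "sdist q" "\<lambda>t. \<delta>"]
    by (intro integral_mono) (auto simp: indicator_def)
  also have "\<dots> = (LINT t|sdist q. \<delta>)"
    using integral_sdist_P[OF A L(1) borel_measurable_const, of \<delta>] unfolding M by (rule sym)
  also have "\<dots> = \<delta> * (l2_norm q)\<^sup>2"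
    using tot by simp
  finally show "Re (l2_inner (\<lambda>x. hq x - of_real t0 * q x) q) \<le> \<delta> * (l2_norm q)\<^sup>2"
    and "- (\<delta> * (l2_norm q)\<^sup>2) \<le> Re (l2_inner (\<lambda>x. hq x - of_real t0 * q x) q)"
    unfolding eq by auto
qed

text \<open>The quadratic form of \<open>H - t\<^sub>0\<close> is bounded by \<open>\<delta>\<close> on the range of \<open>P A\<close>; polarizing with
  \<open>p \<plusminus> r / \<delta>\<close>, where \<open>r = (H - t\<^sub>0) p\<close>, turns this into a norm bound.\<close>

lemma local_norm_bound:
  assumes A: "A \<in> sets borel" "bounded A" and d: "0 < \<delta>" and \<delta>: "\<And>t. t \<in> A \<Longrightarrow> \<bar>t - t0\<bar> \<le> \<delta>"
    and u: "(u, h) \<in> H"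
  defines "p \<equiv> P A u" and "r \<equiv> \<lambda>x. P A h x - of_real t0 * P A u x"
  shows "l2_norm r \<le> \<delta> * l2_norm p"
proof -
  note Lu = self_adjoint_L2[OF sa u]
  have p: "(p, P A h) \<in> H" unfolding p_def by (rule P_commutes[OF A(1) u])
  note L = self_adjoint_L2[OF sa p]
  have rL: "r \<in> L2" unfolding r_def by (intro L2_diff L2_cmult P_L2 A(1) Lu)
  have rP: "ae_eq (P A r) r"
  proof -
    have "ae_eq (P A (\<lambda>x. (- of_real t0) * P A u x + P A h x)) (\<lambda>x. (- of_real t0) * P A (P A u) x + P A (P A h) x)"
      using A Lu by (intro P_lin) auto
    with P_idem[OF A(1) Lu(1)] P_idem[OF A(1) Lu(2)]
    have "ae_eq (P A (\<lambda>x. (- of_real t0) * P A u x + P A h x)) (\<lambda>x. (- of_real t0) * P A u x + P A h x)"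
      unfolding ae_eq_def by eventually_elim simp
    then show ?thesis by (simp add: r_def)
  qed
  \<comment> \<open>Boundedness of A puts r, a vector in the range of \<open>P A\<close>, into the
    domain, so the form can be evaluated at combinations of p and r.\<close>
  obtain k where k: "(P A r, k) \<in> H" using P_domain_bounded[OF A rL] by blast
  note kL = self_adjoint_L2(2)[OF sa k]
  have r: "(r, k) \<in> H"
    by (rule self_adjoint_cong[OF sa k rL kL rP ae_eq_refl])
  have pP: "ae_eq (P A p) p" unfolding p_def by (rule P_idem[OF A(1) Lu(1)])
  define \<beta> where "\<beta> v hv y = l2_inner (\<lambda>x. hv x - of_real t0 * v x) y" for v hv y
  have pr: "\<beta> p (P A h) r = of_real ((l2_norm r)\<^sup>2)"
    unfolding \<beta>_def p_def r_def by (simp add: l2_inner_self)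
  have rp: "\<beta> r k p = of_real ((l2_norm r)\<^sup>2)"
  proof -
    have "\<beta> r k p = l2_inner k p - of_real t0 * l2_inner r p"
      using L rL kL by (simp add: \<beta>_def l2_inner_diff_left L2_cmult l2_inner_cmult_left)
    also have "\<dots> = l2_inner r (P A h) - of_real t0 * l2_inner r p"
      using self_adjoint_symmetric[OF sa r p] by simp
    also have "\<dots> = l2_inner r r"
      unfolding r_def[THEN meta_eq_to_obj_eq, THEN arg_cong[of _ _ "l2_inner r"]]
      using L rL by (simp add: l2_inner_diff_right L2_cmult l2_inner_cmult_right p_def)
    finally show ?thesis by (simp add: l2_inner_self)
  qed
  have exp: "Re (\<beta> (\<lambda>x. of_real s * r x + p x) (\<lambda>x. of_real s * k x + P A h x) (\<lambda>x. of_real s * r x + p x))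
      = Re (\<beta> p (P A h) p) + 2 * s * (l2_norm r)\<^sup>2 + s\<^sup>2 * Re (\<beta> r k r)" for s :: real
  proof -
    let ?b = "\<lambda>v hv x. hv x - of_real t0 * v x"
    have bL: "?b r k \<in> L2" "?b p (P A h) \<in> L2" using L rL kL by auto
    have "(\<lambda>x. (of_real s * k x + P A h x) - of_real t0 * (of_real s * r x + p x)) = (\<lambda>x. of_real s * ?b r k x + ?b p (P A h) x)"
      by (auto simp: fun_eq_iff algebra_simps)
    then have "\<beta> (\<lambda>x. of_real s * r x + p x) (\<lambda>x. of_real s * k x + P A h x) (\<lambda>x. of_real s * r x + p x)
        = of_real s * (of_real s * \<beta> r k r + \<beta> r k p) + (of_real s * \<beta> p (P A h) r + \<beta> p (P A h) p)"
      unfolding \<beta>_def using bL L rL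
      by (simp only: l2_inner_add_left l2_inner_add_right L2_cmult L2_add l2_inner_cmult_left l2_inner_cmult_right complex_cnj_complex_of_real)
    then show ?thesis
      unfolding pr rp by (simp add: algebra_simps power2_eq_square)
  qed
  have test: "(\<lambda>x. of_real s * r x + p x, \<lambda>x. of_real s * k x + P A h x) \<in> H"
      "ae_eq (P A (\<lambda>x. of_real s * r x + p x)) (\<lambda>x. of_real s * r x + p x)" for s :: real
  proof -
    show "(\<lambda>x. of_real s * r x + p x, \<lambda>x. of_real s * k x + P A h x) \<in> H"
      by (rule self_adjoint_lincomb[OF sa r p])
    show "ae_eq (P A (\<lambda>x. of_real s * r x + p x)) (\<lambda>x. of_real s * r x + p x)"
      using P_lin[OF A(1) rL L(1), of "of_real s"] rP pP unfolding ae_eq_def by eventually_elim simp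
  qed
  have nrm: "(l2_norm (\<lambda>x. of_real s * r x + p x))\<^sup>2 = s\<^sup>2 * (l2_norm r)\<^sup>2 + (l2_norm p)\<^sup>2 + 2 * s * Re (l2_inner r p)" for s :: real
    using rL L by (subst l2_norm_add_power2) (auto simp: l2_norm_cmult power_mult_distrib l2_inner_cmult_left)
  \<comment> \<open>Subtracting the lower bound at -s from the upper bound at s cancels the diagonal
    values of the form and the inner product of r and p, leaving 4 s |r|^2 \<le> 2 \<delta> (s^2
    |r|^2 + |p|^2); s = 1 / \<delta> turns this into the claim.\<close>
  let ?s = "1 / \<delta>"
  have up: "Re (\<beta> p (P A h) p) + 2 * ?s * (l2_norm r)\<^sup>2 + ?s\<^sup>2 * Re (\<beta> r k r)
      \<le> \<delta> * (?s\<^sup>2 * (l2_norm r)\<^sup>2 + (l2_norm p)\<^sup>2 + 2 * ?s * Re (l2_inner r p))"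
    using quadratic_form_bound(1)[OF A(1) \<delta> test[of ?s]] unfolding \<beta>_def[symmetric] exp nrm .
  have lo: "- (\<delta> * ((- ?s)\<^sup>2 * (l2_norm r)\<^sup>2 + (l2_norm p)\<^sup>2 + 2 * (- ?s) * Re (l2_inner r p)))
      \<le> Re (\<beta> p (P A h) p) + 2 * (- ?s) * (l2_norm r)\<^sup>2 + (- ?s)\<^sup>2 * Re (\<beta> r k r)"
    using quadratic_form_bound(2)[OF A(1) \<delta> test[of "- ?s"]] unfolding \<beta>_def[symmetric] exp nrm .
  have "4 * ?s * (l2_norm r)\<^sup>2 \<le> 2 * \<delta> * (?s\<^sup>2 * (l2_norm r)\<^sup>2 + (l2_norm p)\<^sup>2)"
    using up lo by (simp add: algebra_simps)
  then have "4 * (l2_norm r)\<^sup>2 * \<delta> \<le> 2 * (l2_norm r)\<^sup>2 * \<delta> + 2 * \<delta> * (\<delta>\<^sup>2 * (l2_norm p)\<^sup>2)"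
    using d by (simp add: field_simps power2_eq_square)
  then have "(2 * \<delta>) * (l2_norm r)\<^sup>2 \<le> (2 * \<delta>) * (\<delta>\<^sup>2 * (l2_norm p)\<^sup>2)"
    by (simp add: algebra_simps)
  then have "(l2_norm r)\<^sup>2 \<le> \<delta>\<^sup>2 * (l2_norm p)\<^sup>2"
    by (rule mult_left_le_imp_le) (use d in simp)
  then have "(l2_norm r)\<^sup>2 \<le> (\<delta> * l2_norm p)\<^sup>2"
    by (simp add: power_mult_distrib)
  then show ?thesis
    using d by (rule_tac power2_le_imp_le) auto
qed

text \<open>With p = \<open>P A u\<close>, commutation gives \<open>P A f\<close> = (H - \<zeta>) p
  = (H - t0) p + (t0 - \<zeta>) p, and the first term has norm at most \<delta> times that of
  p.\<close>

lemma local_density_bounds: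
  assumes A: "A \<in> sets borel" "bounded A" and d: "0 < \<delta>" and \<delta>: "\<And>t. t \<in> A \<Longrightarrow> \<bar>t - t0\<bar> \<le> \<delta>"
    and u: "(u, \<lambda>x. f x + \<zeta> * u x) \<in> H" and f: "f \<in> L2"
  shows "l2_norm (P A f) \<le> (cmod (of_real t0 - \<zeta>) + \<delta>) * l2_norm (P A u)"
    and "(cmod (of_real t0 - \<zeta>) - \<delta>) * l2_norm (P A u) \<le> l2_norm (P A f)"
proof -
  let ?h = "\<lambda>x. f x + \<zeta> * u x" and ?p = "P A u"
  let ?r = "\<lambda>x. P A ?h x - of_real t0 * ?p x"
  note L = self_adjoint_L2[OF sa u]
  have pL: "?p \<in> L2" "P A f \<in> L2" "P A ?h \<in> L2" using A L f by auto
  have r: "l2_norm ?r \<le> \<delta> * l2_norm ?p"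
    by (rule local_norm_bound[OF A d \<delta> u])
  have rL: "?r \<in> L2" using pL by auto
  have "ae_eq (P A (\<lambda>x. \<zeta> * u x + f x)) (\<lambda>x. \<zeta> * P A u x + P A f x)"
    by (rule P_lin[OF A(1) L(1) f])
  then have "ae_eq (P A ?h) (\<lambda>x. \<zeta> * ?p x + P A f x)"
    by (simp only: add.commute)
  then have eq: "ae_eq (P A f) (\<lambda>x. ?r x + (of_real t0 - \<zeta>) * ?p x)"
    unfolding ae_eq_def by eventually_elim (simp add: left_diff_distrib)
  have n1: "l2_norm (P A f) = l2_norm (\<lambda>x. ?r x + (of_real t0 - \<zeta>) * ?p x)"
    using eq by (rule l2_norm_cong[rotated 2]) (use pL rL in \<open>auto intro!: L2_measurable\<close>)
  also have "\<dots> \<le> l2_norm ?r + cmod (of_real t0 - \<zeta>) * l2_norm ?p"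
    using l2_norm_triangle[OF rL L2_cmult[OF pL(1)], of "of_real t0 - \<zeta>"] by (simp add: l2_norm_cmult)
  finally show "l2_norm (P A f) \<le> (cmod (of_real t0 - \<zeta>) + \<delta>) * l2_norm ?p"
    using r by (simp add: algebra_simps)
  have "cmod (of_real t0 - \<zeta>) * l2_norm ?p = l2_norm (\<lambda>x. (of_real t0 - \<zeta>) * ?p x)"
    by (simp add: l2_norm_cmult)
  also have "\<dots> = l2_norm (\<lambda>x. (?r x + (of_real t0 - \<zeta>) * ?p x) - ?r x)"
    by simp
  also have "\<dots> \<le> l2_norm (P A f) + l2_norm ?r"
    unfolding n1 by (rule l2_norm_triangle_diff) (use rL pL in auto)
  finally show "(cmod (of_real t0 - \<zeta>) - \<delta>) * l2_norm ?p \<le> l2_norm (P A f)"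
    using r by (simp add: algebra_simps)
qed

text \<open>Let D be the distance from t0 to \<zeta>. Both |t - \<zeta>| on the cell and the factor
  between the norms of \<open>P A u\<close> and \<open>P A f\<close> lie between D - \<delta> and D
  + \<delta>. Since (D + \<delta>) / (D - \<delta>) decreases in D and D \<ge> \<epsilon>, one
  constant \<rho> serves all cells.\<close>

lemma cell_bounds:
  assumes A: "A \<in> sets borel" "bounded A" and d: "0 < \<delta>" "\<delta> < \<epsilon>" and \<delta>: "\<And>t. t \<in> A \<Longrightarrow> \<bar>t - t0\<bar> \<le> \<delta>"
    and \<epsilon>: "\<epsilon> \<le> \<bar>Im \<zeta>\<bar>" and u: "(u, \<lambda>x. f x + \<zeta> * u x) \<in> H" and f: "f \<in> L2"
  defines "\<rho> \<equiv> ((\<epsilon> + \<delta>) / (\<epsilon> - \<delta>))\<^sup>2"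
  shows "(\<integral>\<^sup>+t\<in>A. ennreal (1 / (cmod (of_real t - \<zeta>))\<^sup>2) \<partial>sdist f) \<le> ennreal \<rho> * emeasure (sdist u) A"
    and "ennreal (1 / \<rho>) * emeasure (sdist u) A \<le> (\<integral>\<^sup>+t\<in>A. ennreal (1 / (cmod (of_real t - \<zeta>))\<^sup>2) \<partial>sdist f)"
proof -
  note L = self_adjoint_L2[OF sa u]
  define D where "D = cmod (of_real t0 - \<zeta>)"
  have De: "\<epsilon> \<le> D"
    using \<epsilon> abs_Im_le_cmod[of "of_real t0 - \<zeta>"] by (simp add: D_def)
  have tD: "D - \<delta> \<le> cmod (of_real t - \<zeta>)" "cmod (of_real t - \<zeta>) \<le> D + \<delta>" if "t \<in> A" for t
  proof -
    have "cmod (of_real t - of_real t0) \<le> \<delta>"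
      using \<delta>[OF that] by (metis norm_of_real of_real_diff)
    then show "D - \<delta> \<le> cmod (of_real t - \<zeta>)" "cmod (of_real t - \<zeta>) \<le> D + \<delta>"
      using norm_triangle_ineq[of "of_real t - of_real t0" "of_real t0 - \<zeta>"]
        norm_triangle_ineq[of "of_real t0 - of_real t" "of_real t - \<zeta>"]
      by (auto simp: D_def norm_minus_commute[of "of_real t0"])
  qed
  have ratio: "(D + \<delta>) / (D - \<delta>) \<le> (\<epsilon> + \<delta>) / (\<epsilon> - \<delta>)"
    using d De by (simp add: divide_simps) (simp add: algebra_simps)
  have rho: "((D + \<delta>) / (D - \<delta>))\<^sup>2 \<le> \<rho>"
    unfolding \<rho>_def using d De by (intro power_mono ratio) auto
  have pos: "0 < D - \<delta>" "0 < D + \<delta>" using d De by auto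
  have rpos: "0 < ((D + \<delta>) / (D - \<delta>))\<^sup>2" using pos by simp
  have ms: "emeasure (sdist f) A = ennreal ((l2_norm (P A f))\<^sup>2)" "emeasure (sdist u) A = ennreal ((l2_norm (P A u))\<^sup>2)"
    using A f L by (simp_all add: emeasure_sdist)
  have up: "(l2_norm (P A f))\<^sup>2 \<le> (D + \<delta>)\<^sup>2 * (l2_norm (P A u))\<^sup>2"
    using power_mono[OF local_density_bounds(1)[OF A d(1) \<delta> u f], of 2] by (simp add: D_def power_mult_distrib)
  have lo: "(D - \<delta>)\<^sup>2 * (l2_norm (P A u))\<^sup>2 \<le> (l2_norm (P A f))\<^sup>2"
    using power_mono[OF local_density_bounds(2)[OF A d(1) \<delta> u f], of 2] pos by (simp add: D_def power_mult_distrib)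
  have "(\<integral>\<^sup>+t\<in>A. ennreal (1 / (cmod (of_real t - \<zeta>))\<^sup>2) \<partial>sdist f) \<le> (\<integral>\<^sup>+t. ennreal (1 / (D - \<delta>)\<^sup>2) * indicator A t \<partial>sdist f)"
  proof (intro nn_integral_mono)
    fix t
    have "1 / (cmod (of_real t - \<zeta>))\<^sup>2 \<le> 1 / (D - \<delta>)\<^sup>2" if "t \<in> A"
      using tD[OF that] pos by (intro frac_le power_mono zero_less_power) auto
    then show "ennreal (1 / (cmod (of_real t - \<zeta>))\<^sup>2) * indicator A t \<le> ennreal (1 / (D - \<delta>)\<^sup>2) * indicator A t"
      by (auto simp: indicator_def intro: ennreal_leI)
  qed
  also have "\<dots> = ennreal (1 / (D - \<delta>)\<^sup>2) * ennreal ((l2_norm (P A f))\<^sup>2)"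
    using A by (simp add: nn_integral_cmult_indicator ms)
  also have "\<dots> \<le> ennreal (1 / (D - \<delta>)\<^sup>2) * ennreal ((D + \<delta>)\<^sup>2 * (l2_norm (P A u))\<^sup>2)"
    by (intro mult_left_mono ennreal_leI up) auto
  also have "\<dots> = ennreal (((D + \<delta>) / (D - \<delta>))\<^sup>2) * ennreal ((l2_norm (P A u))\<^sup>2)"
    by (simp add: ennreal_mult'[symmetric] power_divide)
  also have "\<dots> \<le> ennreal \<rho> * emeasure (sdist u) A"
    unfolding ms by (intro mult_right_mono ennreal_leI rho) auto
  finally show "(\<integral>\<^sup>+t\<in>A. ennreal (1 / (cmod (of_real t - \<zeta>))\<^sup>2) \<partial>sdist f) \<le> ennreal \<rho> * emeasure (sdist u) A" .
  have "1 / \<rho> \<le> 1 / ((D + \<delta>) / (D - \<delta>))\<^sup>2"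
    using rho rpos by (intro frac_le) auto
  then have "ennreal (1 / \<rho>) * emeasure (sdist u) A \<le> ennreal (1 / ((D + \<delta>) / (D - \<delta>))\<^sup>2) * ennreal ((l2_norm (P A u))\<^sup>2)"
    unfolding ms by (intro mult_right_mono ennreal_leI) auto
  also have "\<dots> = ennreal (1 / (D + \<delta>)\<^sup>2) * ennreal ((D - \<delta>)\<^sup>2 * (l2_norm (P A u))\<^sup>2)"
    by (simp add: ennreal_mult'[symmetric] power_divide)
  also have "\<dots> \<le> ennreal (1 / (D + \<delta>)\<^sup>2) * ennreal ((l2_norm (P A f))\<^sup>2)"
    by (intro mult_left_mono ennreal_leI lo) auto
  also have "\<dots> = (\<integral>\<^sup>+t. ennreal (1 / (D + \<delta>)\<^sup>2) * indicator A t \<partial>sdist f)"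
    using A by (simp add: nn_integral_cmult_indicator ms)
  also have "\<dots> \<le> (\<integral>\<^sup>+t\<in>A. ennreal (1 / (cmod (of_real t - \<zeta>))\<^sup>2) \<partial>sdist f)"
  proof (intro nn_integral_mono)
    fix t
    have "1 / (D + \<delta>)\<^sup>2 \<le> 1 / (cmod (of_real t - \<zeta>))\<^sup>2" if "t \<in> A"
      using tD[OF that] pos by (intro frac_le power_mono zero_less_power) auto
    then show "ennreal (1 / (D + \<delta>)\<^sup>2) * indicator A t \<le> ennreal (1 / (cmod (of_real t - \<zeta>))\<^sup>2) * indicator A t"
      by (auto simp: indicator_def intro: ennreal_leI)
  qed
  finally show "ennreal (1 / \<rho>) * emeasure (sdist u) A \<le> (\<integral>\<^sup>+t\<in>A. ennreal (1 / (cmod (of_real t - \<zeta>))\<^sup>2) \<partial>sdist f)" .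
qed

text \<open>A grid of half-open cells of length \<delta>; \<open>int_decode\<close> enumerates the
  integers because countable additivity speaks of sequences indexed by naturals.\<close>

lemma cells:
  fixes \<delta> :: real
  assumes "0 < \<delta>"
  defines "B \<equiv> \<lambda>n::nat. {of_int (int_decode n) * \<delta> ..< (of_int (int_decode n) + 1) * \<delta>}"
  shows "disjoint_family B" "(\<Union>n. B n) = UNIV"
proof -
  have fl: "t \<in> B n \<longleftrightarrow> \<lfloor>t / \<delta>\<rfloor> = int_decode n" for t n
    using assms(1) by (simp add: B_def floor_eq_iff field_simps)
  show "disjoint_family B"
    unfolding disjoint_family_on_def using inj_int_decode by (auto simp: fl set_eq_iff dest: injD)
  show "(\<Union>n. B n) = UNIV"
    using surj_int_decode by (auto simp: fl) (metis surjD)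
qed

text \<open>This stands in for the functional calculus of 1 / |t - \<zeta>|^2: the cell estimates
  with their common factor are added up, and the factor tends to 1 as the grid is refined.\<close>

lemma resolvent_norm_eq:
  assumes \<zeta>: "Im \<zeta> \<noteq> 0" and u: "(u, \<lambda>x. f x + \<zeta> * u x) \<in> H" and f: "f \<in> L2"
  shows "(l2_norm u)\<^sup>2 = (LINT t|sdist f. 1 / (cmod (of_real t - \<zeta>))\<^sup>2)"
proof -
  note L = self_adjoint_L2[OF sa u]
  interpret F: finite_measure "sdist f" by (rule finite_measure_sdist[OF f])
  define \<epsilon> where "\<epsilon> = \<bar>Im \<zeta>\<bar>"
  have e: "0 < \<epsilon>" using \<zeta> by (simp add: \<epsilon>_def)
  let ?g = "\<lambda>t. 1 / (cmod (of_real t - \<zeta>))\<^sup>2"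
  let ?I = "LINT t|sdist f. ?g t"
  have "integrable (sdist f) ?g"
  proof (rule F.integrable_const_bound[of _ "1 / \<epsilon>\<^sup>2"])
    have "\<epsilon> \<le> cmod (of_real t - \<zeta>)" for t
      using abs_Im_le_cmod[of "of_real t - \<zeta>"] by (simp add: \<epsilon>_def)
    then show "AE t in sdist f. norm (?g t) \<le> 1 / \<epsilon>\<^sup>2"
      using e by (intro AE_I2) (auto intro!: frac_le power_mono zero_less_power)
  qed measurable
  then have I: "(\<integral>\<^sup>+t. ennreal (?g t) \<partial>sdist f) = ennreal ?I"
    by (intro nn_integral_eq_integral) auto
  have I0: "0 \<le> ?I" by (intro integral_nonneg_AE) auto
  have U: "emeasure (sdist u) UNIV = ennreal ((l2_norm u)\<^sup>2)"
  proof -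
    interpret finite_measure "sdist u" by (rule finite_measure_sdist[OF L(1)])
    show ?thesis using emeasure_eq_measure[of UNIV] measure_sdist_UNIV[OF L(1)] by simp
  qed
  have bounds: "?I \<le> ((\<epsilon> + \<delta>) / (\<epsilon> - \<delta>))\<^sup>2 * (l2_norm u)\<^sup>2 \<and> (l2_norm u)\<^sup>2 \<le> ((\<epsilon> + \<delta>) / (\<epsilon> - \<delta>))\<^sup>2 * ?I"
    if d: "0 < \<delta>" "\<delta> < \<epsilon>" for \<delta>
  proof -
    let ?\<rho> = "((\<epsilon> + \<delta>) / (\<epsilon> - \<delta>))\<^sup>2"
    let ?B = "\<lambda>n::nat. {of_int (int_decode n) * \<delta> ..< (of_int (int_decode n) + 1) * \<delta>}"
    have \<rho>: "0 < ?\<rho>" using d by simp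
    have close: "\<bar>t - of_int (int_decode n) * \<delta>\<bar> \<le> \<delta>" if "t \<in> ?B n" for t n
      using that by (auto simp: algebra_simps)
    have le: "\<epsilon> \<le> \<bar>Im \<zeta>\<bar>" by (simp add: \<epsilon>_def)
    note cb = cell_bounds[OF _ _ d close le u f]
    have bb: "?B n \<in> sets borel" "bounded (?B n)" for n
      by (auto intro: bounded_subset[OF bounded_closed_interval])
    have "(\<integral>\<^sup>+t. ennreal (?g t) \<partial>sdist f) = (\<integral>\<^sup>+t\<in>(\<Union>n. ?B n). ennreal (?g t) \<partial>sdist f)"
      unfolding cells(2)[OF d(1)] by simp
    also have "\<dots> = (\<Sum>n. \<integral>\<^sup>+t\<in>?B n. ennreal (?g t) \<partial>sdist f)"
      by (rule nn_integral_disjoint_family) (use cells(1)[OF d(1)] in auto)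
    finally have Isum: "ennreal ?I = (\<Sum>n. \<integral>\<^sup>+t\<in>?B n. ennreal (?g t) \<partial>sdist f)"
      using I by simp
    have Usum: "ennreal ((l2_norm u)\<^sup>2) = (\<Sum>n. emeasure (sdist u) (?B n))"
    proof -
      have "range ?B \<subseteq> sets (sdist u)" by (auto simp: image_subset_iff)
      from suminf_emeasure[OF this cells(1)[OF d(1)]] show ?thesis
        unfolding cells(2)[OF d(1)] U by (rule sym)
    qed
    have "ennreal ?I \<le> (\<Sum>n. ennreal ?\<rho> * emeasure (sdist u) (?B n))"
      unfolding Isum by (intro suminf_le cb(1) bb summableI)
    also have "\<dots> = ennreal (?\<rho> * (l2_norm u)\<^sup>2)"
      unfolding ennreal_suminf_cmult Usum[symmetric] by (simp add: ennreal_mult')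
    finally have 1: "?I \<le> ?\<rho> * (l2_norm u)\<^sup>2"
      using \<rho> by (subst (asm) ennreal_le_iff) auto
    have "ennreal (1 / ?\<rho> * (l2_norm u)\<^sup>2) = (\<Sum>n. ennreal (1 / ?\<rho>) * emeasure (sdist u) (?B n))"
      unfolding ennreal_suminf_cmult Usum[symmetric] by (rule ennreal_mult') simp
    also have "\<dots> \<le> ennreal ?I"
      unfolding Isum by (intro suminf_le cb(2) bb summableI)
    finally have "1 / ?\<rho> * (l2_norm u)\<^sup>2 \<le> ?I"
      using I0 by (subst (asm) ennreal_le_iff) auto
    then have "(l2_norm u)\<^sup>2 \<le> ?\<rho> * ?I"
      using \<rho> by (simp add: pos_divide_le_eq mult.commute)
    with 1 show ?thesis by simp
  qed
  have lim: "((\<lambda>\<delta>. ((\<epsilon> + \<delta>) / (\<epsilon> - \<delta>))\<^sup>2 * C) \<longlongrightarrow> C) (at_right 0)" for C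
  proof -
    have "((\<lambda>\<delta>. ((\<epsilon> + \<delta>) / (\<epsilon> - \<delta>))\<^sup>2 * C) \<longlongrightarrow> ((\<epsilon> + 0) / (\<epsilon> - 0))\<^sup>2 * C) (at_right 0)"
      using e by (intro tendsto_intros) auto
    then show ?thesis using e by simp
  qed
  have ev: "\<forall>\<^sub>F \<delta> in at_right 0. 0 < \<delta> \<and> \<delta> < \<epsilon>"
    using e by (auto simp: eventually_at_right_field)
  have nb: "at_right (0::real) \<noteq> bot" by simp
  show ?thesis
  proof (rule antisym)
    show "(l2_norm u)\<^sup>2 \<le> ?I"
      by (rule tendsto_lowerbound[OF lim _ nb]) (use ev bounds in \<open>auto elim!: eventually_mono\<close>)
    show "?I \<le> (l2_norm u)\<^sup>2"
      by (rule tendsto_lowerbound[OF lim _ nb]) (use ev bounds in \<open>auto elim!: eventually_mono\<close>)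
  qed
qed

text \<open>(f, u) = (Hu, u) - \<zeta> |u|^2 and (Hu, u) is real, so only the norm of u contributes
  to the imaginary part.\<close>

lemma Poisson_integral_eq:
  assumes \<zeta>: "Im \<zeta> < 0" and u: "(u, \<lambda>x. f x + \<zeta> * u x) \<in> H" and f: "f \<in> L2"
  shows "Im (l2_inner f u) = (LINT t|sdist f. (- Im \<zeta>) / (cmod (of_real t - \<zeta>))\<^sup>2)"
proof -
  note L = self_adjoint_L2[OF sa u]
  have "l2_inner (\<lambda>x. f x + \<zeta> * u x) u = l2_inner f u + \<zeta> * of_real ((l2_norm u)\<^sup>2)"
    using L f by (simp add: l2_inner_add_left L2_cmult l2_inner_cmult_left l2_inner_self)
  then have "l2_inner f u = of_real (LINT t|sdist u. t) - \<zeta> * of_real ((l2_norm u)\<^sup>2)"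
    using graph_form[OF u] by simp
  then have "Im (l2_inner f u) = (- Im \<zeta>) * (l2_norm u)\<^sup>2"
    by simp
  also have "\<dots> = (- Im \<zeta>) * (LINT t|sdist f. 1 / (cmod (of_real t - \<zeta>))\<^sup>2)"
    using resolvent_norm_eq[OF _ u f] \<zeta> by simp
  also have "\<dots> = (LINT t|sdist f. (- Im \<zeta>) * (1 / (cmod (of_real t - \<zeta>))\<^sup>2))"
    by (rule integral_mult_right_zero[symmetric])
  finally show ?thesis by simp
qed

end

section \<open>Stieltjes inversion\<close>

text \<open>The weight 2 \<kappa> is the Jacobian of the energy \<kappa>^2, so the integrand has the
  primitive arctan ((\<kappa>^2 - t) / \<epsilon>).\<close>

lemma Poisson_kernel_integral:
  fixes a b t \<epsilon> :: real
  assumes "0 \<le> a" "a \<le> b" "0 < \<epsilon>"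
  shows "(\<integral>\<^sup>+\<kappa>. ennreal (2 * \<kappa> * (\<epsilon> / ((t - \<kappa>\<^sup>2)\<^sup>2 + \<epsilon>\<^sup>2))) * indicator {a..b} \<kappa> \<partial>lborel)
    = ennreal (arctan ((b\<^sup>2 - t) / \<epsilon>) - arctan ((a\<^sup>2 - t) / \<epsilon>))"
proof (rule nn_integral_FTC_Icc)
  fix \<kappa> assume "\<kappa> \<in> {a..b}"
  have "((\<lambda>\<kappa>. arctan ((\<kappa>\<^sup>2 - t) / \<epsilon>)) has_real_derivative (inverse (1 + ((\<kappa>\<^sup>2 - t) / \<epsilon>)\<^sup>2) * (2 * \<kappa> / \<epsilon>))) (at \<kappa>)"
    using assms(3) by (auto intro!: derivative_eq_intros simp: divide_simps)
  moreover have "inverse (1 + ((\<kappa>\<^sup>2 - t) / \<epsilon>)\<^sup>2) * (2 * \<kappa> / \<epsilon>) = 2 * \<kappa> * (\<epsilon> / ((t - \<kappa>\<^sup>2)\<^sup>2 + \<epsilon>\<^sup>2))"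
  proof -
    have "(\<kappa>\<^sup>2 - t)\<^sup>2 = (t - \<kappa>\<^sup>2)\<^sup>2" by (rule power2_commute)
    then have "1 + ((\<kappa>\<^sup>2 - t) / \<epsilon>)\<^sup>2 = ((t - \<kappa>\<^sup>2)\<^sup>2 + \<epsilon>\<^sup>2) / \<epsilon>\<^sup>2"
      using assms(3) by (simp add: power_divide add_divide_distrib)
    then show ?thesis using assms(3) by (simp add: power2_eq_square[of \<epsilon>])
  qed
  ultimately show "((\<lambda>\<kappa>. arctan ((\<kappa>\<^sup>2 - t) / \<epsilon>)) has_real_derivative 2 * \<kappa> * (\<epsilon> / ((t - \<kappa>\<^sup>2)\<^sup>2 + \<epsilon>\<^sup>2))) (at \<kappa>)"
    by simp
qed (use assms in auto)

lemma arctan_scaled_tendsto: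
  fixes x :: real
  assumes "\<And>n. 0 < \<epsilon> n" "\<epsilon> \<longlonglongrightarrow> 0"
  shows "(\<lambda>n. arctan (x / \<epsilon> n)) \<longlonglongrightarrow> sgn x * (pi / 2)"
proof -
  have inf: "filterlim (\<lambda>n. inverse (\<epsilon> n)) at_top sequentially"
    using assms by (intro filterlim_inverse_at_top) auto
  consider "0 < x" | "x = 0" | "x < 0" by linarith
  then show ?thesis
  proof cases
    case 1
    then have "filterlim (\<lambda>n. x / \<epsilon> n) at_top sequentially"
      unfolding divide_inverse by (intro filterlim_tendsto_pos_mult_at_top[OF tendsto_const _ inf])
    from filterlim_compose[OF tendsto_arctan_at_top this] show ?thesis
      using 1 by simp
  next
    case 3
    then have "0 < - x" by simp
    then have "filterlim (\<lambda>n. - x / \<epsilon> n) at_top sequentially"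
      unfolding divide_inverse by (intro filterlim_tendsto_pos_mult_at_top[OF tendsto_const _ inf])
    from tendsto_minus[OF filterlim_compose[OF tendsto_arctan_at_top this]] show ?thesis
      using 3 by (simp add: arctan_minus)
  qed simp
qed

text \<open>Continuity of Q up to \<epsilon> = 0 allows the limit under the integral on the left and
  excludes point masses at the end points. On the right the difference of arctangents tends to pi
  inside the interval and to 0 outside.\<close>

lemma Stieltjes_inversion:
  fixes M :: "real measure" and Q :: "real \<Rightarrow> real \<Rightarrow> real"
  assumes M: "finite_measure M" and sM [measurable_cong]: "sets M = sets borel" and ab: "0 < a" "a < b" and \<eta>: "0 < \<eta>"
    and cont: "continuous_on ({a..b} \<times> {0..\<eta>}) (\<lambda>(\<kappa>, \<epsilon>). Q \<kappa> \<epsilon>)"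
    and Pois: "\<And>\<kappa> \<epsilon>. \<kappa> \<in> {a..b} \<Longrightarrow> 0 < \<epsilon> \<Longrightarrow> \<epsilon> \<le> \<eta> \<Longrightarrow> Q \<kappa> \<epsilon> = (LINT t|M. \<epsilon> / ((t - \<kappa>\<^sup>2)\<^sup>2 + \<epsilon>\<^sup>2))"
  shows "(LINT \<kappa>:{a..b}|lborel. 2 * \<kappa> * Q \<kappa> 0) = pi * measure M {a\<^sup>2..<b\<^sup>2}"
proof -
  interpret finite_measure M by (rule M)
  interpret pair: pair_sigma_finite lborel M ..
  have spM: "space M = UNIV" using sets_eq_imp_space_eq[OF sM] by simp
  define \<epsilon> where "\<epsilon> n = \<eta> / Suc n" for n
  have \<epsilon>: "0 < \<epsilon> n" "\<epsilon> n \<le> \<eta>" for n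
    using \<eta> by (auto simp: \<epsilon>_def divide_le_eq)
  have \<epsilon>0: "\<epsilon> \<longlonglongrightarrow> 0"
    unfolding \<epsilon>_def[abs_def] using tendsto_mult[OF tendsto_const[of \<eta>] LIMSEQ_inverse_real_of_nat]
    by (simp add: divide_inverse)
  have Qc: "continuous_on {a..b} (\<lambda>\<kappa>. Q \<kappa> e)" if "e \<in> {0..\<eta>}" for e
  proof -
    have "continuous_on {a..b} ((\<lambda>(\<kappa>, \<epsilon>). Q \<kappa> \<epsilon>) \<circ> (\<lambda>\<kappa>. (\<kappa>, e)))"
      by (intro continuous_on_compose continuous_intros continuous_on_subset[OF cont]) (use that in auto)
    then show ?thesis by (simp add: o_def)
  qed
  have Qlim: "(\<lambda>n. Q \<kappa> (\<epsilon> n)) \<longlonglongrightarrow> Q \<kappa> 0" if "\<kappa> \<in> {a..b}" for \<kappa>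
  proof -
    have pt: "(\<lambda>n. (\<kappa>, \<epsilon> n)) \<longlonglongrightarrow> (\<kappa>, 0)"
      by (intro tendsto_intros \<epsilon>0)
    have "((\<lambda>(\<kappa>, \<epsilon>). Q \<kappa> \<epsilon>) \<circ> (\<lambda>n. (\<kappa>, \<epsilon> n))) \<longlonglongrightarrow> (\<lambda>(\<kappa>, \<epsilon>). Q \<kappa> \<epsilon>) (\<kappa>, 0)"
      using cont[unfolded continuous_on_sequentially, rule_format, of "(\<kappa>, 0)" "\<lambda>n. (\<kappa>, \<epsilon> n)"] pt that \<epsilon> \<eta>
      by (simp add: less_imp_le)
    then show ?thesis by (simp add: o_def)
  qed
  have "compact ((\<lambda>(\<kappa>, \<epsilon>). Q \<kappa> \<epsilon>) ` ({a..b} \<times> {0..\<eta>}))"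
    by (intro compact_continuous_image cont compact_Times compact_Icc)
  then obtain B where B: "\<And>\<kappa> e. \<kappa> \<in> {a..b} \<Longrightarrow> e \<in> {0..\<eta>} \<Longrightarrow> \<bar>Q \<kappa> e\<bar> \<le> B"
    using compact_imp_bounded[of "(\<lambda>(\<kappa>, \<epsilon>). Q \<kappa> \<epsilon>) ` ({a..b} \<times> {0..\<eta>})"] unfolding bounded_iff by fastforce
  \<comment> \<open>\<epsilon> times the Poisson kernel equals 1 at t = \<kappa>^2, so a point mass
    is at most \<epsilon> Q(\<kappa>, \<epsilon>), which tends to 0 because Q has a finite
    limit.\<close>
  have atom: "measure M {\<kappa>\<^sup>2} = 0" if \<kappa>: "\<kappa> \<in> {a..b}" for \<kappa>
  proof -
    have "measure M {\<kappa>\<^sup>2} \<le> \<epsilon> n * Q \<kappa> (\<epsilon> n)" for n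
    proof -
      let ?e = "\<epsilon> n"
      have e: "0 < ?e" by (rule \<epsilon>)
      have le1: "?e * (?e / ((t - \<kappa>\<^sup>2)\<^sup>2 + ?e\<^sup>2)) \<le> 1" for t
      proof -
        have "0 < (t - \<kappa>\<^sup>2)\<^sup>2 + ?e\<^sup>2" using e by (intro add_nonneg_pos) auto
        then show ?thesis by (simp add: divide_le_eq power2_eq_square)
      qed
      have "measure M {\<kappa>\<^sup>2} = (LINT t|M. indicator {\<kappa>\<^sup>2} t)"
        using sM by (simp add: spM)
      also have "\<dots> \<le> (LINT t|M. ?e * (?e / ((t - \<kappa>\<^sup>2)\<^sup>2 + ?e\<^sup>2)))"
      proof (rule integral_mono)
        show "integrable M (\<lambda>t. ?e * (?e / ((t - \<kappa>\<^sup>2)\<^sup>2 + ?e\<^sup>2)))"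
          using le1 e by (intro integrable_const_bound[of _ 1]) (auto simp: abs_of_nonneg)
        show "indicator {\<kappa>\<^sup>2} t \<le> ?e * (?e / ((t - \<kappa>\<^sup>2)\<^sup>2 + ?e\<^sup>2))" for t
          using e by (auto simp: indicator_def power2_eq_square)
      qed (use sM in \<open>auto simp: integrable_indicator_iff spM emeasure_eq_measure\<close>)
      also have "\<dots> = ?e * Q \<kappa> ?e"
        unfolding Pois[OF \<kappa> \<epsilon>[of n]] by (rule integral_mult_right_zero)
      finally show ?thesis .
    qed
    moreover have "(\<lambda>n. \<epsilon> n * Q \<kappa> (\<epsilon> n)) \<longlonglongrightarrow> 0 * Q \<kappa> 0"
      by (intro tendsto_intros \<epsilon>0 Qlim \<kappa>)
    ultimately have "measure M {\<kappa>\<^sup>2} \<le> 0"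
      by (intro LIMSEQ_le_const[where X = "\<lambda>n. \<epsilon> n * Q \<kappa> (\<epsilon> n)"]) auto
    then show ?thesis using measure_nonneg[of M "{\<kappa>\<^sup>2}"] by linarith
  qed
  let ?A = "\<lambda>n t. arctan ((b\<^sup>2 - t) / \<epsilon> n) - arctan ((a\<^sup>2 - t) / \<epsilon> n)"
  have A0: "0 \<le> ?A n t" for n t
  proof -
    have "a\<^sup>2 \<le> b\<^sup>2" using ab by (intro power_mono) auto
    then show ?thesis
      using \<epsilon>[of n] by (simp add: arctan_le_iff divide_right_mono)
  qed
  have Api: "\<bar>?A n t\<bar> \<le> pi" for n t
    using arctan_bounded[of "(b\<^sup>2 - t) / \<epsilon> n"] arctan_bounded[of "(a\<^sup>2 - t) / \<epsilon> n"] by linarith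
  have Am [measurable]: "?A n \<in> borel_measurable borel" for n
    by (intro borel_measurable_continuous_onI continuous_intros) (use \<epsilon> in \<open>auto simp: less_imp_neq[symmetric]\<close>)
  \<comment> \<open>Tonelli: the integrands are nonnegative on the interval since a > 0, and the
    inner integral over \<kappa> is the difference of arctangents.\<close>
  have fub: "(LINT \<kappa>:{a..b}|lborel. 2 * \<kappa> * Q \<kappa> (\<epsilon> n)) = (LINT t|M. ?A n t)" for n
  proof -
    let ?e = "\<epsilon> n"
    let ?F = "\<lambda>\<kappa> t. 2 * \<kappa> * (?e / ((t - \<kappa>\<^sup>2)\<^sup>2 + ?e\<^sup>2))"
    have e: "0 < ?e" by (rule \<epsilon>)
    have pos: "0 < (t - \<kappa>\<^sup>2)\<^sup>2 + ?e\<^sup>2" for t \<kappa> :: real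
      using e by (intro add_nonneg_pos) auto
    have kb: "\<bar>?e / ((t - \<kappa>\<^sup>2)\<^sup>2 + ?e\<^sup>2)\<bar> \<le> 1 / ?e" for t \<kappa> :: real
    proof -
      have "?e / ((t - \<kappa>\<^sup>2)\<^sup>2 + ?e\<^sup>2) \<le> ?e / ?e\<^sup>2"
        using e by (intro divide_left_mono mult_pos_pos pos) auto
      then show ?thesis using e pos[of t \<kappa>] by (simp add: power2_eq_square)
    qed
    have ik: "integrable M (\<lambda>t. ?e / ((t - \<kappa>\<^sup>2)\<^sup>2 + ?e\<^sup>2))" for \<kappa> :: real
      by (rule integrable_const_bound[of _ "1 / ?e"]) (use kb in auto)
    have Qn: "ennreal (2 * \<kappa> * Q \<kappa> ?e) * indicator {a..b} \<kappa> = (\<integral>\<^sup>+t. ennreal (?F \<kappa> t) * indicator {a..b} \<kappa> \<partial>M)" for \<kappa>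
    proof (cases "\<kappa> \<in> {a..b}")
      case True
      then have \<kappa>: "0 \<le> \<kappa>" using ab by auto
      have "(\<integral>\<^sup>+t. ennreal (?F \<kappa> t) \<partial>M) = ennreal (LINT t|M. ?F \<kappa> t)"
      proof (rule nn_integral_eq_integral)
        show "integrable M (\<lambda>t. ?F \<kappa> t)" by (rule integrable_mult_right[OF ik])
      qed (use \<kappa> e in \<open>auto intro!: AE_I2 divide_nonneg_nonneg\<close>)
      also have "(LINT t|M. ?F \<kappa> t) = 2 * \<kappa> * Q \<kappa> ?e"
        unfolding Pois[OF True \<epsilon>[of n]] by (rule integral_mult_right_zero)
      finally show ?thesis using True by simp
    qed simp
    have Q0: "0 \<le> Q \<kappa> ?e" if "\<kappa> \<in> {a..b}" for \<kappa>
      unfolding Pois[OF that \<epsilon>[of n]] using e by (intro integral_nonneg_AE AE_I2 divide_nonneg_nonneg) auto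
    have "integrable lborel (\<lambda>\<kappa>. indicator {a..b} \<kappa> *\<^sub>R (2 * \<kappa> * Q \<kappa> ?e))"
      using \<epsilon>[of n] by (intro borel_integrable_compact compact_Icc continuous_intros Qc) (auto simp: less_imp_le)
    then have "ennreal (LINT \<kappa>:{a..b}|lborel. 2 * \<kappa> * Q \<kappa> ?e) = (\<integral>\<^sup>+\<kappa>. ennreal (indicator {a..b} \<kappa> *\<^sub>R (2 * \<kappa> * Q \<kappa> ?e)) \<partial>lborel)"
      unfolding set_lebesgue_integral_def using Q0 ab
      by (intro nn_integral_eq_integral[symmetric]) (auto simp: indicator_def intro!: AE_I2 mult_nonneg_nonneg)
    also have "\<dots> = (\<integral>\<^sup>+\<kappa>. ennreal (2 * \<kappa> * Q \<kappa> ?e) * indicator {a..b} \<kappa> \<partial>lborel)"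
      by (intro nn_integral_cong) (auto simp: indicator_def)
    also have "\<dots> = (\<integral>\<^sup>+\<kappa>. (\<integral>\<^sup>+t. ennreal (?F \<kappa> t) * indicator {a..b} \<kappa> \<partial>M) \<partial>lborel)"
      unfolding Qn ..
    also have "\<dots> = (\<integral>\<^sup>+t. (\<integral>\<^sup>+\<kappa>. ennreal (?F \<kappa> t) * indicator {a..b} \<kappa> \<partial>lborel) \<partial>M)"
      by (rule pair.Fubini'[symmetric]) measurable
    also have "\<dots> = (\<integral>\<^sup>+t. ennreal (?A n t) \<partial>M)"
      using ab e by (subst Poisson_kernel_integral) auto
    also have "\<dots> = ennreal (LINT t|M. ?A n t)"
      using A0 Api by (intro nn_integral_eq_integral integrable_const_bound[of _ pi]) auto
    finally show ?thesis
    proof (rule ennreal_inj[THEN iffD1, rotated 2])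
      show "0 \<le> (LINT \<kappa>:{a..b}|lborel. 2 * \<kappa> * Q \<kappa> ?e)"
        unfolding set_lebesgue_integral_def using Q0 ab
        by (intro integral_nonneg_AE AE_I2) (auto simp: indicator_def)
      show "0 \<le> (LINT t|M. ?A n t)"
        using A0 by (intro integral_nonneg_AE AE_I2) auto
    qed
  qed
  have lhs: "(\<lambda>n. LINT \<kappa>:{a..b}|lborel. 2 * \<kappa> * Q \<kappa> (\<epsilon> n)) \<longlonglongrightarrow> (LINT \<kappa>:{a..b}|lborel. 2 * \<kappa> * Q \<kappa> 0)"
    unfolding set_lebesgue_integral_def
  proof (rule integral_dominated_convergence[where w = "\<lambda>\<kappa>. indicator {a..b} \<kappa> * (2 * b * B)"])
    show "(\<lambda>\<kappa>. indicator {a..b} \<kappa> *\<^sub>R (2 * \<kappa> * Q \<kappa> 0)) \<in> borel_measurable lborel"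
      using \<eta> by (intro borel_measurable_integrable borel_integrable_compact compact_Icc continuous_intros Qc) auto
    show "(\<lambda>\<kappa>. indicator {a..b} \<kappa> *\<^sub>R (2 * \<kappa> * Q \<kappa> (\<epsilon> n))) \<in> borel_measurable lborel" for n
      using \<epsilon>[of n] by (intro borel_measurable_integrable borel_integrable_compact compact_Icc continuous_intros Qc) (auto simp: less_imp_le)
    show "integrable lborel (\<lambda>\<kappa>. indicator {a..b} \<kappa> * (2 * b * B))"
      by (intro integrable_mult_left integrable_real_indicator) (auto simp: emeasure_lborel_Icc_eq)
    show "AE \<kappa> in lborel. (\<lambda>n. indicator {a..b} \<kappa> *\<^sub>R (2 * \<kappa> * Q \<kappa> (\<epsilon> n))) \<longlonglongrightarrow> indicator {a..b} \<kappa> *\<^sub>R (2 * \<kappa> * Q \<kappa> 0)"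
    proof (intro AE_I2)
      fix \<kappa>
      show "(\<lambda>n. indicator {a..b} \<kappa> *\<^sub>R (2 * \<kappa> * Q \<kappa> (\<epsilon> n))) \<longlonglongrightarrow> indicator {a..b} \<kappa> *\<^sub>R (2 * \<kappa> * Q \<kappa> 0)"
        by (cases "\<kappa> \<in> {a..b}") (auto intro!: tendsto_intros Qlim)
    qed
    show "AE \<kappa> in lborel. norm (indicator {a..b} \<kappa> *\<^sub>R (2 * \<kappa> * Q \<kappa> (\<epsilon> n))) \<le> indicator {a..b} \<kappa> * (2 * b * B)" for n
    proof (intro AE_I2)
      fix \<kappa>
      show "norm (indicator {a..b} \<kappa> *\<^sub>R (2 * \<kappa> * Q \<kappa> (\<epsilon> n))) \<le> indicator {a..b} \<kappa> * (2 * b * B)"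
      proof (cases "\<kappa> \<in> {a..b}")
        case True
        then have "\<bar>\<kappa>\<bar> * \<bar>Q \<kappa> (\<epsilon> n)\<bar> \<le> b * B"
          using ab \<epsilon>[of n] by (intro mult_mono B) (auto simp: less_imp_le)
        then show ?thesis using True by (simp add: abs_mult)
      qed simp
    qed
  qed
  have ae: "AE t in M. t \<noteq> \<kappa>\<^sup>2" if "\<kappa> \<in> {a..b}" for \<kappa>
    by (rule AE_I[where N = "{\<kappa>\<^sup>2}"]) (use atom[OF that] sM in \<open>auto simp: emeasure_eq_measure\<close>)
  \<comment> \<open>At t = a^2 and t = b^2 the difference of arctangents tends to pi / 2, half the
    value inside; the absence of atoms makes these two points negligible.\<close>
  have ae_ab: "AE t in M. t \<noteq> a\<^sup>2" "AE t in M. t \<noteq> b\<^sup>2"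
    using ab by (auto intro!: ae)
  have rhs: "(\<lambda>n. LINT t|M. ?A n t) \<longlonglongrightarrow> (LINT t|M. pi * indicator {a\<^sup>2..<b\<^sup>2} t)"
  proof (rule integral_dominated_convergence[where w = "\<lambda>_. pi"])
    show "AE t in M. (\<lambda>n. ?A n t) \<longlonglongrightarrow> pi * indicator {a\<^sup>2..<b\<^sup>2} t"
      using ae_ab
    proof eventually_elim
      case (elim t)
      have "a\<^sup>2 < b\<^sup>2" using ab by (intro power_strict_mono) auto
      then have "sgn (b\<^sup>2 - t) * (pi / 2) - sgn (a\<^sup>2 - t) * (pi / 2) = pi * indicator {a\<^sup>2..<b\<^sup>2} t"
        using elim by (auto simp: indicator_def sgn_if)
      moreover have "(\<lambda>n. ?A n t) \<longlonglongrightarrow> sgn (b\<^sup>2 - t) * (pi / 2) - sgn (a\<^sup>2 - t) * (pi / 2)"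
        by (intro tendsto_diff arctan_scaled_tendsto \<epsilon> \<epsilon>0)
      ultimately show ?case by simp
    qed
  qed (use Api in auto)
  have "(LINT \<kappa>:{a..b}|lborel. 2 * \<kappa> * Q \<kappa> 0) = (LINT t|M. pi * indicator {a\<^sup>2..<b\<^sup>2} t)"
    using LIMSEQ_unique[OF lhs rhs[folded fub]] .
  also have "\<dots> = pi * measure M {a\<^sup>2..<b\<^sup>2}"
    using sM by (simp add: spM)
  finally show ?thesis .
qed

section \<open>The spectral density\<close>

text \<open>The principal root of a number with nonnegative imaginary part lies in the closed upper
  half-plane, so energies approached from above give admissible k; |k|^2 = |z| \<ge> \<kappa>^2
  gives the distance from 0.\<close>

lemma
  fixes \<kappa> \<epsilon> :: real
  assumes "0 < \<kappa>" "0 \<le> \<epsilon>"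
  defines "z \<equiv> of_real (\<kappa>\<^sup>2) + \<i> * of_real \<epsilon>"
  shows csqrt_uhp: "csqrt z \<in> uhp \<kappa>"
    and Im_csqrt_pos: "0 < \<epsilon> \<Longrightarrow> 0 < Im (csqrt z)"
proof -
  have Re: "Re z = \<kappa>\<^sup>2" and Im: "Im z = \<epsilon>" by (simp_all add: z_def)
  have mod: "\<kappa>\<^sup>2 \<le> cmod z" using complex_Re_le_cmod[of z] Re by simp
  have "(cmod (csqrt z))\<^sup>2 = cmod z"
    by (simp flip: norm_power)
  then have "\<kappa> \<le> cmod (csqrt z)"
    using mod assms(1) by (intro power2_le_imp_le[of \<kappa>]) auto
  moreover have "0 \<le> Im (csqrt z)"
    using assms(2) Re Im mod by (auto simp: sgn_if)
  ultimately show "csqrt z \<in> uhp \<kappa>" by (simp add: uhp_def)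
  assume "0 < \<epsilon>"
  then have "\<kappa>\<^sup>2 < cmod z"
  proof -
    have "(\<kappa>\<^sup>2)\<^sup>2 < (cmod z)\<^sup>2"
      unfolding cmod_power2 Re Im using \<open>0 < \<epsilon>\<close> by simp
    then show ?thesis by (rule power2_less_imp_less) simp
  qed
  then show "0 < Im (csqrt z)"
    using \<open>0 < \<epsilon>\<close> Re Im by (simp add: sgn_if)
qed

lemma csqrt_energy_continuous:
  fixes S :: "(real \<times> real) set"
  assumes "\<And>\<kappa> \<epsilon>. (\<kappa>, \<epsilon>) \<in> S \<Longrightarrow> 0 < \<kappa>"
  shows "continuous_on S (\<lambda>(\<kappa>, \<epsilon>). csqrt (of_real (\<kappa>\<^sup>2) + \<i> * of_real \<epsilon>))"
proof -
  have "continuous_on S (\<lambda>x. csqrt (of_real ((fst x)\<^sup>2) + \<i> * of_real (snd x)))"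
  proof (rule continuous_on_compose2[OF continuous_on_csqrt])
    show "(\<lambda>x. of_real ((fst x)\<^sup>2) + \<i> * of_real (snd x)) ` S \<subseteq> - \<real>\<^sub>\<le>\<^sub>0"
    proof clarify
      fix \<kappa> \<epsilon> assume "(\<kappa>, \<epsilon>) \<in> S" "of_real ((fst (\<kappa>, \<epsilon>))\<^sup>2) + \<i> * of_real (snd (\<kappa>, \<epsilon>)) \<in> (\<real>\<^sub>\<le>\<^sub>0 :: complex set)"
      then have "\<kappa>\<^sup>2 \<le> 0" by (auto simp: complex_nonpos_Reals_iff)
      then show False using assms[OF \<open>(\<kappa>, \<epsilon>) \<in> S\<close>] by simp
    qed
  qed (intro continuous_intros)
  then show ?thesis by (simp add: case_prod_beta')
qed

context short_range_potential begin

text \<open>Compactness: bad points with \<epsilon> shrinking to 0 would accumulate at some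
  (\<kappa>, 0) with \<kappa> in [a, b], near which every k in \<open>uhp c\<close> is
  regular.\<close>

lemma regular_neighbourhood:
  assumes ab: "c \<le> a" and regular: "\<And>\<kappa>. \<kappa> \<in> {a..b} \<Longrightarrow> regular (of_real \<kappa>)"
  obtains \<eta> where "0 < \<eta>"
    "\<And>\<kappa> \<epsilon>. \<kappa> \<in> {a..b} \<Longrightarrow> \<epsilon> \<in> {0..\<eta>} \<Longrightarrow> regular (csqrt (of_real (\<kappa>\<^sup>2) + \<i> * of_real \<epsilon>))"
proof (rule ccontr)
  let ?k = "\<lambda>(\<kappa>, \<epsilon>). csqrt (of_real (\<kappa>\<^sup>2) + \<i> * of_real \<epsilon>)"
  assume "\<not> thesis"
  then have "\<exists>x. fst x \<in> {a..b} \<and> snd x \<in> {0..1 / Suc n} \<and> \<not> regular (?k x)" for n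
    using that[of "1 / Suc n"] by fastforce
  then obtain x where x: "\<And>n. fst (x n) \<in> {a..b}" "\<And>n. snd (x n) \<in> {0..1 / Suc n}" "\<And>n. \<not> regular (?k (x n))"
    by metis
  have a0: "0 < a" using ab c_pos by simp
  have xS: "x n \<in> {a..b} \<times> {0..1}" for n
  proof -
    have "snd (x n) \<le> 1 / real (Suc n)" "1 / real (Suc n) \<le> 1" using x(2)[of n] by auto
    then have "snd (x n) \<le> 1" by (rule order_trans)
    then show ?thesis using x(1,2)[of n] by (auto simp: mem_Times_iff)
  qed
  with compact_Times[OF compact_Icc compact_Icc, of a b 0 "1::real"]
  obtain l r where l: "l \<in> {a..b} \<times> {0..1}" and r: "strict_mono r" and lim: "(x \<circ> r) \<longlonglongrightarrow> l"
    unfolding compact_def by meson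
  have "(\<lambda>n. 1 / real (Suc n)) \<longlonglongrightarrow> 0"
    using LIMSEQ_inverse_real_of_nat by (simp add: inverse_eq_divide)
  then have "(\<lambda>n. 1 / real (Suc (r n))) \<longlonglongrightarrow> 0"
    using r by (rule LIMSEQ_subseq_LIMSEQ[unfolded o_def])
  then have "(\<lambda>n. snd (x (r n))) \<longlonglongrightarrow> 0"
    by (rule Lim_null_comparison[rotated]) (use x(2) in auto)
  moreover have "(\<lambda>n. snd (x (r n))) \<longlonglongrightarrow> snd l"
    using tendsto_snd[OF lim] by (simp add: o_def)
  ultimately have l0: "snd l = 0" by (rule LIMSEQ_unique[symmetric])
  define \<kappa> where "\<kappa> = fst l"
  have \<kappa>: "\<kappa> \<in> {a..b}" "l = (\<kappa>, 0)" using l l0 by (auto simp: \<kappa>_def mem_Times_iff prod_eq_iff)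
  then have "0 < \<kappa>" using a0 by auto
  then have kl: "?k l = of_real \<kappa>"
    unfolding \<kappa>(2) by (simp add: csqrt_of_real_nonneg del: of_real_power)
  obtain C where C: "regular_const (of_real \<kappa>) C" using regular[OF \<kappa>(1)] by (auto simp: regular_def)
  then have "\<forall>\<^sub>F k in at (of_real \<kappa>) within uhp c. regular k"
    using regular_eventually[OF C] by (auto elim!: eventually_mono intro: regular_constD)
  then obtain d where d0: "0 < d" and d': "\<And>k. k \<in> uhp c \<Longrightarrow> k \<noteq> of_real \<kappa> \<Longrightarrow> dist k (of_real \<kappa>) < d \<Longrightarrow> regular k"
    unfolding eventually_at by blast
  have d: "regular k" if "k \<in> uhp c" "dist k (of_real \<kappa>) < d" for k
  proof (cases "k = of_real \<kappa>")
    case True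
    then show ?thesis using regular[OF \<kappa>(1)] by simp
  qed (rule d'[OF that(1) _ that(2)])
  have cont: "continuous_on ({a..b} \<times> {0..1}) ?k"
    by (rule csqrt_energy_continuous) (use a0 in auto)
  have "(?k \<circ> (x \<circ> r)) \<longlonglongrightarrow> ?k l"
    by (rule cont[unfolded continuous_on_sequentially, rule_format, OF l]) (use xS lim in simp)
  then have "(\<lambda>n. ?k (x (r n))) \<longlonglongrightarrow> ?k l"
    by (simp only: o_def)
  then have "\<forall>\<^sub>F n in sequentially. dist (?k (x (r n))) (of_real \<kappa>) < d"
    unfolding kl using d0 by (rule tendstoD)
  then obtain n where n: "dist (?k (x (r n))) (of_real \<kappa>) < d"
    by (auto simp: eventually_sequentially)
  have "?k (x (r n)) \<in> uhp c"
  proof -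
    obtain k e where xe: "x (r n) = (k, e)" by (cases "x (r n)")
    then have "k \<in> {a..b}" "0 \<le> e" using x(1,2)[of "r n"] by auto
    then show ?thesis
      using csqrt_uhp[of k e] a0 ab by (auto simp: xe uhp_def)
  qed
  from d[OF this n] x(3)[of "r n"] show False by simp
qed

lemma spectral_density:
  assumes H: "schroedinger_operator V H" and P: "spectral_measure_of H P" and f: "f \<in> test_functions"
    and ab: "c \<le> a" "a < b" and regular: "\<And>\<kappa>. \<kappa> \<in> {a..b} \<Longrightarrow> regular (of_real \<kappa>)"
  defines "g \<equiv> \<lambda>y. cnj (f y)"
  shows "(LINT \<kappa>:{a..b}|lborel. 2 * \<kappa> * Im (LINT x|lborel. sol g (of_real \<kappa>) x * cnj (g x)))
    = pi * (l2_norm (P {a\<^sup>2..<b\<^sup>2} f))\<^sup>2"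
proof -
  interpret spectral_resolution H P
    using H P by unfold_locales (auto simp: schroedinger_operator_def)
  have fL: "f \<in> L2" and fI: "integrable lborel f"
    using f by (auto intro: test_functions_L2 test_functions_integrable)
  have g: "integrable lborel g" unfolding g_def using fI by simp
  have a0: "0 < a" using ab c_pos by simp
  let ?z = "\<lambda>\<kappa> \<epsilon>. of_real (\<kappa>\<^sup>2) + \<i> * of_real \<epsilon> :: complex"
  obtain \<eta> where \<eta>: "0 < \<eta>" "\<And>\<kappa> \<epsilon>. \<kappa> \<in> {a..b} \<Longrightarrow> \<epsilon> \<in> {0..\<eta>} \<Longrightarrow> regular (csqrt (?z \<kappa> \<epsilon>))"
    using regular_neighbourhood[OF ab(1) regular] by blast
  define Q where "Q \<kappa> \<epsilon> = Im (LINT x|lborel. sol g (csqrt (?z \<kappa> \<epsilon>)) x * cnj (g x))" for \<kappa> \<epsilon>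
  have "(LINT \<kappa>:{a..b}|lborel. 2 * \<kappa> * Q \<kappa> 0) = pi * measure (sdist f) {a\<^sup>2..<b\<^sup>2}"
  proof (rule Stieltjes_inversion[OF finite_measure_sdist[OF fL] sets_sdist a0 ab(2) \<eta>(1)])
    let ?S = "{a..b} \<times> {0..\<eta>}"
    let ?k = "\<lambda>(\<kappa>, \<epsilon>). csqrt (?z \<kappa> \<epsilon>)"
    have "continuous_on ?S (\<lambda>p. LINT x|lborel. sol g (?k p) x * cnj (g x))"
    proof (rule continuous_on_compose2[OF pairing_continuous_on[OF g]])
      show "continuous_on ?S ?k"
        by (rule csqrt_energy_continuous) (use a0 in auto)
      show "\<And>k. k \<in> ?k ` ?S \<Longrightarrow> regular k" using \<eta>(2) by auto
    qed (use g in auto)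
    then have "continuous_on ?S (\<lambda>p. Im (LINT x|lborel. sol g (?k p) x * cnj (g x)))"
      by (intro continuous_intros)
    then show "continuous_on ?S (\<lambda>(\<kappa>, \<epsilon>). Q \<kappa> \<epsilon>)"
      by (simp add: Q_def case_prod_beta')
  next
    fix \<kappa> \<epsilon> assume \<kappa>: "\<kappa> \<in> {a..b}" and \<epsilon>: "0 < \<epsilon>" "\<epsilon> \<le> \<eta>"
    let ?k = "csqrt (?z \<kappa> \<epsilon>)" and ?\<zeta> = "cnj (?z \<kappa> \<epsilon>)"
    have k: "regular ?k" "0 < Im ?k"
      using \<eta>(2)[OF \<kappa>] \<epsilon> Im_csqrt_pos[of \<kappa> \<epsilon>] \<kappa> a0 by auto
    let ?u = "\<lambda>x. cnj (sol g ?k x)"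
    \<comment> \<open>The graph relation holds at the energy cnj (k^2) = \<kappa>^2 - i \<epsilon>,
      which yields the Poisson kernel of width \<epsilon> centred at \<kappa>^2.\<close>
    have "(?u, \<lambda>x. f x + ?\<zeta> * ?u x) \<in> H"
      using sol_in_graph[OF H f k] unfolding g_def power2_csqrt .
    moreover have "Im ?\<zeta> < 0" using \<epsilon> by simp
    ultimately have "Im (l2_inner f ?u) = (LINT t|sdist f. (- Im ?\<zeta>) / (cmod (of_real t - ?\<zeta>))\<^sup>2)"
      by (intro Poisson_integral_eq fL)
    moreover have "l2_inner f ?u = (LINT x|lborel. sol g ?k x * cnj (g x))"
      by (simp add: l2_inner_def g_def mult.commute)
    moreover have "(cmod (of_real t - ?\<zeta>))\<^sup>2 = (t - \<kappa>\<^sup>2)\<^sup>2 + \<epsilon>\<^sup>2" for t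
      by (simp add: cmod_power2)
    ultimately show "Q \<kappa> \<epsilon> = (LINT t|sdist f. \<epsilon> / ((t - \<kappa>\<^sup>2)\<^sup>2 + \<epsilon>\<^sup>2))"
      by (simp add: Q_def)
  qed
  moreover have "(LINT \<kappa>:{a..b}|lborel. 2 * \<kappa> * Q \<kappa> 0)
      = (LINT \<kappa>:{a..b}|lborel. 2 * \<kappa> * Im (LINT x|lborel. sol g (of_real \<kappa>) x * cnj (g x)))"
  proof (rule set_lebesgue_integral_cong)
    show "\<forall>\<kappa>. \<kappa> \<in> {a..b} \<longrightarrow> 2 * \<kappa> * Q \<kappa> 0 = 2 * \<kappa> * Im (LINT x|lborel. sol g (of_real \<kappa>) x * cnj (g x))"
      using a0 by (auto simp: Q_def csqrt_of_real_nonneg simp del: of_real_power)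
  qed simp
  ultimately show ?thesis
    using measure_sdist[OF fL, of "{a\<^sup>2..<b\<^sup>2}"] by simp
qed

lemma sharp_eq: "sharp V f \<xi> = of_real (1 / sqrt (2 * pi)) * cnj (LINT x|lborel. cnj (f x) * eigenfn V x \<xi>)"
  unfolding sharp_def by (simp flip: Bochner_Integration.integral_cnj)

text \<open>\<open>psi\<close> is chosen separately for each \<xi>, so measurability of
  \<open>sharp\<close> in \<xi> is not visible from its definition; the expression through the
  source gives continuity, and with it integrability on compact intervals.\<close>

lemma sharp_continuous_on:
  assumes f: "integrable lborel f" and S: "\<And>\<xi>. \<xi> \<in> S \<Longrightarrow> regular (of_real \<bar>\<xi>\<bar>)"
  shows "continuous_on S (sharp V f)"
proof -
  let ?g = "\<lambda>y. cnj (f y)"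
  have g: "integrable lborel ?g" using f by simp
  have "continuous_on S (\<lambda>\<xi>. of_real (1 / sqrt (2 * pi)) * cnj (LINT x|lborel. source ?g (of_real \<bar>\<xi>\<bar>) x * exp (\<i> * of_real (x * \<xi>))))"
    by (intro continuous_intros source_fourier_continuous_on g S)
  then show ?thesis
    by (rule continuous_on_cong[OF refl, THEN iffD1, rotated]) (simp add: sharp_eq eigenfn_pairing[OF S g])
qed

end

theorem lemma7p1:
  fixes V :: "real \<Rightarrow> real" and H :: l2_graph
    and P :: "real set \<Rightarrow> (real \<Rightarrow> complex) \<Rightarrow> real \<Rightarrow> complex"
    and E0 :: "real set" and f :: "real \<Rightarrow> complex" and \<alpha> \<beta> :: real
  assumes "integrable lborel V" and "integrable lborel (\<lambda>x. (V x)\<^sup>2)"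
    and "schroedinger_operator V H"
    and "spectral_measure_of H P"
    and "exceptional_set V E0"
    and "f \<in> test_functions"
    and "0 < \<alpha>" and "\<alpha> < \<beta>"
    and "{sqrt \<alpha>..sqrt \<beta>} \<inter> E0 = {}"
  shows "set_integrable lborel {\<xi>. \<alpha> \<le> \<xi>\<^sup>2 \<and> \<xi>\<^sup>2 \<le> \<beta>} (\<lambda>\<xi>. (cmod (sharp V f \<xi>))\<^sup>2) \<and>
    (l2_norm (P {\<alpha>..<\<beta>} f))\<^sup>2 =
      (LINT \<xi>:{\<xi>. \<alpha> \<le> \<xi>\<^sup>2 \<and> \<xi>\<^sup>2 \<le> \<beta>}|lborel. (cmod (sharp V f \<xi>))\<^sup>2)"
proof -
  define a b where "a = sqrt \<alpha>" and "b = sqrt \<beta>"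
  have ab: "0 < a" "a < b" "a\<^sup>2 = \<alpha>" "b\<^sup>2 = \<beta>"
    using assms(7,8) by (auto simp: a_def b_def)
  \<comment> \<open>Taking the left end point as lower bound on |k| makes all of [a, b]
    admissible.\<close>
  interpret short_range_potential V a
    using assms(1,2) ab(1) by unfold_locales
  have regular: "regular (of_real \<kappa>)" if "\<kappa> \<in> {a..b}" for \<kappa>
  proof (rule regular_of_inverse)
    show "a \<le> \<kappa>" using that by simp
    have "0 < \<kappa>" using that ab(1) by simp
    then have "\<kappa> \<in> {0<..} - E0" using that assms(9) by (auto simp: a_def b_def)
    then show "l2_has_bounded_inverse (\<lambda>\<phi> x. \<phi> x + T_op V \<kappa> \<phi> x)"
      using assms(5) by (simp add: exceptional_set_def)
  qed
  define g where "g = (\<lambda>y. cnj (f y))"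
  have fI: "integrable lborel f" by (rule test_functions_integrable[OF assms(6)])
  have g: "integrable lborel g" unfolding g_def using fI by simp
  define s where "s \<xi> = (cmod (sharp V f \<xi>))\<^sup>2" for \<xi>
  have cont: "continuous_on {a..b} s" "continuous_on {-b..-a} s"
    unfolding s_def by (intro continuous_intros sharp_continuous_on fI regular; use ab(1) in force)+
  have cont': "continuous_on {a..b} (\<lambda>\<xi>. s (- \<xi>))"
    by (rule continuous_on_compose2[OF cont(2)]) (auto intro!: continuous_intros)
  have set: "{\<xi>. \<alpha> \<le> \<xi>\<^sup>2 \<and> \<xi>\<^sup>2 \<le> \<beta>} = {-b..-a} \<union> {a..b}"
  proof -
    have "\<alpha> \<le> \<xi>\<^sup>2 \<longleftrightarrow> a \<le> \<bar>\<xi>\<bar>" "\<xi>\<^sup>2 \<le> \<beta> \<longleftrightarrow> \<bar>\<xi>\<bar> \<le> b" for \<xi>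
      using ab abs_le_square_iff[of a \<xi>] abs_le_square_iff[of \<xi> b] by auto
    then show ?thesis using ab by (auto simp: abs_if)
  qed
  have int: "set_integrable lborel {a..b} s" "set_integrable lborel {-b..-a} s" "set_integrable lborel {a..b} (\<lambda>\<xi>. s (- \<xi>))"
    by (intro borel_integrable_atLeastAtMost' cont cont')+
  \<comment> \<open>The factor 1 / (2 pi) of the squared transform against 1 / (4 \<kappa>) in
    \<open>Im_pairing\<close> leaves 2 \<kappa> / pi: the Jacobian of \<kappa>^2 over the constant
    of Stieltjes inversion.\<close>
  have dens: "s \<kappa> + s (- \<kappa>) = 1 / pi * (2 * \<kappa> * Im (LINT x|lborel. sol g (of_real \<kappa>) x * cnj (g x)))" if "\<kappa> \<in> {a..b}" for \<kappa>
  proof -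
    have \<kappa>: "0 < \<kappa>" using that ab(1) by simp
    have s: "s \<xi> = (cmod (LINT x|lborel. g x * eigenfn V x \<xi>))\<^sup>2 / (2 * pi)" for \<xi>
      by (simp add: s_def sharp_eq norm_mult norm_divide power_mult_distrib power_divide g_def)
    show ?thesis
      unfolding Im_pairing[OF regular[OF that] \<kappa> g] s using \<kappa> by (simp add: field_simps)
  qed
  have refl: "(LINT \<xi>:{-b..-a}|lborel. s \<xi>) = (LINT \<xi>:{a..b}|lborel. s (- \<xi>))"
    unfolding set_lebesgue_integral_def
    by (subst lborel_integral_real_affine[where c = "-1" and t = 0])
       (auto intro!: Bochner_Integration.integral_cong simp: indicator_def)
  have "(LINT \<xi>:{-b..-a} \<union> {a..b}|lborel. s \<xi>) = (LINT \<xi>:{-b..-a}|lborel. s \<xi>) + (LINT \<xi>:{a..b}|lborel. s \<xi>)"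
    by (rule set_integral_Un) (use int ab in auto)
  also have "\<dots> = (LINT \<kappa>:{a..b}|lborel. s \<kappa> + s (- \<kappa>))"
    unfolding refl using int by (subst set_integral_add(2)) auto
  also have "\<dots> = (LINT \<kappa>:{a..b}|lborel. 1 / pi * (2 * \<kappa> * Im (LINT x|lborel. sol g (of_real \<kappa>) x * cnj (g x))))"
    by (rule set_lebesgue_integral_cong) (use dens in auto)
  also have "\<dots> = 1 / pi * (LINT \<kappa>:{a..b}|lborel. 2 * \<kappa> * Im (LINT x|lborel. sol g (of_real \<kappa>) x * cnj (g x)))"
    by (rule set_integral_mult_right)
  also have "\<dots> = (l2_norm (P {\<alpha>..<\<beta>} f))\<^sup>2"
    using spectral_density[OF assms(3,4,6) order_refl ab(2) regular] by (simp add: g_def ab)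
  finally show ?thesis
    unfolding set using set_integrable_Un[OF int(2,1)] by (simp add: s_def[abs_def])
qed

end
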